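(* Let $p\in\mathbb{C}[z_1,z_2]$ be a complex conic. (1) The boundary $\partial\mathcal{I}(p)$ may not be algebraic (i.e. there exist complex conics for which it is not). The algebraic degree of any irreducible component in its Zariski closure is at most $8$, and this bound is tight. If $\mathcal{I}(p)^{\mathsf c}$ has no bounded components, then $\partial\mathcal{I}(p)$ is algebraic and it consists of irreducible pieces of degree at most two. (2) If all coefficients of $p$ are real, then $\partial\mathcal{I}(p)$ is algebraic and it consists of irreducible pieces of degree at most two.
   Context: A complex conic is a polynomial $p=az_1^2+bz_1z_2+cz_2^2+dz_1+ez_2+f$ with $a,\dots,f\in\mathbb{C}$ of total degree exactly two. The imaginary projection is $\mathcal{I}(p)=\{(\operatorname{Im} z_1,\operatorname{Im} z_2) : p(z_1,z_2)=0,\ (z_1,z_2)\in\mathbb{C}^2\}\subseteq\mathbb{R}^2$; $S^{\mathsf c}$ is the complement and $\overline{S}$ the Euclidean closure of $S$ in $\mathbb{R}^2$; $\partial\mathcal{I}(p)=\overline{\mathcal{I}(p)}\cap\overline{\mathcal{I}(p)^{\mathsf c}}$. Components of $\mathcal{I}(p)^{\mathsf c}$ are connected components. A subset of $\mathbb{R}^2$ is algebraic if it is closed in the Zariski topology (the real zero set of polynomials). The algebraic degree of a set is the degree of its Zariski closure. *)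

theory Defs
  imports
    "HOL-Analysis.Analysis"
    "HOL-Computational_Algebra.Polynomial_Factorial"
    "HOL-Computational_Algebra.Field_as_Ring"
begin

text \<open>
  Bivariate polynomials over a ring are elements of the type \<open>'a poly poly\<close>: the monomial
  $c\, z_1^i z_2^j$ is stored as \<open>coeff (coeff p j) i = c\<close>, i.e. the outer variable is $z_2$ and
  the coefficients are polynomials in $z_1$.
\<close>

definition eval2 :: "'a::comm_semiring_1 poly poly \<Rightarrow> 'a \<Rightarrow> 'a \<Rightarrow> 'a" where
  "eval2 p z1 z2 = poly (poly p [:z2:]) z1"

text \<open>The zero polynomial gets total degree \<open>0\<close>.\<close>

definition total_degree :: "'a::zero poly poly \<Rightarrow> nat" where
  "total_degree p = Max (insert 0 {i + j | i j. coeff (coeff p j) i \<noteq> 0})"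

definition complex_conic :: "complex poly poly \<Rightarrow> bool" where
  "complex_conic p \<longleftrightarrow> total_degree p = 2"

lemma eval2_conic:
  "eval2 [:[:f, d, a:], [:e, b:], [:c:]:] z1 z2 =
     a * z1\<^sup>2 + b * z1 * z2 + c * z2\<^sup>2 + d * z1 + e * z2 + (f :: complex)"
  by (simp add: eval2_def power2_eq_square algebra_simps)

lemma complex_conic_iff:
  "complex_conic p \<longleftrightarrow>
     (\<exists>a b c d e f. (a \<noteq> 0 \<or> b \<noteq> 0 \<or> c \<noteq> 0) \<and> p = [:[:f, d, a:], [:e, b:], [:c:]:])"
proof
  let ?M = "{i + j | i j. coeff (coeff p j) i \<noteq> 0}"
  have fin: "finite ?M"
  proof (rule finite_subset)
    show "?M \<subseteq> (\<lambda>(j, i). i + j) ` (SIGMA j:{..degree p}. {..degree (coeff p j)})"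
    proof
      fix n assume "n \<in> ?M"
      then obtain i j where n: "n = i + j" and nz: "coeff (coeff p j) i \<noteq> 0" by blast
      from nz have "coeff p j \<noteq> 0" by (metis coeff_0)
      with nz have "(j, i) \<in> (SIGMA j:{..degree p}. {..degree (coeff p j)})"
        by (simp add: le_degree)
      with n show "n \<in> (\<lambda>(j, i). i + j) ` (SIGMA j:{..degree p}. {..degree (coeff p j)})"
        by (metis (no_types, lifting) image_eqI case_prod_conv)
    qed
    show "finite ((\<lambda>(j, i). i + j) ` (SIGMA j:{..degree p}. {..degree (coeff p j)}))"
      by auto
  qed
  assume "complex_conic p"
  then have M: "Max (insert 0 ?M) = 2"
    by (simp add: complex_conic_def total_degree_def)
  have zero: "coeff (coeff p j) i = 0" if "i + j > 2" for i j
  proof (rule ccontr)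
    assume "coeff (coeff p j) i \<noteq> 0"
    then have "i + j \<in> insert 0 ?M" by blast
    then show False using Max_ge[of "insert 0 ?M" "i + j"] fin M that by simp
  qed
  have "2 \<in> insert 0 ?M" 
  proof -
    have "Max (insert 0 ?M) \<in> insert 0 ?M" by (rule Max_in) (use fin in auto)
    then show ?thesis unfolding M .
  qed
  then obtain i j where ij: "i + j = 2" "coeff (coeff p j) i \<noteq> 0" by auto
  let ?c = "\<lambda>i j. coeff (coeff p j) i"
  have "p = [:[:?c 0 0, ?c 1 0, ?c 2 0:], [:?c 0 1, ?c 1 1:], [:?c 0 2:]:]"
  proof (intro poly_eqI)
    fix j i
    show "coeff (coeff p j) i =
      coeff (coeff [:[:?c 0 0, ?c 1 0, ?c 2 0:], [:?c 0 1, ?c 1 1:], [:?c 0 2:]:] j) i"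
    proof (cases "i + j > 2")
      case True
      then show ?thesis
        by (auto simp: zero coeff_pCons split: nat.split)
    next
      case False
      then have "(i, j) \<in> {(0,0),(1,0),(2,0),(0,1),(1,1),(0,2)}" by auto
      then show ?thesis by (auto simp: numeral_2_eq_2)
    qed
  qed
  moreover have "?c 2 0 \<noteq> 0 \<or> ?c 1 1 \<noteq> 0 \<or> ?c 0 2 \<noteq> 0"
  proof -
    from ij(1) consider "i = 0" "j = 2" | "i = 1" "j = 1" | "i = 2" "j = 0" by linarith
    then show ?thesis using ij(2) by cases auto
  qed
  ultimately show "\<exists>a b c d e f. (a \<noteq> 0 \<or> b \<noteq> 0 \<or> c \<noteq> 0) \<and> p = [:[:f, d, a:], [:e, b:], [:c:]:]"
    by blast
next
  assume "\<exists>a b c d e f. (a \<noteq> 0 \<or> b \<noteq> 0 \<or> c \<noteq> 0) \<and> p = [:[:f, d, a:], [:e, b:], [:c:]:]"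
  then obtain a b c d e f where abc: "a \<noteq> 0 \<or> b \<noteq> 0 \<or> c \<noteq> 0"
    and p: "p = [:[:f, d, a:], [:e, b:], [:c:]:]" by blast
  let ?M = "{i + j | i j. coeff (coeff p j) i \<noteq> 0}"
  have "i + j \<le> 2" if "coeff (coeff p j) i \<noteq> 0" for i j
    using that by (auto simp: p coeff_pCons split: nat.split_asm if_split_asm)
  then have le: "?M \<subseteq> {..2}" by auto
  then have fin: "finite ?M" by (rule finite_subset) simp
  have "coeff (coeff p 0) 2 = a" "coeff (coeff p 1) 1 = b" "coeff (coeff p 2) 0 = c"
    by (simp_all add: p numeral_2_eq_2)
  with abc have "2 + 0 \<in> ?M \<or> 1 + 1 \<in> ?M \<or> 0 + 2 \<in> ?M" by blast
  then have "2 \<in> ?M" by (simp add: numeral_2_eq_2)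
  then have "Max (insert 0 ?M) = 2"
    using fin le by (intro Max_eqI) auto
  then show "complex_conic p" by (simp add: complex_conic_def total_degree_def)
qed

definition imaginary_projection :: "complex poly poly \<Rightarrow> (real \<times> real) set" where
  "imaginary_projection p = {(Im z1, Im z2) | z1 z2. eval2 p z1 z2 = 0}"

definition algebraic_set :: "(real \<times> real) set \<Rightarrow> bool" where
  "algebraic_set Z \<longleftrightarrow> (\<exists>F :: real poly poly set. Z = {(x, y). \<forall>f\<in>F. eval2 f x y = 0})"

definition zariski_closure :: "(real \<times> real) set \<Rightarrow> (real \<times> real) set" where
  "zariski_closure S = algebraic_set hull S"

definition zariski_irreducible :: "(real \<times> real) set \<Rightarrow> bool" where
  "zariski_irreducible Z \<longleftrightarrow> Z \<noteq> {} \<and>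
     (\<forall>A B. algebraic_set A \<longrightarrow> algebraic_set B \<longrightarrow> Z \<subseteq> A \<union> B \<longrightarrow> Z \<subseteq> A \<or> Z \<subseteq> B)"

definition irreducible_components :: "(real \<times> real) set \<Rightarrow> (real \<times> real) set set" where
  "irreducible_components V =
     {Z. Z \<subseteq> V \<and> zariski_irreducible Z \<and>
         (\<forall>W. Z \<subseteq> W \<longrightarrow> W \<subseteq> V \<longrightarrow> zariski_irreducible W \<longrightarrow> W = Z)}"

definition vanishing_ideal :: "(real \<times> real) set \<Rightarrow> real poly poly set" where
  "vanishing_ideal S = {f. \<forall>(x, y)\<in>S. eval2 f x y = 0}"

text \<open>
  The degree of a subset of the real plane is the degree of its Zariski closure $Z$, by dimension:
  the plane itself has degree 1, a finite set has as degree its number of points, and otherwise the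
  degree is that of the one-dimensional part of $Z$. The vanishing ideal of the latter is principal,
  generated by the greatest common divisor of the polynomials vanishing on $Z$; so for an
  irreducible curve this is the degree of the irreducible generator of its vanishing ideal.
\<close>

definition algebraic_degree :: "(real \<times> real) set \<Rightarrow> nat" where
  "algebraic_degree S =
     (let Z = zariski_closure S in
      if Z = UNIV then 1
      else if finite Z then card Z
      else total_degree (Gcd (vanishing_ideal Z)))"

end

theory Submission
  imports Defs
begin

text \<open>
  A zero $x + iy$ of $p$ with prescribed imaginary part $y$ is a common real zero $x$ of the two
  quadrics $\operatorname{Re} p(x + iy)$ and $\operatorname{Im} p(x + iy)$. Real affine changes of
  coordinates (with complex translations) and a factorization of the leading form into linear forms
  leave few normal forms. If both factors are proportional to real forms, or if they are complex
  conjugate, the boundary is computed explicitly and consists of curves of degree at most two.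

  Otherwise some factor is $z_1 + i z_2$ after a real change of coordinates. Its value $u$ then
  ranges over all of $\mathbb{C}$ while $y$ is fixed, and Brouwer's fixed point theorem solves the
  equation in $u$ for all large $y$. So the complement of the imaginary projection is bounded, and it
  is empty if it has no bounded component. If the leading form has no real zero, the imaginary
  projection is closed and, by an open mapping argument, the boundary consists of points $y$ at which
  the two quadrics are tangent. There the discriminant of the cubic
  $\det(\lambda M(y) + \mu \overline{M(y)})$ vanishes, $M(y)$ being the symmetric matrix of
  $p(x + iy)$. The outer coefficients of this cubic do not depend on $y$ and the inner ones are
  conjugate and of degree two in $y$, whence a curve of degree eight. If the leading form has exactly
  one real zero, the intermediate value theorem shows that the boundary lies on a line.

  The conic $z_2(z_1 - i z_2) - i$ has a segment as boundary. For $z_1^2 + 2 i z_2^2 + 1$ the boundary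
  contains infinitely many of the points $(\sqrt{1 - k^4}, k^3)/(1 + k^4)$, and the curve of degree
  eight through them is irreducible.
\<close>

text \<open>Where the leading form has a nonreal factor, the boundary is in general only shown to
  lie on a curve. For degree bounds this is enough: a polynomial vanishing on an irreducible set is
  a multiple of the greatest common divisor that defines the degree of that set. Tightness needs
  more, since the boundary is a proper part of the real octic: every polynomial vanishing on this
  part has to be divisible by the octic.

  The case of exactly one real zero of the leading form stands apart because zeros of the conic may
  then escape to infinity over bounded imaginary parts. The projection need not be closed, so a
  boundary point need not come from a tangency.\<close>

section \<open>Total degree of bivariate polynomials\<close>

lemma total_degree_ge:
  assumes "coeff (coeff p j) i \<noteq> 0"
  shows "i + j \<le> total_degree p"
proof -
  let ?M = "{i + j | i j. coeff (coeff p j) i \<noteq> 0}"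
  have "?M \<subseteq> (\<lambda>(j, i). i + j) ` (SIGMA j:{..degree p}. {..degree (coeff p j)})"
  proof
    fix n assume "n \<in> ?M"
    then obtain i j where n: "n = i + j" and nz: "coeff (coeff p j) i \<noteq> 0" by blast
    from nz have "coeff p j \<noteq> 0" by (metis coeff_0)
    with nz have "(j, i) \<in> (SIGMA j:{..degree p}. {..degree (coeff p j)})"
      by (simp add: le_degree)
    with n show "n \<in> (\<lambda>(j, i). i + j) ` (SIGMA j:{..degree p}. {..degree (coeff p j)})"
      by (metis (no_types, lifting) image_eqI case_prod_conv)
  qed
  then have "finite (insert 0 ?M)"
    by (meson finite.insertI finite_SigmaI finite_atMost finite_imageI finite_subset)
  then show ?thesis
    unfolding total_degree_def using assms by (intro Max_ge) blast+
qed

lemma total_degree_attained: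
  assumes "p \<noteq> 0"
  obtains i j where "coeff (coeff p j) i \<noteq> 0" "i + j = total_degree p"
proof -
  let ?M = "{i + j | i j. coeff (coeff p j) i \<noteq> 0}"
  obtain j0 i0 where ne: "coeff (coeff p j0) i0 \<noteq> 0"
    using assms by (metis leading_coeff_neq_0)
  have fin: "finite (insert 0 ?M)"
    by (rule finite_subset[of _ "{..total_degree p}"]) (auto dest: total_degree_ge)
  have "?M \<noteq> {}" using ne by blast
  moreover have "finite ?M" using fin by simp
  ultimately have "Max (insert 0 ?M) = Max ?M" "Max ?M \<in> ?M"
    using Max_insert[of ?M 0] Max_in[of ?M] by simp_all
  then have "total_degree p \<in> ?M" unfolding total_degree_def by simp
  then show thesis using that by force
qed

lemma total_degree_le_iff:
  "total_degree p \<le> n \<longleftrightarrow> (\<forall>i j. coeff (coeff p j) i \<noteq> 0 \<longrightarrow> i + j \<le> n)"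
proof (cases "p = 0")
  case True
  then show ?thesis by (simp add: total_degree_def)
next
  case False
  then show ?thesis using total_degree_attained[OF False] total_degree_ge order_trans by metis
qed

lemma coeff2_mult:
  "coeff (coeff (p * q) J) I =
     (\<Sum>(j, i)\<in>{..J} \<times> {..I}. coeff (coeff p j) i * coeff (coeff q (J - j)) (I - i))"
  by (simp add: coeff_mult coeff_sum sum.cartesian_product)

lemma total_degree_mult_le: "total_degree (p * q) \<le> total_degree p + total_degree q"
  for p q :: "'a::comm_ring_1 poly poly"
proof -
  have "I + J \<le> total_degree p + total_degree q" if "coeff (coeff (p * q) J) I \<noteq> 0" for I J
  proof -
    from that obtain j i where ij: "j \<le> J" "i \<le> I"
      "coeff (coeff p j) i * coeff (coeff q (J - j)) (I - i) \<noteq> 0"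
      unfolding coeff2_mult by (metis (no_types, lifting) sum.neutral SigmaE atMost_iff case_prod_conv)
    then have "coeff (coeff p j) i \<noteq> 0" "coeff (coeff q (J - j)) (I - i) \<noteq> 0" by auto
    from total_degree_ge[OF this(1)] total_degree_ge[OF this(2)] ij show ?thesis by simp
  qed
  then show ?thesis by (simp add: total_degree_le_iff)
qed

text \<open>Singles out the leading monomial for the order by total degree, with ties broken by the
  outer exponent. Leading monomials of two factors cannot cancel in the product.\<close>

lemma total_degree_leading:
  assumes "p \<noteq> 0"
  obtains i j where "coeff (coeff p j) i \<noteq> 0" "i + j = total_degree p"
    "\<And>i' j'. coeff (coeff p j') i' \<noteq> 0 \<Longrightarrow> i' + j' = total_degree p \<Longrightarrow> j' \<le> j"
proof -
  define J where "J = {j. \<exists>i. coeff (coeff p j) i \<noteq> 0 \<and> i + j = total_degree p}"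
  have "J \<subseteq> {..total_degree p}" unfolding J_def by auto
  then have fin: "finite J" by (rule finite_subset) simp
  have "J \<noteq> {}" using total_degree_attained[OF assms] unfolding J_def by blast
  then have "Max J \<in> J" using fin by simp
  moreover have "\<And>j. j \<in> J \<Longrightarrow> j \<le> Max J" using fin by simp
  ultimately show thesis using that unfolding J_def by blast
qed

lemma total_degree_mult:
  fixes p q :: "'a::idom poly poly"
  assumes "p \<noteq> 0" "q \<noteq> 0"
  shows "total_degree (p * q) = total_degree p + total_degree q"
proof (rule antisym[OF total_degree_mult_le])
  obtain i1 j1 where 1: "coeff (coeff p j1) i1 \<noteq> 0" "i1 + j1 = total_degree p"
    "\<And>i' j'. coeff (coeff p j') i' \<noteq> 0 \<Longrightarrow> i' + j' = total_degree p \<Longrightarrow> j' \<le> j1"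
    using total_degree_leading[OF assms(1)] by metis
  obtain i2 j2 where 2: "coeff (coeff q j2) i2 \<noteq> 0" "i2 + j2 = total_degree q"
    "\<And>i' j'. coeff (coeff q j') i' \<noteq> 0 \<Longrightarrow> i' + j' = total_degree q \<Longrightarrow> j' \<le> j2"
    using total_degree_leading[OF assms(2)] by metis
  let ?t = "\<lambda>(j, i). coeff (coeff p j) i * coeff (coeff q (j1 + j2 - j)) (i1 + i2 - i)"
  \<comment> \<open>Any other contributing pair would have top total degree in both factors, and an
    outer exponent that is too large in one of them.\<close>
  have z: "?t ji = 0" if "ji \<in> {..j1 + j2} \<times> {..i1 + i2} - {(j1, i1)}" for ji
  proof (rule ccontr)
    obtain j i where ji: "ji = (j, i)" by force
    assume "?t ji \<noteq> 0"
    then have nz: "coeff (coeff p j) i \<noteq> 0" "coeff (coeff q (j1 + j2 - j)) (i1 + i2 - i) \<noteq> 0"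
      by (auto simp: ji)
    have "j \<le> j1 + j2" "i \<le> i1 + i2" "(j, i) \<noteq> (j1, i1)" using that ji by auto
    moreover have le: "i + j \<le> total_degree p" "i1 + i2 - i + (j1 + j2 - j) \<le> total_degree q"
      using nz total_degree_ge by blast+
    ultimately have eq: "i + j = total_degree p" "i1 + i2 - i + (j1 + j2 - j) = total_degree q"
      using 1(2) 2(2) by linarith+
    then have "j \<le> j1" "j1 + j2 - j \<le> j2" using 1(3) 2(3) nz by blast+
    with eq 1(2) \<open>(j, i) \<noteq> (j1, i1)\<close> \<open>j \<le> j1 + j2\<close> show False by auto
  qed
  have "coeff (coeff (p * q) (j1 + j2)) (i1 + i2) = (\<Sum>ji\<in>{(j1, i1)}. ?t ji)"
    unfolding coeff2_mult by (rule sum.mono_neutral_right) (use z in auto)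
  also have "\<dots> \<noteq> 0" using 1(1) 2(1) by simp
  finally have "i1 + i2 + (j1 + j2) \<le> total_degree (p * q)" by (rule total_degree_ge)
  then show "total_degree p + total_degree q \<le> total_degree (p * q)"
    using 1(2) 2(2) by linarith
qed

lemma total_degree_dvd_le:
  fixes p q :: "'a::idom poly poly"
  assumes "p dvd q" "q \<noteq> 0"
  shows "total_degree p \<le> total_degree q"
  using assms by (auto simp: dvd_def total_degree_mult)

lemma total_degree_add_le: "total_degree (p + q) \<le> max (total_degree p) (total_degree q)"
proof -
  have "i + j \<le> max (total_degree p) (total_degree q)" if "coeff (coeff (p + q) j) i \<noteq> 0" for i j
  proof -
    from that have "coeff (coeff p j) i \<noteq> 0 \<or> coeff (coeff q j) i \<noteq> 0" by auto
    then show ?thesis using total_degree_ge by (metis max.coboundedI1 max.coboundedI2)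
  qed
  then show ?thesis by (simp add: total_degree_le_iff)
qed

lemma eval2_add [simp]: "eval2 (p + q) x y = eval2 p x y + eval2 q x y"
  by (simp add: eval2_def)

lemma eval2_mult [simp]: "eval2 (p * q) x y = eval2 p x y * eval2 q x y"
  by (simp add: eval2_def)

section \<open>Polynomial functions of bounded degree\<close>

text \<open>A predicate on functions, so that degree bounds follow the syntax of an expression and
  coefficient lists never have to be multiplied out. The index is only an upper bound;
  \<open>polyfun_eval2\<close> returns to polynomials.\<close>

inductive polyfun :: "nat \<Rightarrow> (real \<times> real \<Rightarrow> real) \<Rightarrow> bool" where
  const [intro!]: "polyfun n (\<lambda>_. c)"
| fst [intro!]: "polyfun (Suc n) fst"
| snd [intro!]: "polyfun (Suc n) snd"
| add [intro]: "polyfun n f \<Longrightarrow> polyfun n g \<Longrightarrow> polyfun n (\<lambda>y. f y + g y)"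
| mult: "polyfun m f \<Longrightarrow> polyfun k g \<Longrightarrow> m + k \<le> n \<Longrightarrow> polyfun n (\<lambda>y. f y * g y)"

lemma polyfun_eval2:
  assumes "polyfun n f"
  obtains P where "total_degree P \<le> n" "\<And>x y. eval2 P x y = f (x, y)"
proof -
  from assms have "\<exists>P. total_degree P \<le> n \<and> (\<forall>x y. eval2 P x y = f (x, y))"
  proof induction
    case (const n c)
    then show ?case
      by (intro exI[of _ "[:[:c:]:]"])
         (auto simp: eval2_def total_degree_le_iff coeff_pCons split: nat.split_asm)
  next
    case (fst n)
    then show ?case
      by (intro exI[of _ "[:[:0, 1:]:]"])
         (auto simp: eval2_def total_degree_le_iff coeff_pCons split: nat.split_asm)
  next
    case (snd n)
    then show ?case
      by (intro exI[of _ "[:0, 1:]"])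
         (auto simp: eval2_def total_degree_le_iff coeff_pCons one_pCons split: nat.split_asm)
  next
    case (add n f g)
    then obtain P Q where
      "total_degree P \<le> n" "\<forall>x y. eval2 P x y = f (x, y)"
      "total_degree Q \<le> n" "\<forall>x y. eval2 Q x y = g (x, y)" by blast
    then show ?case
      by (intro exI[of _ "P + Q"]) (auto intro: order_trans[OF total_degree_add_le])
  next
    case (mult m f k g n)
    then obtain P Q where
      "total_degree P \<le> m" "\<forall>x y. eval2 P x y = f (x, y)"
      "total_degree Q \<le> k" "\<forall>x y. eval2 Q x y = g (x, y)" by blast
    then show ?case using mult.hyps
      by (intro exI[of _ "P * Q"]) (auto intro!: order_trans[OF total_degree_mult_le])
  qed
  then show thesis using that by blast
qed

lemma polyfun_mono: "polyfun m f \<Longrightarrow> m \<le> n \<Longrightarrow> polyfun n f"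
proof (induction arbitrary: n rule: polyfun.induct)
  case (fst m) then show ?case by (cases n) auto
next
  case (snd m) then show ?case by (cases n) auto
next
  case (mult m f k g m') then show ?case by (metis order_trans polyfun.mult)
qed auto

lemma polyfun_fst: "1 \<le> n \<Longrightarrow> polyfun n fst" by (cases n) auto
lemma polyfun_snd: "1 \<le> n \<Longrightarrow> polyfun n snd" by (cases n) auto

lemma polyfun_cmult: "polyfun n f \<Longrightarrow> polyfun n (\<lambda>y. c * f y)"
  by (rule polyfun.mult[of 0 "\<lambda>_. c" n f n]) auto

lemma polyfun_uminus: "polyfun n f \<Longrightarrow> polyfun n (\<lambda>y. - f y)"
  using polyfun_cmult[of n f "-1"] by simp

lemma polyfun_diff: "polyfun n f \<Longrightarrow> polyfun n g \<Longrightarrow> polyfun n (\<lambda>y. f y - g y)"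
  using polyfun.add[OF _ polyfun_uminus, of n f g] by simp

lemma polyfun_compose:
  assumes "polyfun n f" "polyfun 1 (\<lambda>y. fst (T y))" "polyfun 1 (\<lambda>y. snd (T y))"
  shows "polyfun n (\<lambda>y. f (T y))"
  using assms(1)
proof induction
  case (fst n) then show ?case using polyfun_mono[OF assms(2), of "Suc n"] by simp
next
  case (snd n) then show ?case using polyfun_mono[OF assms(3), of "Suc n"] by simp
next
  case (mult m f k g n) then show ?case by (metis polyfun.mult)
qed auto

subsection \<open>Zariski topology\<close>

lemma zariski_closure_eq:
  "zariski_closure S = {(x, y). \<forall>f \<in> vanishing_ideal S. eval2 f x y = 0}"
proof -
  have "algebraic_set {(x, y). \<forall>f \<in> vanishing_ideal S. eval2 f x y = 0}"
    unfolding algebraic_set_def by blast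
  moreover have "{(x, y). \<forall>f \<in> vanishing_ideal S. eval2 f x y = 0} \<subseteq> A"
    if "S \<subseteq> A" "algebraic_set A" for A
  proof -
    obtain F where F: "A = {(x, y). \<forall>f\<in>F. eval2 f x y = 0}"
      using \<open>algebraic_set A\<close> unfolding algebraic_set_def by blast
    then have "F \<subseteq> vanishing_ideal S" using \<open>S \<subseteq> A\<close> by (auto simp: vanishing_ideal_def)
    then show ?thesis unfolding F by blast
  qed
  ultimately show ?thesis
    unfolding zariski_closure_def by (intro hull_unique) (auto simp: vanishing_ideal_def)
qed

lemma zariski_closure_superset: "S \<subseteq> zariski_closure S"
  unfolding zariski_closure_def by (rule hull_subset)

lemma zariski_closure_minimal: "S \<subseteq> A \<Longrightarrow> algebraic_set A \<Longrightarrow> zariski_closure S \<subseteq> A"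
  unfolding zariski_closure_def by (rule hull_minimal)

lemma zariski_closure_algebraic: "algebraic_set S \<Longrightarrow> zariski_closure S = S"
  using zariski_closure_minimal zariski_closure_superset by blast

lemma algebraic_zeros: "algebraic_set {(x, y). eval2 f x y = 0}"
  unfolding algebraic_set_def by (intro exI[of _ "{f}"]) auto

lemma algebraic_polyfun: "polyfun n f \<Longrightarrow> algebraic_set {y. f y = 0}"
proof (erule polyfun_eval2)
  fix P assume "\<And>x y. eval2 P x y = f (x, y)"
  then have "{y. f y = 0} = {(x, y). eval2 P x y = 0}" by auto
  then show ?thesis using algebraic_zeros by simp
qed

lemma algebraic_Un:
  assumes "algebraic_set A" "algebraic_set B"
  shows "algebraic_set (A \<union> B)"
proof -
  obtain F where F: "A = {(x, y). \<forall>f\<in>F. eval2 f x y = 0}"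
    using assms(1) unfolding algebraic_set_def by blast
  obtain G where G: "B = {(x, y). \<forall>f\<in>G. eval2 f x y = 0}"
    using assms(2) unfolding algebraic_set_def by blast
  show ?thesis unfolding algebraic_set_def
    by (rule exI[of _ "(\<lambda>(f, g). f * g) ` (F \<times> G)"]) (auto simp: F G)
qed

lemma algebraic_empty: "algebraic_set {}"
  using algebraic_polyfun[OF polyfun.const[of 0 1]] by simp

lemma algebraic_point: "algebraic_set {a}"
proof -
  have "algebraic_set {(x, y). \<forall>f\<in>{[:[:- fst a, 1:]:], [:[:- snd a:], 1:]}. eval2 f x y = 0}"
    unfolding algebraic_set_def by blast
  also have "{(x, y). \<forall>f\<in>{[:[:- fst a, 1:]:], [:[:- snd a:], 1:]}. eval2 f x y = 0} = {a}"
    by (cases a) (auto simp: eval2_def)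
  finally show ?thesis .
qed

lemma algebraic_finite_Union: "finite \<A> \<Longrightarrow> (\<And>A. A \<in> \<A> \<Longrightarrow> algebraic_set A) \<Longrightarrow> algebraic_set (\<Union>\<A>)"
  by (induction \<A> rule: finite_induct) (auto intro: algebraic_empty algebraic_Un)

lemma algebraic_finite: "finite A \<Longrightarrow> algebraic_set A"
  using algebraic_finite_Union[of "(\<lambda>a. {a}) ` A"] algebraic_point by force

lemma zariski_irreducible_subset_Union:
  assumes "zariski_irreducible Z" "finite \<A>" "\<And>A. A \<in> \<A> \<Longrightarrow> algebraic_set A" "Z \<subseteq> \<Union>\<A>"
  shows "\<exists>A\<in>\<A>. Z \<subseteq> A"
  using assms(2-4)
proof (induction \<A> rule: finite_induct)
  case empty
  then show ?case using assms(1) by (auto simp: zariski_irreducible_def)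
next
  case (insert A \<A>)
  then have "Z \<subseteq> A \<or> Z \<subseteq> \<Union>\<A>"
    using assms(1) algebraic_finite_Union[of \<A>] unfolding zariski_irreducible_def by auto
  with insert show ?case by auto
qed

text \<open>For an infinite closure, \<open>f\<close> comes from a nonzero polynomial in the
  vanishing ideal, which the \<open>Gcd\<close> divides, and total degree is monotone under
  divisibility.\<close>

lemma algebraic_degree_le:
  assumes "zariski_irreducible Z" "polyfun n f" "f a \<noteq> 0" "Z \<subseteq> {y. f y = 0}" "1 \<le> n"
  shows "algebraic_degree Z \<le> n"
proof -
  have sub: "zariski_closure Z \<subseteq> {y. f y = 0}"
    using assms(2,4) by (intro zariski_closure_minimal algebraic_polyfun)
  then have neU: "zariski_closure Z \<noteq> UNIV" using assms(3) by blast
  show ?thesis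
  proof (cases "finite (zariski_closure Z)")
    case True
    then have fin: "finite Z" using zariski_closure_superset finite_subset by blast
    \<comment> \<open>A finite irreducible set lies in one of its points, so it has degree one; this
      is where \<open>1 \<le> n\<close> enters.\<close>
    have "\<exists>A\<in>(\<lambda>a. {a}) ` Z. Z \<subseteq> A"
      by (rule zariski_irreducible_subset_Union) (use assms(1) fin algebraic_point in auto)
    then have "card Z \<le> 1" using card_mono[of "{_}" Z] by fastforce
    then show ?thesis
      using True neU fin assms(5)
      by (simp add: algebraic_degree_def Let_def zariski_closure_algebraic algebraic_finite)
  next
    case False
    obtain P where P: "total_degree P \<le> n" "\<And>x y. eval2 P x y = f (x, y)"
      using polyfun_eval2[OF assms(2)] by blast
    have "P \<noteq> 0" using assms(3) P(2)[of "fst a" "snd a"] by (auto simp: eval2_def)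
    moreover have "P \<in> vanishing_ideal (zariski_closure Z)"
      using sub P(2) by (auto simp: vanishing_ideal_def)
    ultimately have "total_degree (Gcd (vanishing_ideal (zariski_closure Z))) \<le> total_degree P"
      by (intro total_degree_dvd_le Gcd_dvd)
    then show ?thesis
      using neU False P(1) by (simp add: algebraic_degree_def Let_def)
  qed
qed

section \<open>Boundaries described by curves of low degree\<close>

text \<open>The pieces need not be irreducible: an irreducible component lies in one of them and
  inherits the bound two. The empty family gives the empty boundary, and a sum of two squares admits
  an isolated point.\<close>

definition low_degree_pieces :: "(real \<times> real) set \<Rightarrow> bool" where
  "low_degree_pieces S \<longleftrightarrow>
     (\<exists>F. finite F \<and> (\<forall>f\<in>F. polyfun 2 f \<and> (\<exists>a. f a \<noteq> 0)) \<and> S = {y. \<exists>f\<in>F. f y = 0})"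

definition in_curve :: "nat \<Rightarrow> (real \<times> real) set \<Rightarrow> bool" where
  "in_curve n S \<longleftrightarrow> (\<exists>f a. polyfun n f \<and> f a \<noteq> 0 \<and> S \<subseteq> {y. f y = 0})"

text \<open>The outcome of the case analysis, as a property invariant under affine changes from
  which both general claims about complex conics follow.\<close>

definition tame :: "(real \<times> real) set \<Rightarrow> bool" where
  "tame S \<longleftrightarrow> low_degree_pieces (frontier S) \<or> bounded (- S) \<and> in_curve 8 (frontier S)"

lemma low_degree_pieces_eq_Union:
  assumes "low_degree_pieces S"
  obtains \<A> where "finite \<A>" "S = \<Union>\<A>" "\<And>A. A \<in> \<A> \<Longrightarrow> algebraic_set A"
    "\<And>A. A \<in> \<A> \<Longrightarrow> \<exists>f a. polyfun 2 f \<and> f a \<noteq> 0 \<and> A = {y. f y = 0}"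
proof -
  obtain F where F: "finite F" "\<And>f. f \<in> F \<Longrightarrow> polyfun 2 f \<and> (\<exists>a. f a \<noteq> 0)"
    "S = {y. \<exists>f\<in>F. f y = 0}"
    using assms unfolding low_degree_pieces_def by blast
  show thesis
  proof (rule that[of "(\<lambda>f. {y. f y = 0}) ` F"])
    show "\<And>A. A \<in> (\<lambda>f. {y. f y = 0}) ` F \<Longrightarrow> algebraic_set A"
      using F(2) algebraic_polyfun by blast
  qed (use F in blast)+
qed

lemma low_degree_pieces_algebraic: "low_degree_pieces S \<Longrightarrow> algebraic_set S"
  by (erule low_degree_pieces_eq_Union) (auto intro: algebraic_finite_Union)

lemma low_degree_pieces_degree:
  assumes "low_degree_pieces S" "Z \<in> irreducible_components S"
  shows "algebraic_degree Z \<le> 2"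
proof -
  obtain \<A> where \<A>: "finite \<A>" "S = \<Union>\<A>" "\<And>A. A \<in> \<A> \<Longrightarrow> algebraic_set A"
    "\<And>A. A \<in> \<A> \<Longrightarrow> \<exists>f a. polyfun 2 f \<and> f a \<noteq> 0 \<and> A = {y. f y = 0}"
    using low_degree_pieces_eq_Union[OF assms(1)] by blast
  have Z: "Z \<subseteq> S" "zariski_irreducible Z"
    using assms(2) by (auto simp: irreducible_components_def)
  then obtain A where A: "A \<in> \<A>" "Z \<subseteq> A"
    using zariski_irreducible_subset_Union[OF _ \<A>(1,3)] \<A>(2) by metis
  with \<A>(4) obtain f a where "polyfun 2 f" "f a \<noteq> 0" "A = {y. f y = 0}" by blast
  with Z A show ?thesis by (intro algebraic_degree_le[of Z 2 f a]) auto
qed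

lemma in_curve_degree:
  assumes "in_curve n S" "1 \<le> n" "Z \<in> irreducible_components (zariski_closure S)"
  shows "algebraic_degree Z \<le> n"
proof -
  obtain f a where f: "polyfun n f" "f a \<noteq> 0" "S \<subseteq> {y. f y = 0}"
    using assms(1) unfolding in_curve_def by blast
  have "zariski_closure S \<subseteq> {y. f y = 0}"
    using f by (intro zariski_closure_minimal algebraic_polyfun)
  with assms(2,3) f show ?thesis
    by (intro algebraic_degree_le[of Z n f a]) (auto simp: irreducible_components_def)
qed

lemma tame_degree:
  assumes "tame S" "Z \<in> irreducible_components (zariski_closure (frontier S))"
  shows "algebraic_degree Z \<le> 8"
  using assms(1) unfolding tame_def
proof
  assume "low_degree_pieces (frontier S)"
  moreover from this have "zariski_closure (frontier S) = frontier S"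
    by (intro zariski_closure_algebraic low_degree_pieces_algebraic)
  ultimately have "algebraic_degree Z \<le> 2" using assms(2) low_degree_pieces_degree by metis
  then show ?thesis by simp
next
  assume "bounded (- S) \<and> in_curve 8 (frontier S)"
  then show ?thesis using in_curve_degree[of 8 "frontier S"] assms(2) by simp
qed

lemma low_degree_pieces_empty: "low_degree_pieces {}"
  unfolding low_degree_pieces_def by (intro exI[of _ "{}"]) auto

lemma low_degree_pieces_zeros: "polyfun 2 f \<Longrightarrow> f a \<noteq> 0 \<Longrightarrow> low_degree_pieces {y. f y = 0}"
  unfolding low_degree_pieces_def by (intro exI[of _ "{f}"]) blast

lemma low_degree_pieces_Un:
  assumes "low_degree_pieces S" "low_degree_pieces T"
  shows "low_degree_pieces (S \<union> T)"
proof -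
  obtain F G where "finite F" "\<forall>f\<in>F. polyfun 2 f \<and> (\<exists>a. f a \<noteq> 0)" "S = {y. \<exists>f\<in>F. f y = 0}"
    "finite G" "\<forall>f\<in>G. polyfun 2 f \<and> (\<exists>a. f a \<noteq> 0)" "T = {y. \<exists>f\<in>G. f y = 0}"
    using assms unfolding low_degree_pieces_def by blast
  then show ?thesis unfolding low_degree_pieces_def by (intro exI[of _ "F \<union> G"]) auto
qed

lemma tame_pieces_of_unbounded_components:
  assumes "tame S" "\<forall>C \<in> components (- S). \<not> bounded C"
  shows "low_degree_pieces (frontier S)"
  using assms(1) unfolding tame_def
proof
  assume *: "bounded (- S) \<and> in_curve 8 (frontier S)"
  have "- S = {}"
  proof (rule ccontr)
    assume "- S \<noteq> {}"
    then obtain C where C: "C \<in> components (- S)" using components_eq_empty by blast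
    then have "bounded C" using * in_components_subset bounded_subset by blast
    with assms(2) C show False by blast
  qed
  then have "S = UNIV" by blast
  then show ?thesis by (simp add: low_degree_pieces_empty)
qed

subsection \<open>Affine changes of coordinates\<close>

text \<open>Homeomorphisms with coordinates of degree at most one: frontiers, boundedness and degree
  bounds can all be pulled back along \<open>T\<close>.\<close>

locale affine_iso =
  fixes T T' :: "real \<times> real \<Rightarrow> real \<times> real"
  assumes T'T [simp]: "T' (T y) = y" and TT' [simp]: "T (T' y) = y"
    and cont: "continuous_on UNIV T" "continuous_on UNIV T'"
    and polyfun_T: "polyfun 1 (\<lambda>y. fst (T y))" "polyfun 1 (\<lambda>y. snd (T y))"
begin

lemma closure_vimage_iso: "closure (T -` S) = T -` closure S"
proof (rule antisym)
  show "closure (T -` S) \<subseteq> T -` closure S"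
    using cont(1) closure_subset[of S]
    by (intro closure_minimal continuous_closed_vimage) (auto simp: continuous_on_eq_continuous_at)
  have "S \<subseteq> T' -` closure (T -` S)"
    using closure_subset[of "T -` S"] by (metis TT' subsetD subsetI vimageI)
  then have "closure S \<subseteq> T' -` closure (T -` S)"
    using cont(2)
    by (intro closure_minimal continuous_closed_vimage) (auto simp: continuous_on_eq_continuous_at)
  then show "T -` closure S \<subseteq> closure (T -` S)" by (metis T'T subsetD subsetI vimageD)
qed

lemma frontier_vimage_iso: "frontier (T -` S) = T -` frontier S"
  by (auto simp: frontier_closures closure_vimage_iso simp flip: vimage_Compl)

lemma bounded_vimage_iso: "bounded S \<Longrightarrow> bounded (T -` S)"
proof -
  assume "bounded S"
  then have "compact (T' ` closure S)"
    using cont(2) by (intro compact_continuous_image) (auto intro: continuous_on_subset)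
  moreover have "T -` S \<subseteq> T' ` closure S"
    using closure_subset[of S] by (metis T'T image_eqI subsetD subsetI vimageD)
  ultimately show ?thesis using bounded_subset compact_imp_bounded by blast
qed

lemma low_degree_pieces_vimage:
  assumes "low_degree_pieces S" shows "low_degree_pieces (T -` S)"
proof -
  obtain F where F: "finite F" "\<And>f. f \<in> F \<Longrightarrow> polyfun 2 f \<and> (\<exists>a. f a \<noteq> 0)"
    "S = {y. \<exists>f\<in>F. f y = 0}"
    using assms unfolding low_degree_pieces_def by blast
  have "polyfun 2 (\<lambda>y. f (T y))" "\<exists>a. f (T a) \<noteq> 0" if "f \<in> F" for f
    using F(2)[OF that] polyfun_compose[OF _ polyfun_T] TT' by metis+
  then show ?thesis
    unfolding low_degree_pieces_def using F(1,3)
    by (intro exI[of _ "(\<lambda>f y. f (T y)) ` F"]) auto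
qed

lemma in_curve_vimage:
  assumes "in_curve n S" shows "in_curve n (T -` S)"
proof -
  obtain f a where "polyfun n f" "f a \<noteq> 0" "S \<subseteq> {y. f y = 0}"
    using assms unfolding in_curve_def by blast
  then show ?thesis
    unfolding in_curve_def
    by (intro exI[of _ "\<lambda>y. f (T y)"] exI[of _ "T' a"])
       (auto intro: polyfun_compose[OF _ polyfun_T])
qed

lemma tame_vimage: "tame S \<Longrightarrow> tame (T -` S)"
  unfolding tame_def frontier_vimage_iso
  using low_degree_pieces_vimage in_curve_vimage bounded_vimage_iso[of "- S"]
  by (auto simp: vimage_Compl)

end

text \<open>Stated for functions instead of polynomials, so that a change of variables is plain
  substitution.\<close>

definition improj :: "(complex \<Rightarrow> complex \<Rightarrow> complex) \<Rightarrow> (real \<times> real) set" where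
  "improj P = {(Im z1, Im z2) | z1 z2. P z1 z2 = 0}"

lemma improjI: "P z1 z2 = 0 \<Longrightarrow> (Im z1, Im z2) \<in> improj P"
  unfolding improj_def by blast

lemma improj_cong_zeros: "(\<And>z1 z2. P z1 z2 = 0 \<longleftrightarrow> Q z1 z2 = 0) \<Longrightarrow> improj P = improj Q"
  unfolding improj_def by simp

text \<open>A real matrix commutes with taking imaginary parts, and a complex translation
  contributes just its imaginary part. The induced map \<open>T\<close> does not depend on
  \<open>P\<close>.\<close>

lemma improj_affine:
  assumes det: "a * d - b * c \<noteq> 0"
  obtains T T' where "affine_iso T T'"
    "\<And>P. improj (\<lambda>z1 z2. P (of_real a * z1 + of_real b * z2 + s) (of_real c * z1 + of_real d * z2 + t))
       = T -` improj P"
proof -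
  define D where "D = a * d - b * c"
  have D: "D \<noteq> 0" using det D_def by simp
  have D_complex: "of_real a * of_real d - of_real b * of_real c = (of_real D :: complex)"
    by (simp add: D_def)
  define T where "T = (\<lambda>y. (a * fst y + b * snd y + Im s, c * fst y + d * snd y + Im t))"
  define T' where "T' = (\<lambda>y. ((d * (fst y - Im s) - b * (snd y - Im t)) / D,
      (a * (snd y - Im t) - c * (fst y - Im s)) / D))"
  have 1: "T' (T y) = y" for y
  proof -
    have "d * (a * fst y + b * snd y) - b * (c * fst y + d * snd y) = D * fst y"
      "a * (c * fst y + d * snd y) - c * (a * fst y + b * snd y) = D * snd y"
      by (simp_all add: D_def algebra_simps)
    then show ?thesis using D by (simp add: T_def T'_def prod_eq_iff)
  qed
  have 2: "T (T' y) = y" for y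
  proof -
    have "a * (d * (fst y - Im s) - b * (snd y - Im t)) + b * (a * (snd y - Im t) - c * (fst y - Im s))
        = D * (fst y - Im s)"
      "c * (d * (fst y - Im s) - b * (snd y - Im t)) + d * (a * (snd y - Im t) - c * (fst y - Im s))
        = D * (snd y - Im t)"
      by (simp_all add: D_def algebra_simps)
    then show ?thesis using D by (simp add: T_def T'_def prod_eq_iff flip: add_divide_distrib)
  qed
  have "affine_iso T T'"
  proof
    show "continuous_on UNIV T" unfolding T_def by (intro continuous_intros)
    show "continuous_on UNIV T'" unfolding T'_def using D by (intro continuous_intros) auto
    show "polyfun 1 (\<lambda>y. fst (T y))" "polyfun 1 (\<lambda>y. snd (T y))"
      by (auto simp: T_def intro!: polyfun.add polyfun_cmult polyfun_fst polyfun_snd)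
  qed (use 1 2 in auto)
  moreover have "improj (\<lambda>z1 z2. P (of_real a * z1 + of_real b * z2 + s) (of_real c * z1 + of_real d * z2 + t))
       = T -` improj P" (is "improj ?Q = _") for P
  proof (rule antisym; rule subsetI)
    fix y assume "y \<in> improj ?Q"
    then obtain z1 z2 where z: "y = (Im z1, Im z2)" "?Q z1 z2 = 0" unfolding improj_def by blast
    have "T y = (Im (of_real a * z1 + of_real b * z2 + s), Im (of_real c * z1 + of_real d * z2 + t))"
      by (simp add: T_def z(1))
    then show "y \<in> T -` improj P" using improjI[of P, OF z(2)] by simp
  next
    fix y assume "y \<in> T -` improj P"
    then obtain w1 w2 where w: "T y = (Im w1, Im w2)" "P w1 w2 = 0" unfolding improj_def by blast
    \<comment> \<open>Cramer's rule, now over the complex numbers.\<close>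
    define z1 where "z1 = (of_real d * (w1 - s) - of_real b * (w2 - t)) / of_real D"
    define z2 where "z2 = (of_real a * (w2 - t) - of_real c * (w1 - s)) / of_real D"
    have "of_real a * (of_real d * (w1 - s) - of_real b * (w2 - t)) + of_real b * (of_real a * (w2 - t) - of_real c * (w1 - s))
        = of_real D * (w1 - s)"
      "of_real c * (of_real d * (w1 - s) - of_real b * (w2 - t)) + of_real d * (of_real a * (w2 - t) - of_real c * (w1 - s))
        = of_real D * (w2 - t)"
      by (simp_all add: algebra_simps flip: D_complex)
    then have "of_real a * z1 + of_real b * z2 + s = w1" "of_real c * z1 + of_real d * z2 + t = w2"
      using D by (simp_all add: z1_def z2_def flip: add_divide_distrib)
    then have "(Im z1, Im z2) \<in> improj ?Q" using w(2) by (intro improjI) simp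
    moreover have "(Im z1, Im z2) = T' (T y)"
      unfolding w(1) by (simp add: T'_def z1_def z2_def)
    ultimately show "y \<in> improj ?Q" by (simp add: 1)
  qed
  ultimately show thesis by (rule that)
qed

section \<open>Leading forms without real zeros: compactness and the boundary\<close>

definition conic :: "complex \<Rightarrow> complex \<Rightarrow> complex \<Rightarrow> complex \<Rightarrow> complex \<Rightarrow> complex \<Rightarrow> complex \<Rightarrow> complex \<Rightarrow> complex"
  where "conic a b c d e f z1 z2 = a * z1\<^sup>2 + b * z1 * z2 + c * z2\<^sup>2 + d * z1 + e * z2 + f"

text \<open>Says that the conic has no real point at infinity.\<close>

definition nonvanishing_form :: "complex \<Rightarrow> complex \<Rightarrow> complex \<Rightarrow> bool" where
  "nonvanishing_form a b c \<longleftrightarrow> (\<forall>x1 x2 :: real. (x1, x2) \<noteq> (0, 0) \<longrightarrow>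
     a * of_real x1 ^ 2 + b * of_real x1 * of_real x2 + c * of_real x2 ^ 2 \<noteq> 0)"

text \<open>The constant is the minimum on the unit circle; homogeneity of degree two extends the
  estimate to the plane.\<close>

lemma nonvanishing_form_lower_bound:
  assumes "nonvanishing_form a b c"
  obtains m where "m > 0" "\<And>x1 x2 :: real. m * (x1\<^sup>2 + x2\<^sup>2) \<le>
     cmod (a * of_real x1 ^ 2 + b * of_real x1 * of_real x2 + c * of_real x2 ^ 2)"
proof -
  define q where "q = (\<lambda>x :: real \<times> real. cmod (a * of_real (fst x) ^ 2
     + b * of_real (fst x) * of_real (snd x) + c * of_real (snd x) ^ 2))"
  have "continuous_on (sphere 0 1) q" unfolding q_def by (intro continuous_intros)
  moreover have "(1, 0) \<in> sphere (0 :: real \<times> real) 1" by (simp add: norm_Pair)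
  ultimately obtain x0 where x0: "x0 \<in> sphere 0 1" "\<And>x. x \<in> sphere 0 1 \<Longrightarrow> q x0 \<le> q x"
    using continuous_attains_inf[of "sphere 0 1" q] by auto
  have "x0 \<noteq> (0, 0)" using x0(1) by auto
  then have "q x0 > 0"
    using assms unfolding nonvanishing_form_def q_def by (cases x0) auto
  moreover have "q x0 * (x1\<^sup>2 + x2\<^sup>2) \<le> q (x1, x2)" for x1 x2
  proof (cases "(x1, x2) = 0")
    case True then show ?thesis by (simp add: zero_prod_def q_def)
  next
    case False
    define r where "r = norm (x1, x2)"
    have r: "r > 0" using False r_def by simp
    have r2: "r\<^sup>2 = x1\<^sup>2 + x2\<^sup>2" by (simp add: r_def norm_Pair)
    have "(x1 / r, x2 / r) = (1 / r) *\<^sub>R (x1, x2)" by simp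
    then have "norm (x1 / r, x2 / r) = 1"
      unfolding r_def using False by (metis norm_sgn sgn_div_norm inverse_eq_divide)
    then have "q x0 \<le> q (x1 / r, x2 / r)" by (intro x0(2)) simp
    also have "q (x1 / r, x2 / r) = cmod ((a * of_real x1 ^ 2 + b * of_real x1 * of_real x2
        + c * of_real x2 ^ 2) / of_real (r\<^sup>2))"
      by (simp add: q_def power_divide add_divide_distrib power2_eq_square)
    also have "\<dots> = q (x1, x2) / r\<^sup>2"
      by (simp add: norm_divide q_def norm_power)
    finally have "q x0 * r\<^sup>2 \<le> q (x1, x2)" using r by (simp add: pos_le_divide_eq)
    then show ?thesis by (simp only: r2)
  qed
  ultimately show thesis using that[of "q x0"] by (simp add: q_def)
qed

text \<open>In terms of the real parts, the equation is a quadratic form bounded below by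
  \<open>m * r\<^sup>2\<close> plus terms of order at most one, whose coefficients are bounded when
  the imaginary parts are.\<close>

lemma conic_zeros_bounded:
  assumes "nonvanishing_form a b c"
  obtains C where "\<And>z1 z2. conic a b c d e f z1 z2 = 0 \<Longrightarrow> norm (Im z1, Im z2) \<le> R \<Longrightarrow>
    norm (z1, z2) \<le> C"
proof -
  obtain m where m: "m > 0" "\<And>x1 x2 :: real. m * (x1\<^sup>2 + x2\<^sup>2) \<le>
     cmod (a * of_real x1 ^ 2 + b * of_real x1 * of_real x2 + c * of_real x2 ^ 2)"
    using nonvanishing_form_lower_bound[OF assms] by metis
  \<comment> \<open>\<open>A\<close> and \<open>B\<close> are the coefficients of the two real parts
    in the expansion of the conic at given imaginary parts, and \<open>K0\<close> is its constant
    term.\<close>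
  define A where "A = (\<lambda>y :: real \<times> real. 2 * \<i> * a * of_real (fst y) + \<i> * b * of_real (snd y) + d)"
  define B where "B = (\<lambda>y :: real \<times> real. \<i> * b * of_real (fst y) + 2 * \<i> * c * of_real (snd y) + e)"
  define K0 where "K0 = (\<lambda>y :: real \<times> real. conic a b c d e f (\<i> * of_real (fst y)) (\<i> * of_real (snd y)))"
  define G where "G = (\<lambda>y. cmod (A y) + cmod (B y) + cmod (K0 y))"
  have "continuous_on (cball 0 R) G"
    unfolding G_def A_def B_def K0_def conic_def by (intro continuous_intros)
  then have "bounded (G ` cball 0 R)"
    by (intro compact_imp_bounded compact_continuous_image) auto
  then obtain K where K0: "K > 0" and "\<forall>g \<in> G ` cball 0 R. norm g \<le> K"
    unfolding bounded_pos by blast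
  then have K: "G y \<le> K" if "norm y \<le> R" for y
  proof -
    have "y \<in> cball 0 R" using that by simp
    then have "norm (G y) \<le> K" using \<open>\<forall>g \<in> G ` cball 0 R. norm g \<le> K\<close> by blast
    then show ?thesis by simp
  qed
  \<comment> \<open>The maximum bounds the real parts: if \<open>r > 1\<close>, then
    \<open>m * r\<^sup>2 \<le> r * K + K\<close> yields \<open>m * r \<le> 2 * K\<close>. The
    summand \<open>R\<close> accounts for the imaginary parts.\<close>
  define C where "C = max 1 (2 * K / m) + R"
  show thesis
  proof (rule that[of C])
    fix z1 z2 assume z: "conic a b c d e f z1 z2 = 0" and y: "norm (Im z1, Im z2) \<le> R"
    let ?x1 = "Re z1" and ?x2 = "Re z2" and ?y = "(Im z1, Im z2)"
    define r where "r = norm (?x1, ?x2)"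
    have r2: "r\<^sup>2 = ?x1\<^sup>2 + ?x2\<^sup>2" by (simp add: r_def norm_Pair)
    have r_ge: "\<bar>?x1\<bar> \<le> r" "\<bar>?x2\<bar> \<le> r" "0 \<le> r"
      using norm_fst_le[of ?x1 ?x2] norm_snd_le[of ?x2 ?x1] by (simp_all add: r_def)
    have ri: "z1 = of_real ?x1 + \<i> * of_real (Im z1)" "z2 = of_real ?x2 + \<i> * of_real (Im z2)"
      by (simp_all add: complex_eq_iff)
    have "conic a b c d e f z1 z2 = (a * of_real ?x1 ^ 2 + b * of_real ?x1 * of_real ?x2
        + c * of_real ?x2 ^ 2) + of_real ?x1 * A ?y + of_real ?x2 * B ?y + K0 ?y"
      apply (subst ri(1), subst ri(2))
      apply (simp add: conic_def A_def B_def K0_def power2_eq_square algebra_simps)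
      done
    then have eq: "a * of_real ?x1 ^ 2 + b * of_real ?x1 * of_real ?x2 + c * of_real ?x2 ^ 2
        = - (of_real ?x1 * A ?y + of_real ?x2 * B ?y + K0 ?y)"
      using z by (simp only: eq_neg_iff_add_eq_0 add.assoc)
    have "m * r\<^sup>2 \<le> cmod (of_real ?x1 * A ?y + of_real ?x2 * B ?y + K0 ?y)"
      using m(2)[of ?x1 ?x2] unfolding eq r2 norm_minus_cancel .
    also have "\<dots> \<le> \<bar>?x1\<bar> * cmod (A ?y) + \<bar>?x2\<bar> * cmod (B ?y) + cmod (K0 ?y)"
      by (intro norm_triangle_le add_mono) (auto simp: norm_mult)
    also have "\<dots> \<le> r * cmod (A ?y) + r * cmod (B ?y) + cmod (K0 ?y)"
      using r_ge by (intro add_mono mult_right_mono) auto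
    also have "\<dots> \<le> r * G ?y + G ?y"
      by (simp add: G_def algebra_simps r_ge)
    also have "\<dots> \<le> r * K + K" using K[OF y] r_ge by (intro add_mono mult_left_mono) auto
    finally have le: "m * r\<^sup>2 \<le> r * K + K" .
    have "r \<le> max 1 (2 * K / m)"
    proof (cases "r \<le> 1")
      case False
      then have "K \<le> r * K" using K0 by simp
      then have "m * r * r \<le> 2 * K * r" using le by (simp add: power2_eq_square algebra_simps)
      then have "m * r \<le> 2 * K" using False by simp
      then have "r \<le> 2 * K / m" using m(1) by (simp add: field_simps)
      then show ?thesis by simp
    qed simp
    moreover have "norm (z1, z2) \<le> r + norm ?y"
    proof -
      have "norm (z1, z2) = sqrt (norm (?x1, ?x2) ^ 2 + norm ?y ^ 2)"
        by (simp add: norm_Pair cmod_power2 algebra_simps)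
      also have "\<dots> \<le> norm (?x1, ?x2) + norm ?y" by (intro sqrt_sum_squares_le_sum) auto
      finally show ?thesis by (simp add: r_def)
    qed
    ultimately show "norm (z1, z2) \<le> C" using y unfolding C_def by linarith
  qed
qed

text \<open>A convergent sequence in the projection lifts to a bounded sequence of zeros, and a
  limit of a subsequence is a zero over the limit point.\<close>

lemma closed_improj_conic:
  assumes "nonvanishing_form a b c"
  shows "closed (improj (conic a b c d e f))"
  unfolding closed_sequential_limits
proof (intro allI impI, elim conjE)
  fix Y y assume Y: "\<forall>n. Y n \<in> improj (conic a b c d e f)" and lim: "Y \<longlonglongrightarrow> y"
  have "bounded (range Y)" using lim convergent_imp_bounded by blast
  then obtain R where R: "\<And>n. norm (Y n) \<le> R" unfolding bounded_iff by blast
  have "\<forall>n. \<exists>z. Y n = (Im (fst z), Im (snd z)) \<and> conic a b c d e f (fst z) (snd z) = 0"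
    using Y unfolding improj_def by fastforce
  then obtain Z where Z: "\<And>n. Y n = (Im (fst (Z n)), Im (snd (Z n)))"
    "\<And>n. conic a b c d e f (fst (Z n)) (snd (Z n)) = 0"
    by metis
  obtain C where C: "\<And>z1 z2. conic a b c d e f z1 z2 = 0 \<Longrightarrow> norm (Im z1, Im z2) \<le> R \<Longrightarrow>
    norm (z1, z2) \<le> C"
    using conic_zeros_bounded[OF assms] by metis
  have "norm (Z n) \<le> C" for n using C[OF Z(2)[of n]] R[of n] Z(1)[of n] by simp
  then have "bounded (range Z)" unfolding bounded_iff by blast
  then obtain l r where r: "strict_mono r" "(Z \<circ> r) \<longlonglongrightarrow> l"
    using bounded_imp_convergent_subsequence by metis
  have "(\<lambda>n. conic a b c d e f (fst ((Z \<circ> r) n)) (snd ((Z \<circ> r) n))) \<longlonglongrightarrow> conic a b c d e f (fst l) (snd l)"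
    unfolding conic_def by (intro tendsto_intros r(2))
  then have l0: "conic a b c d e f (fst l) (snd l) = 0"
    using Z(2) by (simp add: LIMSEQ_const_iff)
  have "(\<lambda>n. (Im (fst ((Z \<circ> r) n)), Im (snd ((Z \<circ> r) n)))) \<longlonglongrightarrow> (Im (fst l), Im (snd l))"
    by (intro tendsto_intros r(2))
  then have "(Y \<circ> r) \<longlonglongrightarrow> (Im (fst l), Im (snd l))" by (simp add: comp_def Z(1))
  moreover have "(Y \<circ> r) \<longlonglongrightarrow> y" using LIMSEQ_subseq_LIMSEQ[OF lim r(1)] .
  ultimately have "y = (Im (fst l), Im (snd l))" using LIMSEQ_unique by blast
  then show "y \<in> improj (conic a b c d e f)" using improjI[of "conic a b c d e f", OF l0] by simp
qed

text \<open>
  At a zero where the gradient is not a complex multiple of a real vector, the map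
  $z \mapsto (p(z), \operatorname{Im} z)$ is a submersion, so its value lies in the interior.
\<close>

lemma improj_conic_interior:
  fixes z1 z2 a b c d e f :: complex
  defines "P1 \<equiv> 2 * a * z1 + b * z2 + d" and "P2 \<equiv> b * z1 + 2 * c * z2 + e"
  assumes z: "conic a b c d e f z1 z2 = 0" and J: "Im (P1 * cnj P2) \<noteq> 0"
  shows "(Im z1, Im z2) \<in> interior (improj (conic a b c d e f))"
proof -
  define F where "F = (\<lambda>z. (conic a b c d e f (fst z) (snd z), (Im (fst z), Im (snd z))))"
  define F' where "F' = (\<lambda>h. (P1 * fst h + P2 * snd h, (Im (fst h), Im (snd h))))"
  \<comment> \<open>With the imaginary parts \<open>snd k\<close> prescribed, \<open>W k\<close> is
    what the real parts still have to contribute to the value. Two real unknowns solve this complex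
    equation by Cramer's rule with determinant \<open>Im (P1 * cnj P2)\<close>, which gives the
    right inverse \<open>G\<close>.\<close>
  define W where "W = (\<lambda>k :: complex \<times> (real \<times> real). fst k - \<i> * (P1 * of_real (fst (snd k)) + P2 * of_real (snd (snd k))))"
  define G where "G = (\<lambda>k. (of_real (Im (W k * cnj P2) / Im (P1 * cnj P2)) + \<i> * of_real (fst (snd k)),
      of_real (- Im (W k * cnj P1) / Im (P1 * cnj P2)) + \<i> * of_real (snd (snd k))))"
  have der: "(F has_derivative F') (at (z1, z2))"
    unfolding F_def conic_def
    by (rule has_derivative_eq_rhs, (rule derivative_eq_intros refl)+)
       (auto simp: F'_def fun_eq_iff P1_def P2_def algebra_simps power2_eq_square)
  have contF: "continuous_on UNIV F" unfolding F_def conic_def by (intro continuous_intros)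
  have linG: "linear G"
    unfolding G_def W_def
    by (rule linearI) (auto simp: complex_eq_iff add_divide_distrib diff_divide_distrib algebra_simps)
  have right_inv: "F' (G k) = k" for k
  proof -
    obtain w k1 k2 where k: "k = (w, (k1, k2))" by (metis surj_pair)
    let ?J = "Im (P1 * cnj P2)"
    have id: "P1 * of_real (Im (v * cnj P2)) - P2 * of_real (Im (v * cnj P1)) = of_real ?J * v" for v
      by (simp add: complex_eq_iff algebra_simps)
    have div: "P1 * of_real (A / j) + P2 * of_real (- B / j) = (P1 * of_real A - P2 * of_real B) / of_real j"
      for A B j by (simp add: diff_divide_distrib)
    have "P1 * of_real (Im (W k * cnj P2) / ?J) + P2 * of_real (- Im (W k * cnj P1) / ?J)
        = (P1 * of_real (Im (W k * cnj P2)) - P2 * of_real (Im (W k * cnj P1))) / of_real ?J"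
      by (rule div)
    also have "\<dots> = W k"
      unfolding id using J by (metis nonzero_mult_div_cancel_left of_real_eq_0_iff)
    finally have *: "P1 * of_real (Im (W k * cnj P2) / ?J) + P2 * of_real (- Im (W k * cnj P1) / ?J) = W k" .
    have "fst (F' (G k)) = (P1 * of_real (Im (W k * cnj P2) / ?J) + P2 * of_real (- Im (W k * cnj P1) / ?J))
        + \<i> * (P1 * of_real k1 + P2 * of_real k2)"
      by (simp add: F'_def G_def k algebra_simps)
    also have "\<dots> = w" unfolding * by (simp add: W_def k)
    finally show ?thesis by (simp add: F'_def G_def k prod_eq_iff)
  qed
  have "F (z1, z2) \<in> interior (F ` UNIV)"
    by (rule sussmann_open_mapping[OF open_UNIV contF _ der])
       (use linG right_inv in \<open>auto simp: linear_conv_bounded_linear fun_eq_iff\<close>)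
  then obtain r where r: "r > 0" "ball (F (z1, z2)) r \<subseteq> F ` UNIV"
    unfolding mem_interior by blast
  have "ball (Im z1, Im z2) r \<subseteq> improj (conic a b c d e f)"
  proof
    fix y assume "y \<in> ball (Im z1, Im z2) r"
    then have "(0, y) \<in> ball (F (z1, z2)) r" by (simp add: F_def z dist_Pair_Pair)
    with r(2) obtain w where "F w = (0, y)" by (metis imageE subsetD)
    then have w: "conic a b c d e f (fst w) (snd w) = 0" "y = (Im (fst w), Im (snd w))"
      by (auto simp: F_def)
    show "y \<in> improj (conic a b c d e f)"
      unfolding w(2) by (rule improjI[of "conic a b c d e f", OF w(1)])
  qed
  with r(1) show ?thesis unfolding mem_interior by blast
qed

text \<open>Closedness supplies a zero over the boundary point, and this zero cannot satisfy the
  submersion criterion. The last equation is the tangency of the two real quadrics.\<close>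

lemma frontier_improj_conic:
  assumes "nonvanishing_form a b c" "y \<in> frontier (improj (conic a b c d e f))"
  obtains z1 z2 where "y = (Im z1, Im z2)" "conic a b c d e f z1 z2 = 0"
    "Im ((2 * a * z1 + b * z2 + d) * cnj (b * z1 + 2 * c * z2 + e)) = 0"
proof -
  have "y \<in> improj (conic a b c d e f)" "y \<notin> interior (improj (conic a b c d e f))"
    using assms(2) closed_improj_conic[OF assms(1), of d e f] by (auto simp: frontier_def)
  then show thesis using that improj_conic_interior unfolding improj_def by blast
qed

subsection \<open>Conics whose leading form has a nonreal linear factor\<close>

text \<open>
  For $u = z_1 + i z_2$ and $y = (\operatorname{Im} z_1, \operatorname{Im} z_2)$ the conjugate linear
  form $z_1 - i z_2$ has the value \<open>cnj u + eta y\<close>, and $u$ can be chosen independently of $y$.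
\<close>

definition eta :: "real \<times> real \<Rightarrow> complex" where
  "eta y = Complex (2 * snd y) (2 * fst y)"

lemma norm_eta: "cmod (eta y) = 2 * norm y"
proof -
  have "(cmod (eta y))\<^sup>2 = (2 * norm y)\<^sup>2"
    by (cases y) (simp add: eta_def cmod_power2 norm_Pair power_mult_distrib)
  then show ?thesis by (subst (asm) power2_eq_iff_nonneg) auto
qed

lemma eta_surj: obtains y where "eta y = w"
  by (rule that[of "(Im w / 2, Re w / 2)"]) (simp add: eta_def)

lemma improj_conj_coords:
  "improj (\<lambda>z1 z2. Q (z1 + \<i> * z2) (z1 - \<i> * z2)) = {y. \<exists>u. Q u (cnj u + eta y) = 0}"
  (is "?L = ?R")
proof (rule antisym; rule subsetI)
  fix y assume "y \<in> ?L"
  then obtain z1 z2 where z: "y = (Im z1, Im z2)" "Q (z1 + \<i> * z2) (z1 - \<i> * z2) = 0"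
    unfolding improj_def by blast
  have "z1 - \<i> * z2 = cnj (z1 + \<i> * z2) + eta y"
    by (simp add: z(1) eta_def complex_eq_iff)
  with z(2) have "Q (z1 + \<i> * z2) (cnj (z1 + \<i> * z2) + eta y) = 0" by (simp only:)
  then show "y \<in> ?R" by blast
next
  fix y assume "y \<in> ?R"
  then obtain u where u: "Q u (cnj u + eta y) = 0" by blast
  \<comment> \<open>Solves \<open>u = (x1 - snd y) + \<i> * (x2 + fst y)\<close> for the real parts
    \<open>x1\<close> and \<open>x2\<close>.\<close>
  define z1 where "z1 = Complex (Re u + snd y) (fst y)"
  define z2 where "z2 = Complex (Im u - fst y) (snd y)"
  have "z1 + \<i> * z2 = u" "z1 - \<i> * z2 = cnj u + eta y"
    by (simp_all add: z1_def z2_def eta_def complex_eq_iff)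
  then have "Q (z1 + \<i> * z2) (z1 - \<i> * z2) = 0" using u by (simp only:)
  then have "(Im z1, Im z2) \<in> ?L" by (rule improjI)
  then show "y \<in> ?L" by (simp add: z1_def z2_def)
qed

lemma bounded_eta:
  assumes "\<And>y. cmod (eta y) \<ge> R \<Longrightarrow> y \<in> S"
  shows "bounded (- S)"
  unfolding bounded_iff
proof (intro exI ballI)
  fix y assume "y \<in> - S"
  then have "cmod (eta y) < R" using assms by (meson ComplD leI)
  then show "norm y \<le> R / 2" by (simp add: norm_eta)
qed

section \<open>The discriminant and the curve of degree eight\<close>

definition cpolyfun :: "nat \<Rightarrow> (real \<times> real \<Rightarrow> complex) \<Rightarrow> bool" where
  "cpolyfun n g \<longleftrightarrow> polyfun n (\<lambda>y. Re (g y)) \<and> polyfun n (\<lambda>y. Im (g y))"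

lemma cpolyfun_const: "cpolyfun n (\<lambda>_. c)"
  by (auto simp: cpolyfun_def)

lemma cpolyfun_add: "cpolyfun n f \<Longrightarrow> cpolyfun n g \<Longrightarrow> cpolyfun n (\<lambda>y. f y + g y)"
  by (auto simp: cpolyfun_def)

lemma cpolyfun_mult: "cpolyfun m f \<Longrightarrow> cpolyfun k g \<Longrightarrow> m + k \<le> n \<Longrightarrow> cpolyfun n (\<lambda>y. f y * g y)"
  by (auto simp: cpolyfun_def intro!: polyfun_diff polyfun.add intro: polyfun.mult)

lemma cpolyfun_cnj: "cpolyfun n f \<Longrightarrow> cpolyfun n (\<lambda>y. cnj (f y))"
  by (auto simp: cpolyfun_def intro: polyfun_uminus)

lemma cpolyfun_eta: "cpolyfun 1 eta"
  by (auto simp: cpolyfun_def eta_def intro!: polyfun_cmult polyfun_fst polyfun_snd)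

definition disc :: "complex \<Rightarrow> complex \<Rightarrow> complex" where
  "disc D E = E * cnj E * (E * cnj E) - 4 * D * (cnj E * (cnj E * cnj E)) - 4 * cnj D * (E * (E * E))
     + 18 * D * cnj D * (E * cnj E) - 27 * (D * cnj D) * (D * cnj D)"

text \<open>
  \<open>disc D E\<close> is the discriminant of the cubic \<open>D x^3 + E x^2 + cnj E x + cnj D\<close>;
  the hypothesis says that \<open>- cnj \<theta>\<close> is a double root.
\<close>

lemma disc_eq_0:
  assumes "\<theta> * cnj \<theta> = 1" "E = 2 * D * cnj \<theta> + \<theta>\<^sup>2 * cnj D"
  shows "disc D E = 0"
proof -
  define t d d' e where "t = cnj \<theta>" and "d = D" and "d' = cnj D" and "e = cnj E"
  have t: "\<theta> * t = 1" using assms(1) by (simp add: t_def)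
  have E: "E = 2 * d * t + \<theta>\<^sup>2 * d'" "e = 2 * d' * \<theta> + t\<^sup>2 * d"
    by (simp_all add: assms(2) t_def d_def d'_def e_def)
  \<comment> \<open>These three quantities, related by \<open>X * Y = N * N\<close>, suffice to
    express every product in the discriminant, so that the unit number and its conjugate
    disappear.\<close>
  define N X Y where "N = d * d'" and "X = d\<^sup>2 * t ^ 3" and "Y = d'\<^sup>2 * \<theta> ^ 3"
  have XY: "X * Y = N * N" unfolding N_def X_def Y_def using t by algebra
  have 1: "E * e = 5 * N + 2 * X + 2 * Y" unfolding E N_def X_def Y_def using t by algebra
  have 2: "d * (e * (e * e)) = 8 * N * Y + 12 * N\<^sup>2 + 6 * N * X + X\<^sup>2"
    unfolding E N_def X_def Y_def using t by algebra
  have 3: "d' * (E * (E * E)) = 8 * N * X + 12 * N\<^sup>2 + 6 * N * Y + Y\<^sup>2"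
    unfolding E N_def X_def Y_def using t by algebra
  have "disc D E = (E * e) * (E * e) - 4 * (d * (e * (e * e)))
     - 4 * (d' * (E * (E * E))) + 18 * N * (E * e) - 27 * N * N"
    by (simp add: disc_def d_def d'_def N_def e_def)
  also have "\<dots> = 0" unfolding 1 2 3 using XY by algebra
  finally show ?thesis .
qed

text \<open>For large \<open>E\<close> the term \<open>(E * cnj E)\<^sup>2\<close> prevails. The two
  cubic terms cost at most \<open>8 * r * t ^ 3\<close>, and \<open>27 * r ^ 4\<close> is absorbed
  by \<open>18 * r\<^sup>2 * t\<^sup>2\<close>; the factor 9 serves both, and the summand 1 keeps
  \<open>t\<close> positive when \<open>D = 0\<close>.\<close>

lemma disc_neq_0:
  assumes "cmod E \<ge> 9 * cmod D + 1"
  shows "Re (disc D E) \<noteq> 0"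
proof -
  define t r where "t = cmod E" and "r = cmod D"
  have t: "t \<ge> 9 * r + 1" "r \<ge> 0" using assms by (simp_all add: t_def r_def)
  define W where "W = D * cnj E ^ 3"
  have disc: "disc D E = of_real (t ^ 4 + 18 * r\<^sup>2 * t\<^sup>2 - 27 * r ^ 4)
     - 4 * (W + cnj W)"
  proof -
    have EE: "E * cnj E = of_real (t\<^sup>2)" and DD: "D * cnj D = of_real (r\<^sup>2)"
      by (simp_all only: t_def r_def complex_norm_square)
    have "disc D E = (E * cnj E) * (E * cnj E) + 18 * (D * cnj D) * (E * cnj E) - 27 * (D * cnj D) * (D * cnj D)
       - 4 * (W + cnj W)"
      by (simp add: disc_def W_def power3_eq_cube algebra_simps)
    then show ?thesis unfolding EE DD by (simp add: power4_eq_xxxx power2_eq_square algebra_simps)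
  qed
  have "Re W \<le> cmod W" by (rule complex_Re_le_cmod)
  also have "\<dots> = r * t ^ 3" by (simp add: norm_mult norm_power t_def r_def W_def)
  finally have "Re (disc D E) \<ge> t ^ 4 + 18 * r\<^sup>2 * t\<^sup>2 - 27 * r ^ 4 - 8 * (r * t ^ 3)"
    by (simp add: disc)
  also have "t ^ 4 + 18 * r\<^sup>2 * t\<^sup>2 - 27 * r ^ 4 - 8 * (r * t ^ 3)
      = t ^ 3 * (t - 8 * r) + 18 * r\<^sup>2 * t\<^sup>2 - 27 * r ^ 4"
    by (simp add: power4_eq_xxxx power3_eq_cube algebra_simps)
  finally have *: "Re (disc D E) \<ge> t ^ 3 * (t - 8 * r) + 18 * r\<^sup>2 * t\<^sup>2 - 27 * r ^ 4" .
  have "t ^ 3 * (t - 8 * r) > 0" using t by (intro mult_pos_pos zero_less_power) auto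
  moreover have "18 * r\<^sup>2 * t\<^sup>2 \<ge> 18 * r\<^sup>2 * (9 * r)\<^sup>2"
    using t by (intro mult_left_mono power_mono) auto
  then have "18 * r\<^sup>2 * t\<^sup>2 \<ge> 27 * r ^ 4"
    using zero_le_power[OF t(2), of 4] by (simp add: power2_eq_square power4_eq_xxxx)
  ultimately show ?thesis using * by linarith
qed

text \<open>The discriminant has degree four in \<open>E\<close> and \<open>cnj E\<close>, hence
  degree at most eight in \<open>y\<close>. It vanishes on \<open>S\<close> because of the double
  root, and the point \<open>a\<close> shows that it is not identically zero.\<close>

lemma in_curve_disc:
  assumes E: "cpolyfun 2 E"
    and S: "\<And>y. y \<in> S \<Longrightarrow> \<exists>\<theta>. \<theta> * cnj \<theta> = 1 \<and> E y = 2 * D * cnj \<theta> + \<theta>\<^sup>2 * cnj D"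
    and a: "cmod (E a) \<ge> 9 * cmod D + 1"
  shows "in_curve 8 S"
proof -
  note E' = cpolyfun_cnj[OF E]
  have EE: "cpolyfun 4 (\<lambda>y. E y * cnj (E y))" "cpolyfun 4 (\<lambda>y. E y * E y)"
    "cpolyfun 4 (\<lambda>y. cnj (E y) * cnj (E y))"
    by (rule cpolyfun_mult[OF E E'] cpolyfun_mult[OF E E] cpolyfun_mult[OF E' E'], simp)+
  have EEE: "cpolyfun 6 (\<lambda>y. cnj (E y) * (cnj (E y) * cnj (E y)))" "cpolyfun 6 (\<lambda>y. E y * (E y * E y))"
    by (rule cpolyfun_mult[OF E' EE(3)] cpolyfun_mult[OF E EE(2)], simp)+
  have c: "cpolyfun 8 (\<lambda>y. c * f y)" if "cpolyfun n f" "n \<le> 8" for c f n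
    by (rule cpolyfun_mult[OF cpolyfun_const[of 0] that(1)]) (use that in simp)
  have "cpolyfun 8 (\<lambda>y. E y * cnj (E y) * (E y * cnj (E y)))"
    by (rule cpolyfun_mult[OF EE(1) EE(1)]) simp
  from cpolyfun_add[OF cpolyfun_add[OF cpolyfun_add[OF cpolyfun_add[OF this
      c[OF EEE(1), of "- 4 * D"]] c[OF EEE(2), of "- 4 * cnj D"]] c[OF EE(1), of "18 * D * cnj D"]]
      cpolyfun_const[of 8 "- 27 * (D * cnj D) * (D * cnj D)"]]
  have "polyfun 8 (\<lambda>y. Re (disc D (E y)))"
    unfolding cpolyfun_def by (simp add: disc_def)
  moreover have "Re (disc D (E a)) \<noteq> 0" using a by (rule disc_neq_0)
  moreover have "S \<subseteq> {y. Re (disc D (E y)) = 0}" using S disc_eq_0 by fastforce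
  ultimately show ?thesis unfolding in_curve_def by blast
qed

section \<open>Normal forms with a nonreal linear factor\<close>

text \<open>Normal form when the two leading factors are not proportional: the first is
  \<open>U = z1 + \<i> * z2\<close>, the second is scaled to have coefficient one at
  \<open>V = z1 - \<i> * z2\<close>, and translations absorb all linear terms.\<close>

definition conic_UV :: "complex \<Rightarrow> complex \<Rightarrow> complex \<Rightarrow> complex \<Rightarrow> complex" where
  "conic_UV \<alpha> \<gamma> z1 z2 = (z1 + \<i> * z2) * (\<alpha> * (z1 + \<i> * z2) + (z1 - \<i> * z2)) - \<gamma>"

text \<open>Normal form when the leading form is a multiple of the square of \<open>U\<close>.
  Completing the square removes the linear term in \<open>U\<close>, but the one in the conjugate
  form stays.\<close>

definition conic_UU :: "complex \<Rightarrow> complex \<Rightarrow> complex \<Rightarrow> complex \<Rightarrow> complex" where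
  "conic_UU \<epsilon> \<phi> z1 z2 = (z1 + \<i> * z2)\<^sup>2 + \<epsilon> * (z1 - \<i> * z2) + \<phi>"

lemma improj_UV: "improj (conic_UV \<alpha> \<gamma>) = {y. \<exists>u. u * (\<alpha> * u + (cnj u + eta y)) = \<gamma>}"
  using improj_conj_coords[of "\<lambda>U V. U * (\<alpha> * U + V) - \<gamma>"]
  by (simp add: conic_UV_def[abs_def])

lemma improj_UU: "improj (conic_UU \<epsilon> \<phi>) = {y. \<exists>u. u\<^sup>2 + \<epsilon> * (cnj u + eta y) + \<phi> = 0}"
  using improj_conj_coords[of "\<lambda>U V. U\<^sup>2 + \<epsilon> * V + \<phi>"]
  by (simp add: conic_UU_def[abs_def])

text \<open>A fixed point of \<open>\<gamma> / v u\<close> solves the equation. On the unit disc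
  \<open>\<alpha> * u + cnj u\<close> has modulus at most \<open>cmod \<alpha> + 1\<close>, so the
  chosen radius leaves \<open>cmod (v u) \<ge> cmod \<gamma> + 1\<close> and the disc is mapped into
  itself.\<close>

lemma bounded_compl_UV: "bounded (- improj (conic_UV \<alpha> \<gamma>))"
proof (rule bounded_eta[of "cmod \<alpha> + cmod \<gamma> + 2"])
  fix y assume y: "cmod (eta y) \<ge> cmod \<alpha> + cmod \<gamma> + 2"
  define v where "v = (\<lambda>u. \<alpha> * u + (cnj u + eta y))"
  have v: "cmod (v u) \<ge> cmod \<gamma> + 1" if "u \<in> cball 0 1" for u
  proof -
    have "cmod (eta y) = cmod (v u - (\<alpha> * u + cnj u))" by (simp add: v_def)
    also have "\<dots> \<le> cmod (v u) + cmod (\<alpha> * u + cnj u)" by (rule norm_triangle_ineq4)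
    also have "cmod (\<alpha> * u + cnj u) \<le> cmod \<alpha> * cmod u + cmod u"
      by (rule norm_triangle_le) (simp add: norm_mult)
    also have "cmod \<alpha> * cmod u + cmod u \<le> cmod \<alpha> + 1"
      using that by (intro add_mono mult_left_le) auto
    finally show ?thesis using y by linarith
  qed
  then have v0: "v u \<noteq> 0" if "u \<in> cball 0 1" for u
  proof -
    have "cmod (v u) > 0" using v[OF that] norm_ge_zero[of \<gamma>] by linarith
    then show ?thesis by simp
  qed
  have "continuous_on (cball 0 1) (\<lambda>u. \<gamma> / v u)"
    using v0 unfolding v_def by (intro continuous_intros) auto
  moreover have "(\<lambda>u. \<gamma> / v u) \<in> cball 0 1 \<rightarrow> cball 0 1"
  proof
    fix u :: complex assume u: "u \<in> cball 0 1"
    then show "\<gamma> / v u \<in> cball 0 1"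
      using v[OF u] v0[OF u] by (simp add: norm_divide)
  qed
  ultimately obtain u where u: "u \<in> cball 0 1" "\<gamma> / v u = u"
    using brouwer_ball[of 1 0 "\<lambda>u. \<gamma> / v u"] by auto
  then have "u * v u = \<gamma>" using v0[OF u(1)] by (metis nonzero_eq_divide_eq)
  then show "y \<in> improj (conic_UV \<alpha> \<gamma>)" unfolding improj_UV v_def by blast
qed

text \<open>The ansatz \<open>u = u0 + v\<close> starts from a square root \<open>u0\<close> that
  ignores the term \<open>\<epsilon> * cnj u\<close>; the correction \<open>v\<close> is a fixed
  point of \<open>w\<close>. In the numerator \<open>\<epsilon> * cnj u0\<close> has modulus
  \<open>cmod \<epsilon> * cmod u0\<close>, and \<open>R\<close> makes \<open>u0\<close> so large
  that the rest contributes at most \<open>cmod u0\<close>. This explains the radius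
  \<open>cmod \<epsilon> + 1\<close>.\<close>

lemma bounded_compl_UU:
  assumes "\<epsilon> \<noteq> 0"
  shows "bounded (- improj (conic_UU \<epsilon> \<phi>))"
proof -
  define r where "r = cmod \<epsilon> + 1"
  define R where "R = (r\<^sup>2 + cmod \<epsilon> * r) ^ 2"
  have r: "r > 0" by (simp add: r_def add_nonneg_pos)
  show ?thesis
  proof (rule bounded_eta[of "(R + cmod \<phi>) / cmod \<epsilon>"])
    fix y assume "cmod (eta y) \<ge> (R + cmod \<phi>) / cmod \<epsilon>"
    then have "R + cmod \<phi> \<le> cmod (\<epsilon> * eta y)"
      using assms by (simp add: field_simps norm_mult)
    then have R: "R \<le> cmod (- (\<epsilon> * eta y + \<phi>))"
      using norm_triangle_ineq4[of "\<epsilon> * eta y + \<phi>" \<phi>] by (simp only: norm_minus_cancel) simp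
    define u0 where "u0 = csqrt (- (\<epsilon> * eta y + \<phi>))"
    have u0: "u0\<^sup>2 = - (\<epsilon> * eta y + \<phi>)" by (simp add: u0_def)
    have "(r\<^sup>2 + cmod \<epsilon> * r) ^ 2 \<le> (cmod u0) ^ 2"
      using R unfolding u0[symmetric] R_def by (simp add: norm_power)
    then have u0_ge: "r\<^sup>2 + cmod \<epsilon> * r \<le> cmod u0"
      using power2_le_imp_le norm_ge_zero by blast
    have "0 < r\<^sup>2" using r by simp
    then have u0_pos: "cmod u0 > 0" using u0_ge r
      by (meson add_pos_nonneg less_eq_real_def less_le_trans mult_nonneg_nonneg norm_ge_zero)
    define w where "w = (\<lambda>v. - (\<epsilon> * cnj u0 + (v\<^sup>2 + \<epsilon> * cnj v)) / (2 * u0))"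
    have "continuous_on (cball 0 r) w"
      using u0_pos unfolding w_def by (intro continuous_intros) auto
    moreover have "w \<in> cball 0 r \<rightarrow> cball 0 r"
    proof
      fix v :: complex assume v: "v \<in> cball 0 r"
      have "cmod (\<epsilon> * cnj u0 + (v\<^sup>2 + \<epsilon> * cnj v)) \<le> cmod \<epsilon> * cmod u0 + (cmod v ^ 2 + cmod \<epsilon> * cmod v)"
        by (intro norm_triangle_le add_mono) (auto simp: norm_mult norm_power)
      also have "\<dots> \<le> cmod \<epsilon> * cmod u0 + (r ^ 2 + cmod \<epsilon> * r)"
        using v by (intro add_mono power_mono mult_left_mono) auto
      also have "\<dots> \<le> cmod \<epsilon> * cmod u0 + cmod u0" using u0_ge by simp
      also have "\<dots> = r * cmod u0" by (simp add: r_def algebra_simps)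
      also have "\<dots> \<le> r * (2 * cmod u0)" using r u0_pos by simp
      finally have "cmod (w v) \<le> r"
        using u0_pos by (simp add: w_def norm_divide norm_mult divide_le_eq norm_minus_cancel del: minus_add_distrib)
      then show "w v \<in> cball 0 r" by simp
    qed
    ultimately obtain v where "w v = v" using brouwer_ball[OF r, of 0 w] by blast
    then have "2 * u0 * v = - (\<epsilon> * cnj u0 + (v\<^sup>2 + \<epsilon> * cnj v))"
      using u0_pos unfolding w_def by (auto simp: field_simps)
    then have "(u0 + v)\<^sup>2 + \<epsilon> * cnj (u0 + v) = u0\<^sup>2"
      by (simp add: power2_eq_square algebra_simps)
    then have "(u0 + v)\<^sup>2 + \<epsilon> * (cnj (u0 + v) + eta y) + \<phi> = 0"
      unfolding u0 by (simp add: algebra_simps)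
    then show "y \<in> improj (conic_UU \<epsilon> \<phi>)" unfolding improj_UU by blast
  qed
qed

lemma conic_UV_eq_conic: "conic_UV \<alpha> \<gamma> = conic (\<alpha> + 1) (2 * \<i> * \<alpha>) (1 - \<alpha>) 0 0 (- \<gamma>)"
  by (auto simp: fun_eq_iff conic_UV_def conic_def power2_eq_square algebra_simps)

lemma conic_UU_eq_conic: "conic_UU \<epsilon> \<phi> = conic 1 (2 * \<i>) (- 1) \<epsilon> (- \<i> * \<epsilon>) \<phi>"
  by (auto simp: fun_eq_iff conic_UU_def conic_def power2_eq_square algebra_simps)

text \<open>If \<open>A\<close> and \<open>B\<close> are the derivatives with respect to
  \<open>U\<close> and \<open>V\<close>, then those with respect to \<open>z1\<close> and
  \<open>z2\<close> are \<open>A + B\<close> and \<open>\<i> * (A - B)\<close>. Tangency thus means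
  that \<open>A\<close> and \<open>B\<close> have equal modulus.\<close>

lemma Im_gradient_conj_coords: "Im ((A + B) * cnj (\<i> * (A - B))) = (cmod B)\<^sup>2 - (cmod A)\<^sup>2"
  unfolding cmod_power2 by (simp add: power2_eq_square algebra_simps)

text \<open>
  Up to a constant factor, the cubic of the pencil spanned by the two quadrics has outer coefficient
  $-\gamma$ and inner coefficient \<open>E\<close> below. At a tangency its double root is given by the quotient of
  the two partial derivatives, which has modulus $1$.
\<close>

lemma tame_UV_generic:
  assumes "cmod \<alpha> \<noteq> 1"
  shows "tame (improj (conic_UV \<alpha> \<gamma>))"
proof -
  define c where "c = (4 * \<alpha> * cnj \<alpha> - 2) * \<gamma> - cnj \<gamma>"
  define E where "E = (\<lambda>y. cnj \<alpha> * (eta y * eta y) + (- 1) * (eta y * cnj (eta y)) + c)"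
  \<comment> \<open>At a real point \<open>V\<close> is the conjugate of \<open>U\<close>, so a
    nontrivial zero of the leading form would give \<open>\<alpha> * u = - cnj u\<close> and force
    modulus one.\<close>
  have nv: "nonvanishing_form (\<alpha> + 1) (2 * \<i> * \<alpha>) (1 - \<alpha>)"
    unfolding nonvanishing_form_def
  proof (intro allI impI notI)
    fix x1 x2 :: real assume x: "(x1, x2) \<noteq> (0, 0)"
      and 0: "(\<alpha> + 1) * of_real x1 ^ 2 + 2 * \<i> * \<alpha> * of_real x1 * of_real x2 + (1 - \<alpha>) * of_real x2 ^ 2 = 0"
    define u where "u = Complex x1 x2"
    have u: "u \<noteq> 0" using x by (simp add: u_def complex_eq_iff)
    have "u * (\<alpha> * u + cnj u) = 0"
      using 0 unfolding u_def Complex_eq by (simp add: power2_eq_square algebra_simps)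
    then have "\<alpha> * u = - cnj u" using u by (simp add: eq_neg_iff_add_eq_0)
    then have "cmod \<alpha> * cmod u = cmod u" by (metis complex_mod_cnj norm_minus_cancel norm_mult)
    then show False using u assms by simp
  qed
  have cE: "cpolyfun 2 E"
  proof -
    have "cpolyfun 2 (\<lambda>y. eta y * eta y)" "cpolyfun 2 (\<lambda>y. eta y * cnj (eta y))"
      by (rule cpolyfun_mult[OF cpolyfun_eta cpolyfun_eta]
            cpolyfun_mult[OF cpolyfun_eta cpolyfun_cnj[OF cpolyfun_eta]], simp)+
    from cpolyfun_mult[OF cpolyfun_const[of 0 "cnj \<alpha>"] this(1), of 2]
      cpolyfun_mult[OF cpolyfun_const[of 0 "- 1"] this(2), of 2]
    show ?thesis unfolding E_def by (intro cpolyfun_add cpolyfun_const) simp_all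
  qed
  have crit: "\<exists>\<theta>. \<theta> * cnj \<theta> = 1 \<and> E y = 2 * (- \<gamma>) * cnj \<theta> + \<theta>\<^sup>2 * cnj (- \<gamma>)"
    if y: "y \<in> frontier (improj (conic_UV \<alpha> \<gamma>))" for y
  proof -
    obtain z1 z2 where z: "y = (Im z1, Im z2)" "conic_UV \<alpha> \<gamma> z1 z2 = 0"
      "Im ((2 * (\<alpha> + 1) * z1 + 2 * \<i> * \<alpha> * z2 + 0) * cnj (2 * \<i> * \<alpha> * z1 + 2 * (1 - \<alpha>) * z2 + 0)) = 0"
      using frontier_improj_conic[OF nv y[unfolded conic_UV_eq_conic]] conic_UV_eq_conic by metis
    define u where "u = z1 + \<i> * z2"
    \<comment> \<open>The derivative with respect to \<open>U\<close>; the derivative with respect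
      to \<open>V\<close> is \<open>u\<close>.\<close>
    define P where "P = 2 * \<alpha> * u + (cnj u + eta y)"
    have V: "z1 - \<i> * z2 = cnj u + eta y" by (simp add: u_def z(1) eta_def complex_eq_iff)
    have \<gamma>: "\<gamma> = u * (\<alpha> * u + (cnj u + eta y))"
      using z(2) unfolding conic_UV_def V u_def[symmetric] by simp
    have "2 * (\<alpha> + 1) * z1 + 2 * \<i> * \<alpha> * z2 + 0 = P + u"
      "2 * \<i> * \<alpha> * z1 + 2 * (1 - \<alpha>) * z2 + 0 = \<i> * (P - u)"
      unfolding P_def V[symmetric] unfolding u_def by (simp_all add: algebra_simps)
    with z(3) have "(cmod u)\<^sup>2 = (cmod P)\<^sup>2" by (simp only: Im_gradient_conj_coords right_minus_eq)
    then have Pu: "P * cnj P = u * cnj u" by (metis complex_norm_square)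
    show ?thesis
    proof (cases "u = 0")
      case True
      then have "P = 0" using Pu by simp
      then have "eta y = 0" using True by (simp add: P_def)
      then show ?thesis using \<gamma> True by (intro exI[of _ 1]) (simp add: E_def c_def)
    next
      case False
      define t where "t = P / cnj u"
      have t: "t * cnj t = 1" using Pu False by (simp add: t_def)
      have "P = t * cnj u" using False by (simp add: t_def)
      then have \<eta>: "eta y = t * cnj u - 2 * \<alpha> * u - cnj u" by (simp add: P_def algebra_simps)
      \<comment> \<open>With \<open>eta y\<close> and \<open>\<gamma>\<close> written in terms of
        \<open>u\<close>, \<open>t\<close> and their conjugates, the double root relation is a
        polynomial identity modulo \<open>t * cnj t = 1\<close>.\<close>
      have "\<gamma> = u * (t * cnj u - \<alpha> * u)" unfolding \<gamma> \<eta> by (simp add: algebra_simps)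
      moreover define s a v where "s = cnj t" and "a = cnj \<alpha>" and "v = cnj u"
      moreover define g' n n' where "g' = cnj \<gamma>" and "n = eta y" and "n' = cnj n"
      ultimately have *: "\<gamma> = u * (t * v - \<alpha> * u)" "g' = v * (s * u - a * v)"
        "n = t * v - 2 * \<alpha> * u - v" "n' = s * u - 2 * a * v - u" "t * s = 1"
        using \<eta> t by simp_all
      have "E y = a * (n * n) + (- 1) * (n * n') + ((4 * \<alpha> * a - 2) * \<gamma> - g')"
        by (simp add: E_def c_def a_def n_def n'_def g'_def)
      also have "\<dots> = 2 * (- \<gamma>) * s + t\<^sup>2 * (- g')"
        unfolding *(1-4) using *(5) by algebra
      finally have "E y = 2 * (- \<gamma>) * s + t\<^sup>2 * (- g')" .
      then show ?thesis using t by (intro exI[of _ t]) (simp add: s_def g'_def)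
    qed
  qed
  \<comment> \<open>For a real value \<open>s\<close> of \<open>eta y\<close> the quadratic part of
    \<open>E\<close> is \<open>s\<^sup>2 * (cnj \<alpha> - 1)\<close>, which does not vanish
    identically; \<open>s\<close> is scaled so that \<open>E\<close> dominates the outer coefficient
    in spite of \<open>c\<close>.\<close>
  define M where "M = 9 * cmod (- \<gamma>) + 1 + cmod c"
  have "cnj \<alpha> \<noteq> 1" using assms by (metis complex_mod_cnj norm_one)
  then have k: "cmod (cnj \<alpha> - 1) > 0" by simp
  define s where "s = sqrt (M / cmod (cnj \<alpha> - 1))"
  have "s\<^sup>2 = M / cmod (cnj \<alpha> - 1)" using k by (simp add: s_def M_def)
  then have s: "M = s\<^sup>2 * cmod (cnj \<alpha> - 1)" using k by simp
  obtain y where y: "eta y = of_real s" using eta_surj by blast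
  have "E y = of_real (s\<^sup>2) * (cnj \<alpha> - 1) + c" by (simp add: E_def y power2_eq_square algebra_simps)
  then have "cmod (of_real (s\<^sup>2) * (cnj \<alpha> - 1)) \<le> cmod (E y) + cmod c"
    using norm_triangle_ineq4[of "E y" c] by simp
  then have "cmod (E y) \<ge> 9 * cmod (- \<gamma>) + 1"
    using s unfolding M_def norm_mult norm_of_real by simp
  then show ?thesis
    unfolding tame_def using in_curve_disc[OF cE crit] bounded_compl_UV by blast
qed

text \<open>The derivatives are now \<open>2 * u\<close> and \<open>\<epsilon>\<close>. The outer
  coefficient is \<open>\<epsilon>\<^sup>2 / 4\<close> and the inner one is affine in
  \<open>y\<close>; with \<open>t = 2 * u / cnj \<epsilon>\<close> the double root relation is the
  equation of the conic itself.\<close>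

lemma tame_UU: "tame (improj (conic_UU \<epsilon> \<phi>))"
proof (cases "\<epsilon> = 0")
  case True
  have "\<exists>u. u\<^sup>2 + \<phi> = 0" by (rule exI[of _ "csqrt (- \<phi>)"]) simp
  then have "improj (conic_UU \<epsilon> \<phi>) = UNIV" unfolding improj_UU True by simp
  then show ?thesis by (simp add: tame_def low_degree_pieces_empty)
next
  case False
  define E where "E = (\<lambda>y. (- \<epsilon>) * eta y + (- \<phi>))"
  have nv: "nonvanishing_form 1 (2 * \<i>) (- 1)"
    unfolding nonvanishing_form_def
  proof (intro allI impI notI)
    fix x1 x2 :: real assume x: "(x1, x2) \<noteq> (0, 0)"
      and 0: "1 * of_real x1 ^ 2 + 2 * \<i> * of_real x1 * of_real x2 + - 1 * of_real x2 ^ 2 = 0"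
    have "(Complex x1 x2)\<^sup>2 = 0"
      using 0 unfolding Complex_eq by (simp add: power2_eq_square algebra_simps)
    then have "Complex x1 x2 = 0" by simp
    then show False using x by (simp add: complex_eq_iff)
  qed
  have cE: "cpolyfun 2 E"
    using cpolyfun_mult[OF cpolyfun_const[of 0 "- \<epsilon>"] cpolyfun_eta, of 2]
    unfolding E_def by (intro cpolyfun_add cpolyfun_const) simp_all
  have crit: "\<exists>\<theta>. \<theta> * cnj \<theta> = 1 \<and> E y = 2 * (\<epsilon>\<^sup>2 / 4) * cnj \<theta> + \<theta>\<^sup>2 * cnj (\<epsilon>\<^sup>2 / 4)"
    if y: "y \<in> frontier (improj (conic_UU \<epsilon> \<phi>))" for y
  proof -
    obtain z1 z2 where z: "y = (Im z1, Im z2)" "conic_UU \<epsilon> \<phi> z1 z2 = 0"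
      "Im ((2 * 1 * z1 + 2 * \<i> * z2 + \<epsilon>) * cnj (2 * \<i> * z1 + 2 * (- 1) * z2 + - \<i> * \<epsilon>)) = 0"
      using frontier_improj_conic[OF nv y[unfolded conic_UU_eq_conic]] conic_UU_eq_conic by metis
    define u where "u = z1 + \<i> * z2"
    have V: "z1 - \<i> * z2 = cnj u + eta y" by (simp add: u_def z(1) eta_def complex_eq_iff)
    have u: "u\<^sup>2 + \<epsilon> * (cnj u + eta y) + \<phi> = 0"
      using z(2) unfolding conic_UU_def V u_def[symmetric] by simp
    have "2 * 1 * z1 + 2 * \<i> * z2 + \<epsilon> = 2 * u + \<epsilon>"
      "2 * \<i> * z1 + 2 * (- 1) * z2 + - \<i> * \<epsilon> = \<i> * (2 * u - \<epsilon>)"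
      unfolding u_def by (simp_all add: algebra_simps)
    with z(3) have "(cmod \<epsilon>)\<^sup>2 = (cmod (2 * u))\<^sup>2" by (simp only: Im_gradient_conj_coords right_minus_eq)
    then have "of_real ((cmod \<epsilon>)\<^sup>2) = (of_real ((cmod (2 * u))\<^sup>2) :: complex)" by (simp only:)
    then have *: "\<epsilon> * cnj \<epsilon> = 4 * u * cnj u"
      unfolding complex_norm_square by simp
    define t where "t = 2 * u / cnj \<epsilon>"
    have "u \<noteq> 0" using False * by auto
    then have t: "t * cnj t = 1" using False * by (simp add: t_def mult.commute mult.left_commute)
    have "2 * (\<epsilon>\<^sup>2 / 4) * cnj t = \<epsilon> * cnj u" "t\<^sup>2 * cnj (\<epsilon>\<^sup>2 / 4) = u\<^sup>2"
      using False by (simp_all add: t_def power2_eq_square)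
    moreover have "E y = \<epsilon> * cnj u + u\<^sup>2"
      using u unfolding E_def by algebra
    ultimately show ?thesis using t by metis
  qed
  obtain y where y: "eta y = - (of_real (9 * cmod (\<epsilon>\<^sup>2 / 4) + 1) + \<phi>) / \<epsilon>" using eta_surj by blast
  have "E y = of_real (9 * cmod (\<epsilon>\<^sup>2 / 4) + 1)" using False by (simp add: E_def y)
  then have "cmod (E y) \<ge> 9 * cmod (\<epsilon>\<^sup>2 / 4) + 1" by (simp add: norm_of_real del: of_real_add of_real_mult)
  then show ?thesis
    unfolding tame_def using in_curve_disc[OF cE crit] bounded_compl_UU[OF False] by blast
qed

lemma frontier_subset_complement_open:
  assumes "open U" "U \<subseteq> S"
  shows "frontier S \<subseteq> - U"
  using interior_maximal[OF assms(2,1)] by (auto simp: frontier_def)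

lemma continuous_on_eta: "continuous_on A eta"
  unfolding eta_def by (intro continuous_intros)

text \<open>Rotating \<open>u\<close> by a square root \<open>w\<close> of \<open>\<alpha>\<close>
  turns the equation into \<open>v * (v + cnj v + p) = \<gamma>\<close> with
  \<open>p = cnj w * eta y\<close>. The second factor has the prescribed imaginary part
  \<open>Im p\<close>, so one real unknown remains. It can be found whenever
  \<open>Im p \<noteq> 0\<close>, which leaves only a line for the boundary.\<close>

lemma tame_UV_unit:
  assumes "cmod \<alpha> = 1"
  shows "tame (improj (conic_UV \<alpha> \<gamma>))"
proof -
  define w where "w = csqrt \<alpha>"
  have w2: "w * w = \<alpha>" by (simp add: w_def flip: power2_eq_square)
  have "cmod w ^ 2 = 1" using assms w2 by (metis norm_mult power2_eq_square)
  then have ww: "w * cnj w = 1" by (metis complex_norm_square of_real_1)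
  define U where "U = {y. Im (cnj w * eta y) \<noteq> 0}"
  have "U \<subseteq> improj (conic_UV \<alpha> \<gamma>)"
  proof
    fix y assume "y \<in> U"
    define p where "p = cnj w * eta y"
    have q: "Im p \<noteq> 0" using \<open>y \<in> U\<close> by (simp add: U_def p_def)
    define W where "W = (\<lambda>t. Complex t (Im p))"
    have W0: "W t \<noteq> 0" and W_ge: "cmod (W t) \<ge> \<bar>Im p\<bar>" for t
      using q abs_Im_le_cmod[of "W t"] by (auto simp: W_def complex_eq_iff)
    \<comment> \<open>For \<open>v = \<gamma> / W t\<close> it remains that
      \<open>v + cnj v + p = W t\<close>. The imaginary parts agree by the choice of
      \<open>W\<close>, and \<open>g t = Re p\<close> is the real part. As \<open>g\<close> differs
      from the identity by at most \<open>2 * k\<close>, the value is attained.\<close>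
    define g where "g = (\<lambda>t. t - 2 * Re (\<gamma> / W t))"
    define k where "k = cmod \<gamma> / \<bar>Im p\<bar>"
    have k: "\<bar>Re (\<gamma> / W t)\<bar> \<le> k" for t
    proof -
      have "\<bar>Re (\<gamma> / W t)\<bar> \<le> cmod \<gamma> / cmod (W t)"
        using abs_Re_le_cmod[of "\<gamma> / W t"] by (simp add: norm_divide)
      also have "\<dots> \<le> k" unfolding k_def using W_ge[of t] W0[of t] q by (intro divide_left_mono) auto
      finally show ?thesis .
    qed
    have "g (Re p - 2 * k) \<le> Re p" "Re p \<le> g (Re p + 2 * k)" "Re p - 2 * k \<le> Re p + 2 * k"
      using k[of "Re p - 2 * k"] k[of "Re p + 2 * k"] unfolding g_def by auto
    moreover have "continuous_on {Re p - 2 * k .. Re p + 2 * k} g"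
      using W0 unfolding g_def W_def by (intro continuous_intros) (auto simp: complex_eq_iff)
    ultimately obtain t where "g t = Re p" using IVT'[of g "Re p - 2 * k" "Re p" "Re p + 2 * k"] by auto
    define v where "v = \<gamma> / W t"
    have "v + cnj v + p = W t"
      using \<open>g t = Re p\<close> unfolding g_def v_def[symmetric] by (simp add: complex_eq_iff W_def)
    then have v: "v * (v + cnj v + p) = \<gamma>" using W0 by (simp add: v_def)
    have "(cnj w * v) * (\<alpha> * (cnj w * v) + (cnj (cnj w * v) + eta y)) = v * (v + cnj v + p)"
    proof -
      define s n where "s = cnj w" and "n = eta y"
      have s: "w * s = 1" using ww by (simp add: s_def)
      have "(s * v) * (w * w * (s * v) + (w * cnj v + n)) = v * (v + cnj v + s * n)"
        using s by algebra
      then show ?thesis by (simp add: s_def n_def p_def w2)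
    qed
    then show "y \<in> improj (conic_UV \<alpha> \<gamma>)" unfolding improj_UV using v by blast
  qed
  moreover have "open U"
    unfolding U_def by (intro open_Collect_neq continuous_intros continuous_on_eta)
  ultimately have "frontier (improj (conic_UV \<alpha> \<gamma>)) \<subseteq> - U" by (rule frontier_subset_complement_open[rotated])
  then have sub: "frontier (improj (conic_UV \<alpha> \<gamma>)) \<subseteq> {y. Im (cnj w * eta y) = 0}"
    by (auto simp: U_def)
  have "cpolyfun 8 (\<lambda>y. cnj w * eta y)"
    by (rule cpolyfun_mult[OF cpolyfun_const[of 0] cpolyfun_eta]) simp
  then have pf: "polyfun 8 (\<lambda>y. Im (cnj w * eta y))" by (simp only: cpolyfun_def)
  obtain a where "eta a = w * \<i>" using eta_surj by blast
  then have "Im (cnj w * eta a) \<noteq> 0" using ww by (simp add: mult.commute mult.left_commute flip: mult.assoc)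
  then have "in_curve 8 (frontier (improj (conic_UV \<alpha> \<gamma>)))"
    unfolding in_curve_def using sub pf by blast
  then show ?thesis unfolding tame_def using bounded_compl_UV by blast
qed

lemma tame_UV: "tame (improj (conic_UV \<alpha> \<gamma>))"
  using tame_UV_unit tame_UV_generic by blast

text \<open>Necessity is the inequality of arithmetic and geometric means for the moduli of the two
  factors, whose difference up to conjugation is \<open>eta y\<close>. For sufficiency,
  \<open>u = cnj (eta y) * W\<close> reduces the equation to
  \<open>W * (cnj W + 1) = \<gamma> / s\<close>, which fixes \<open>Im W\<close> and leaves a real
  quadratic equation.\<close>

lemma improj_circle:
  "improj (conic_UV 0 \<gamma>) = {y. 2 * (cmod \<gamma> - Re \<gamma>) \<le> 4 * (norm y)\<^sup>2}"
proof -
  have "(\<exists>u. u * (cnj u + eta y) = \<gamma>) \<longleftrightarrow> 2 * (cmod \<gamma> - Re \<gamma>) \<le> (cmod (eta y))\<^sup>2" for y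
  proof
    assume "\<exists>u. u * (cnj u + eta y) = \<gamma>"
    then obtain u where u: "u * (cnj u + eta y) = \<gamma>" by blast
    define V where "V = cnj u + eta y"
    have \<gamma>: "\<gamma> = u * V" using u by (simp add: V_def)
    have n: "eta y = V - cnj u" by (simp add: V_def)
    have "(cmod (eta y))\<^sup>2 + 2 * Re \<gamma> = (cmod V)\<^sup>2 + (cmod u)\<^sup>2"
      unfolding n \<gamma> cmod_power2 by (simp add: power2_eq_square algebra_simps)
    moreover have "2 * cmod \<gamma> \<le> (cmod V)\<^sup>2 + (cmod u)\<^sup>2"
      using sum_squares_bound[of "cmod V" "cmod u"] by (simp add: \<gamma> norm_mult mult_ac)
    ultimately show "2 * (cmod \<gamma> - Re \<gamma>) \<le> (cmod (eta y))\<^sup>2" by (simp add: right_diff_distrib)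
  next
    assume le: "2 * (cmod \<gamma> - Re \<gamma>) \<le> (cmod (eta y))\<^sup>2"
    show "\<exists>u. u * (cnj u + eta y) = \<gamma>"
    proof (cases "eta y = 0")
      case True
      then have "cmod \<gamma> \<le> Re \<gamma>" using le by simp
      then have "Re \<gamma> = cmod \<gamma>" using complex_Re_le_cmod[of \<gamma>] by simp
      then have g: "Re \<gamma> \<ge> 0" "Im \<gamma> = 0"
        using cmod_power2[of \<gamma>] norm_ge_zero[of \<gamma>] by auto
      then show ?thesis
        by (intro exI[of _ "of_real (sqrt (Re \<gamma>))"]) (simp add: True complex_eq_iff)
    next
      case False
      define s where "s = (cmod (eta y))\<^sup>2"
      have s: "s > 0" using False by (simp add: s_def)
      \<comment> \<open>A quarter of the discriminant of the quadratic for
        \<open>a = s * Re W\<close>; squaring the assumed inequality shows that it is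
        nonnegative.\<close>
      define D where "D = s\<^sup>2 / 4 + s * Re \<gamma> - (Im \<gamma>)\<^sup>2"
      have "(2 * cmod \<gamma>)\<^sup>2 \<le> (s + 2 * Re \<gamma>)\<^sup>2"
        using le by (intro power_mono) (auto simp: s_def)
      then have D: "D \<ge> 0"
        unfolding power_mult_distrib cmod_power2 D_def by (simp add: power2_eq_square algebra_simps)
      define a where "a = sqrt D - s / 2"
      have a: "a * a + s * a + (Im \<gamma>)\<^sup>2 = s * Re \<gamma>"
      proof -
        have "(sqrt D)\<^sup>2 = D" using D by simp
        then show ?thesis unfolding a_def D_def by (simp add: power2_eq_square algebra_simps field_simps)
      qed
      define W where "W = Complex (a / s) (Im \<gamma> / s)"
      define u where "u = cnj (eta y) * W"
      have "u * (cnj u + eta y) = of_real s * (W * (cnj W + 1))"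
        unfolding u_def s_def complex_norm_square by (simp add: algebra_simps)
      also have "\<dots> = \<gamma>"
      proof -
        define A G where "A = a / s" and "G = Im \<gamma> / s"
        have AG: "a = s * A" "Im \<gamma> = s * G" using s by (simp_all add: A_def G_def)
        have "s * Re \<gamma> = s * (s * (A * (A + 1) + G * G))"
          unfolding a[symmetric] AG by (simp add: power2_eq_square algebra_simps)
        then have "s * (A * (A + 1) + G * G) = Re \<gamma>" using s by simp
        moreover have "W = Complex A G" by (simp add: W_def A_def G_def)
        ultimately show ?thesis using AG by (simp add: complex_eq_iff algebra_simps)
      qed
      finally show ?thesis by blast
    qed
  qed
  then show ?thesis unfolding improj_UV by (simp add: norm_eta power_mult_distrib)
qed

lemma low_degree_circle: "low_degree_pieces (frontier (improj (conic_UV 0 \<gamma>)))"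
proof -
  define r where "r = (cmod \<gamma> - Re \<gamma>) / 2"
  have S: "improj (conic_UV 0 \<gamma>) = {y. r \<le> (norm y)\<^sup>2}" by (auto simp: improj_circle r_def)
  have "r \<ge> 0" using complex_Re_le_cmod[of \<gamma>] by (simp add: r_def)
  show ?thesis
  proof (cases "r = 0")
    case True
    then show ?thesis by (simp add: S low_degree_pieces_empty)
  next
    case False
    then have r: "r > 0" using \<open>r \<ge> 0\<close> by simp
    have "r \<le> (norm y)\<^sup>2 \<longleftrightarrow> sqrt r \<le> norm y" for y :: "real \<times> real"
      using r by (metis norm_ge_zero real_sqrt_le_iff real_sqrt_abs abs_norm_cancel)
    then have "improj (conic_UV 0 \<gamma>) = - ball 0 (sqrt r)" unfolding S by auto
    then have "frontier (improj (conic_UV 0 \<gamma>)) = sphere 0 (sqrt r)"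
      using r by (simp add: frontier_complement)
    also have "\<dots> = {y. fst y * fst y + snd y * snd y - r = 0}"
      using r by (auto simp: norm_Pair power2_eq_square real_sqrt_unique)
    also have "low_degree_pieces \<dots>"
    proof (rule low_degree_pieces_zeros)
      show "polyfun 2 (\<lambda>y. fst y * fst y + snd y * snd y - r)"
        by (intro polyfun_diff polyfun.add polyfun.const polyfun.mult[of 1 fst 1] polyfun.mult[of 1 snd 1]
            polyfun_fst polyfun_snd) simp_all
      show "fst (0 :: real \<times> real) * fst (0 :: real \<times> real) + snd (0 :: real \<times> real) * snd (0 :: real \<times> real) - r \<noteq> 0"
        using r by simp
    qed
    finally show ?thesis .
  qed
qed

subsection \<open>Conics whose leading form splits into real linear factors\<close>

lemma polyfun_prod: "polyfun 2 (\<lambda>y. fst y * snd y)"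
  by (rule polyfun.mult[of 1 fst 1]) (auto intro: polyfun_fst polyfun_snd)

text \<open>The product of the coordinates is a saddle without local extrema: a diagonal step adds
  \<open>d * d\<close> and an antidiagonal one subtracts it, while the signs \<open>s\<close> and
  \<open>t\<close> keep the first order terms from interfering.\<close>

lemma prod_perturb:
  fixes y :: "real \<times> real"
  assumes "e > 0"
  obtains y1 y2 where "dist y1 y < e" "dist y2 y < e"
    "fst y1 * snd y1 > fst y * snd y" "fst y2 * snd y2 < fst y * snd y"
proof -
  obtain a b where y: "y = (a, b)" by force
  define d where "d = e / 2"
  have d: "d > 0" using assms by (simp add: d_def)
  have *: "dist (a + s * d, b + t * d) y < e" if "\<bar>s\<bar> = 1" "\<bar>t\<bar> = 1" for s t
  proof -
    have "s\<^sup>2 = 1" "t\<^sup>2 = 1" using that by (simp_all add: abs_square_eq_1)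
    then have "dist (a + s * d, b + t * d) y = sqrt (2 * d\<^sup>2)"
      by (simp add: y dist_Pair_Pair dist_real_def power_mult_distrib abs_mult)
    also have "\<dots> = sqrt 2 * d" using d by (simp add: real_sqrt_mult)
    also have "\<dots> < 2 * d" using d sqrt2_less_2 by simp
    finally show ?thesis by (simp add: d_def)
  qed
  define s where "s = (if a + b \<ge> 0 then 1 else - 1 :: real)"
  define t where "t = (if b - a \<le> 0 then 1 else - 1 :: real)"
  have "s * s = 1" "t * t = 1" "s * (a + b) \<ge> 0" "t * (b - a) \<le> 0" "\<bar>s\<bar> = 1" "\<bar>t\<bar> = 1"
    by (auto simp: s_def t_def)
  moreover have "(a + s * d) * (b + s * d) = a * b + d * (s * (a + b)) + (s * s) * (d * d)"
    "(a + t * d) * (b + (- t) * d) = a * b + d * (t * (b - a)) - (t * t) * (d * d)"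
    by (simp_all add: algebra_simps)
  moreover have "d * d > 0" using d by simp
  ultimately have "(a + s * d) * (b + s * d) > a * b" "(a + t * d) * (b + (- t) * d) < a * b"
    using d by (simp_all add: mult_nonneg_nonneg mult_nonneg_nonpos add_nonneg_pos add_nonpos_neg)
  then show thesis
    using *[of s s] *[of t "- t"] \<open>\<bar>s\<bar> = 1\<close> \<open>\<bar>t\<bar> = 1\<close>
    by (intro that[of "(a + s * d, b + s * d)" "(a + t * d, b + (- t) * d)"]) (auto simp: y)
qed

text \<open>The quantity is the real part of \<open>z1 * cnj z2\<close>, a number of modulus
  \<open>cmod \<gamma>\<close>.\<close>

lemma improj_prod_le:
  assumes "y \<in> improj (\<lambda>z1 z2. z1 * z2 - \<gamma>)"
  shows "\<bar>2 * (fst y * snd y) + Re \<gamma>\<bar> \<le> cmod \<gamma>"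
proof -
  obtain z1 z2 where z: "y = (Im z1, Im z2)" "\<gamma> = z1 * z2"
    using assms unfolding improj_def by auto
  have "2 * (fst y * snd y) + Re \<gamma> = Re (z1 * cnj z2)" by (simp add: z)
  then show ?thesis using abs_Re_le_cmod[of "z1 * cnj z2"] by (simp add: z norm_mult)
qed

text \<open>With \<open>y = (a, b)\<close>, the numbers \<open>x1 * b\<close> and
  \<open>a * x2\<close> have sum \<open>Im \<gamma>\<close> and product
  \<open>a * b * (Re \<gamma> + a * b)\<close>. They are real roots of a quadratic with discriminant
  \<open>D\<close>, and dividing by \<open>b\<close> and \<open>a\<close> recovers the real
  parts.\<close>

lemma improj_prod_ge:
  assumes y: "fst y \<noteq> 0" "snd y \<noteq> 0" and le: "\<bar>2 * (fst y * snd y) + Re \<gamma>\<bar> \<le> cmod \<gamma>"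
  shows "y \<in> improj (\<lambda>z1 z2. z1 * z2 - \<gamma>)"
proof -
  define a b where "a = fst y" and "b = snd y"
  define D where "D = (Im \<gamma>)\<^sup>2 - 4 * (a * b) * (Re \<gamma> + a * b)"
  have "(2 * (a * b) + Re \<gamma>)\<^sup>2 \<le> (cmod \<gamma>)\<^sup>2"
    using le power_mono[of "\<bar>2 * (a * b) + Re \<gamma>\<bar>" "cmod \<gamma>" 2] by (simp add: a_def b_def)
  then have D: "D \<ge> 0" unfolding cmod_power2 D_def by (simp add: power2_eq_square algebra_simps)
  define x1 where "x1 = (Im \<gamma> + sqrt D) / (2 * b)"
  define x2 where "x2 = (Im \<gamma> - sqrt D) / (2 * a)"
  have ab: "a \<noteq> 0" "b \<noteq> 0" using y by (simp_all add: a_def b_def)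
  have "x1 * b + a * x2 = Im \<gamma>" using ab by (simp add: x1_def x2_def field_simps)
  moreover have "x1 * x2 - a * b = Re \<gamma>"
  proof -
    have "(Im \<gamma> + sqrt D) * (Im \<gamma> - sqrt D) = 4 * (a * b) * (Re \<gamma> + a * b)"
      using D by (simp add: algebra_simps D_def flip: power2_eq_square)
    then have "x1 * x2 = (4 * (a * b) * (Re \<gamma> + a * b)) / (4 * (a * b))"
      by (simp add: x1_def x2_def mult.commute)
    then show ?thesis using ab by simp
  qed
  ultimately have "Complex x1 a * Complex x2 b - \<gamma> = 0" by (simp add: complex_eq_iff)
  then have "(Im (Complex x1 a), Im (Complex x2 b)) \<in> improj (\<lambda>z1 z2. z1 * z2 - \<gamma>)" by (rule improjI)
  then show ?thesis by (simp add: a_def b_def)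
qed

text \<open>Treats points at which one cannot divide by both coordinates. If exactly one coordinate
  vanishes and \<open>\<gamma>\<close> is nonreal, the imaginary part of the equation determines one
  unknown and the real part the other.\<close>

lemma improj_prod_axes:
  assumes "fst y * snd y = 0" "Im \<gamma> \<noteq> 0 \<and> y \<noteq> 0 \<or> Im \<gamma> = 0 \<and> (y = 0 \<or> \<gamma> = 0)"
  shows "y \<in> improj (\<lambda>z1 z2. z1 * z2 - \<gamma>)"
proof -
  obtain a b where y: "y = (a, b)" by force
  have "\<exists>x1 x2. Complex x1 a * Complex x2 b = \<gamma>"
  proof (cases "Im \<gamma> = 0")
    case True
    then consider "a = 0" "b = 0" | "\<gamma> = 0" "a = 0" | "\<gamma> = 0" "b = 0"
      using assms y by (auto simp: zero_prod_def)
    then show ?thesis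
    proof cases
      case 1
      then show ?thesis using True
        by (intro exI[of _ 1] exI[of _ "Re \<gamma>"]) (simp add: complex_eq_iff)
    next
      case 2
      then show ?thesis by (intro exI[of _ 0]) (simp add: complex_eq_iff)
    next
      case 3
      then show ?thesis by (intro exI[of _ 0] exI[of _ 0]) (simp add: complex_eq_iff)
    qed
  next
    case False
    then consider "a = 0" "b \<noteq> 0" | "b = 0" "a \<noteq> 0"
      using assms y by (auto simp: zero_prod_def)
    then show ?thesis
    proof cases
      case 1
      then show ?thesis using False
        by (intro exI[of _ "Im \<gamma> / b"] exI[of _ "Re \<gamma> * b / Im \<gamma>"]) (simp add: complex_eq_iff)
    next
      case 2
      then show ?thesis using False
        by (intro exI[of _ "Re \<gamma> * a / Im \<gamma>"] exI[of _ "Im \<gamma> / a"]) (simp add: complex_eq_iff)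
    qed
  qed
  then obtain x1 x2 where "Complex x1 a * Complex x2 b - \<gamma> = 0" by auto
  then have "(Im (Complex x1 a), Im (Complex x2 b)) \<in> improj (\<lambda>z1 z2. z1 * z2 - \<gamma>)" by (rule improjI)
  then show ?thesis by (simp add: y)
qed

text \<open>Off the axes the projection is given by \<open>g y \<le> cmod \<gamma>\<close>, and on
  the level set the saddle allows small moves that increase \<open>g\<close>. For nonreal
  \<open>\<gamma>\<close> the origin is missing from the projection although all nearby points
  belong to it, which adds an isolated boundary point.\<close>

lemma frontier_improj_prod:
  "frontier (improj (\<lambda>z1 z2. z1 * z2 - \<gamma>)) =
     {y. \<bar>2 * (fst y * snd y) + Re \<gamma>\<bar> = cmod \<gamma>} \<union> {y. Im \<gamma> \<noteq> 0 \<and> y = 0}"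
  (is "frontier ?S = ?B \<union> ?O")
proof -
  define P where "P = (\<lambda>y :: real \<times> real. fst y * snd y)"
  define g where "g = (\<lambda>y. \<bar>2 * P y + Re \<gamma>\<bar>)"
  have contP: "continuous_on A P" and contg: "continuous_on A g" for A
    unfolding g_def P_def by (intro continuous_intros)+
  have le: "g y \<le> cmod \<gamma>" if "y \<in> ?S" for y using improj_prod_le[OF that] by (simp add: g_def P_def)
  have out: "y \<notin> frontier ?S" if "g y > cmod \<gamma>" for y
  proof -
    have "frontier (- ?S) \<subseteq> - {y. g y > cmod \<gamma>}"
      using le by (intro frontier_subset_complement_open open_Collect_less contg continuous_on_const) fastforce
    then show ?thesis using that by (auto simp: frontier_complement)
  qed
  define U where "U = {y. g y < cmod \<gamma>} - (if Im \<gamma> \<noteq> 0 then {0} else {})"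
  have openU: "open U" unfolding U_def
    by (intro open_Diff open_Collect_less contg continuous_on_const) auto
  have US: "U \<subseteq> ?S"
  proof
    fix y assume y: "y \<in> U"
    show "y \<in> ?S"
    proof (cases "P y = 0")
      case True
      have "Im \<gamma> \<noteq> 0"
      proof
        assume "Im \<gamma> = 0"
        then have "cmod \<gamma> = \<bar>Re \<gamma>\<bar>" by (simp add: cmod_def)
        with y True show False by (simp add: U_def g_def)
      qed
      then show ?thesis using y True by (intro improj_prod_axes) (auto simp: U_def P_def)
    next
      case False
      then show ?thesis using y by (intro improj_prod_ge) (auto simp: U_def g_def P_def)
    qed
  qed
  have "frontier ?S \<subseteq> ?B \<union> ?O"
  proof
    fix y assume y: "y \<in> frontier ?S"
    then have "y \<notin> U" using frontier_subset_complement_open[OF openU US] by blast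
    moreover have "g y \<le> cmod \<gamma>" using out[of y] y by linarith
    ultimately show "y \<in> ?B \<union> ?O" by (auto simp: U_def g_def P_def split: if_splits)
  qed
  moreover have "?B \<subseteq> frontier ?S"
  proof
    fix y assume "y \<in> ?B"
    then have y: "g y = cmod \<gamma>" by (simp add: g_def P_def)
    have "y \<in> closure (- ?S)"
      unfolding closure_approachable
    proof (intro allI impI)
      fix e :: real assume "e > 0"
      then obtain y1 y2 where d: "dist y1 y < e" "dist y2 y < e" "P y1 > P y" "P y2 < P y"
        unfolding P_def by (rule prod_perturb)
      then have "g y1 > g y \<or> g y2 > g y" unfolding g_def by linarith
      then show "\<exists>z\<in>- ?S. dist z y < e" using d le y by (metis ComplI not_le)
    qed
    moreover have "y \<in> closure ?S"
    proof (cases "y \<in> ?S")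
      case True
      then show ?thesis using closure_subset by blast
    next
      case False
      have P0: "P y = 0"
      proof (rule ccontr)
        assume "P y \<noteq> 0"
        then have "y \<in> ?S" using y by (intro improj_prod_ge) (auto simp: g_def P_def)
        with False show False by blast
      qed
      have "\<bar>Re \<gamma>\<bar> = cmod \<gamma>" using y P0 by (simp add: g_def)
      then have Im0: "Im \<gamma> = 0" using cmod_power2[of \<gamma>] power2_abs[of "Re \<gamma>"] by simp
      have r: "Re \<gamma> \<noteq> 0"
        using improj_prod_axes[of y \<gamma>] False P0 Im0 by (auto simp: P_def complex_eq_iff)
      show ?thesis
        unfolding closure_approachable
      proof (intro allI impI)
        fix e :: real assume e: "e > 0"
        have "open {z. \<bar>P z\<bar> < \<bar>Re \<gamma>\<bar>}"
          by (intro open_Collect_less continuous_intros contP)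
        moreover have "y \<in> {z. \<bar>P z\<bar> < \<bar>Re \<gamma>\<bar>}" using P0 r by simp
        ultimately obtain e' where e': "e' > 0" "\<And>z. dist z y < e' \<Longrightarrow> \<bar>P z\<bar> < \<bar>Re \<gamma>\<bar>"
          unfolding open_dist by blast
        define d where "d = min e e'"
        have "d > 0" using e e' by (simp add: d_def)
        then obtain y1 y2 where d: "dist y1 y < d" "dist y2 y < d" "P y1 > P y" "P y2 < P y"
          unfolding P_def by (rule prod_perturb)
        have "\<bar>P y1\<bar> < \<bar>Re \<gamma>\<bar>" "\<bar>P y2\<bar> < \<bar>Re \<gamma>\<bar>" using d(1,2) e'(2) by (auto simp: d_def)
        \<comment> \<open>A small value of \<open>P\<close> with sign opposite to that of
          \<open>Re \<gamma>\<close> decreases \<open>g\<close>; one of the two perturbations has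
          it.\<close>
        then have "\<bar>2 * P y1 + Re \<gamma>\<bar> < \<bar>Re \<gamma>\<bar> \<or> \<bar>2 * P y2 + Re \<gamma>\<bar> < \<bar>Re \<gamma>\<bar>"
          using d(3,4) P0 r by linarith
        then have "y1 \<in> U \<or> y2 \<in> U"
          using \<open>\<bar>Re \<gamma>\<bar> = cmod \<gamma>\<close> Im0 by (auto simp: U_def g_def)
        then show "\<exists>z\<in>?S. dist z y < e" using US d(1,2) by (auto simp: d_def)
      qed
    qed
    ultimately show "y \<in> frontier ?S" by (simp add: frontier_closures)
  qed
  moreover have "0 \<in> frontier ?S" if "Im \<gamma> \<noteq> 0"
  proof -
    have "0 \<notin> ?S"
    proof
      assume "0 \<in> ?S"
      then obtain z1 z2 where "Im z1 = 0" "Im z2 = 0" "\<gamma> = z1 * z2"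
        unfolding improj_def by (auto simp: zero_prod_def)
      with that show False by simp
    qed
    moreover have "0 \<in> closure ?S"
      unfolding closure_approachable
    proof (intro allI impI)
      fix e :: real assume "e > 0"
      then have "(e / 2, 0) \<in> ?S" "dist (e / 2, 0 :: real) 0 < e"
        using that by (auto intro!: improj_prod_axes simp: zero_prod_def dist_Pair_Pair)
      then show "\<exists>z\<in>?S. dist z 0 < e" by blast
    qed
    ultimately show ?thesis using closure_subset[of "- ?S"] by (auto simp: frontier_closures)
  qed
  ultimately show ?thesis by blast
qed

lemma low_degree_prod: "low_degree_pieces (frontier (improj (\<lambda>z1 z2. z1 * z2 - \<gamma>)))"
proof -
  have *: "low_degree_pieces {y. 2 * (fst y * snd y) + c = 0}" for c
  proof (rule low_degree_pieces_zeros)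
    show "polyfun 2 (\<lambda>y. 2 * (fst y * snd y) + c)"
      by (intro polyfun.add polyfun.const polyfun_cmult polyfun_prod)
    show "2 * (fst (1 - c / 2, 1) * snd (1 - c / 2, 1)) + c \<noteq> 0" by simp
  qed
  have "low_degree_pieces {y :: real \<times> real. fst y * fst y + snd y * snd y = 0}"
    by (rule low_degree_pieces_zeros[of _ "(1, 1)"])
       (auto intro!: polyfun.add polyfun.mult[of 1 fst 1] polyfun.mult[of 1 snd 1] polyfun_fst polyfun_snd)
  also have "{y :: real \<times> real. fst y * fst y + snd y * snd y = 0} = {0}"
    by (auto simp: zero_prod_def)
  finally have 0: "low_degree_pieces {y. Im \<gamma> \<noteq> 0 \<and> y = 0}"
    by (cases "Im \<gamma> = 0") (auto simp: low_degree_pieces_empty)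
  have "{y. \<bar>2 * (fst y * snd y) + Re \<gamma>\<bar> = cmod \<gamma>} =
      {y. 2 * (fst y * snd y) + (Re \<gamma> - cmod \<gamma>) = 0} \<union> {y. 2 * (fst y * snd y) + (Re \<gamma> + cmod \<gamma>) = 0}"
    using norm_ge_zero[of \<gamma>] by (auto simp: abs_if simp del: norm_ge_zero)
  then show ?thesis
    unfolding frontier_improj_prod using low_degree_pieces_Un[OF low_degree_pieces_Un[OF * *] 0] by simp
qed

text \<open>The projection consists of at most two parallel lines and is its own boundary.\<close>

lemma low_degree_square: "low_degree_pieces (frontier (improj (\<lambda>z1 z2. z1\<^sup>2 + \<phi>)))"
proof -
  define c where "c = \<bar>Im (csqrt (- \<phi>))\<bar>"
  let ?S = "{y :: real \<times> real. fst y * fst y - c * c = 0}"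
  have S: "improj (\<lambda>z1 z2. z1\<^sup>2 + \<phi>) = ?S"
  proof (rule antisym; rule subsetI)
    fix y assume "y \<in> improj (\<lambda>z1 z2. z1\<^sup>2 + \<phi>)"
    then obtain z1 z2 where z: "y = (Im z1, Im z2)" "z1\<^sup>2 + \<phi> = 0" unfolding improj_def by blast
    then have "z1\<^sup>2 = (csqrt (- \<phi>))\<^sup>2" by (simp add: eq_neg_iff_add_eq_0)
    then have "z1 = csqrt (- \<phi>) \<or> z1 = - csqrt (- \<phi>)" by (simp only: power2_eq_iff)
    then show "y \<in> ?S" by (auto simp: z(1) c_def)
  next
    fix y assume "y \<in> ?S"
    then have "fst y = Im (csqrt (- \<phi>)) \<or> fst y = Im (- csqrt (- \<phi>))"
      by (auto simp: c_def square_eq_iff)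
    then obtain z where z: "z\<^sup>2 + \<phi> = 0" "Im z = fst y"
      by (metis power2_csqrt power2_minus add.left_inverse)
    then have "(Im z, Im (\<i> * of_real (snd y))) \<in> improj (\<lambda>z1 z2. z1\<^sup>2 + \<phi>)"
      by (intro improjI)
    then show "y \<in> improj (\<lambda>z1 z2. z1\<^sup>2 + \<phi>)" using z by simp
  qed
  have "closed ?S" by (intro closed_Collect_eq continuous_intros)
  moreover have "interior ?S = {}"
  proof (rule ccontr)
    assume "interior ?S \<noteq> {}"
    then obtain y e where e: "e > 0" "ball y e \<subseteq> ?S" unfolding interior_def open_contains_ball by blast
    define s where "s = (if fst y \<ge> 0 then e / 2 else - e / 2)"
    have "y + (s, 0) \<in> ball y e" using e by (simp add: s_def dist_norm norm_Pair)
    moreover have "y \<in> ball y e" using e by simp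
    ultimately have "y \<in> ?S" "y + (s, 0) \<in> ?S" using e by blast+
    then have "(fst y + s) * (fst y + s) = fst y * fst y" by simp
    then have "s * (2 * fst y + s) = 0" by (simp add: algebra_simps)
    then show False using e by (auto simp: s_def split: if_splits)
  qed
  ultimately have "frontier ?S = ?S" by (simp add: frontier_def)
  moreover have "low_degree_pieces ?S"
  proof (rule low_degree_pieces_zeros)
    show "polyfun 2 (\<lambda>y. fst y * fst y - c * c)"
      by (intro polyfun_diff polyfun.const polyfun.mult[of 1 fst 1] polyfun_fst) simp_all
    have "c \<ge> 0" by (simp add: c_def)
    then show "fst (c + 1, 0) * fst (c + 1, 0) - c * c \<noteq> 0" by (simp add: algebra_simps)
  qed
  ultimately show ?thesis unfolding S by simp
qed

lemma improj_parabola: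
  assumes "\<kappa> \<noteq> 0"
  shows "improj (\<lambda>z1 z2. z2 - \<kappa> * z1\<^sup>2) =
     {y. \<exists>x. snd y = Im \<kappa> * (x\<^sup>2 - (fst y)\<^sup>2) + 2 * Re \<kappa> * x * fst y}" (is "_ = ?R")
proof (rule antisym; rule subsetI)
  fix y assume "y \<in> improj (\<lambda>z1 z2. z2 - \<kappa> * z1\<^sup>2)"
  then obtain z1 z2 where z: "y = (Im z1, Im z2)" "z2 = \<kappa> * z1\<^sup>2" unfolding improj_def by auto
  then show "y \<in> ?R" by (intro CollectI exI[of _ "Re z1"]) (simp add: power2_eq_square algebra_simps)
next
  fix y assume "y \<in> ?R"
  then obtain x where x: "snd y = Im \<kappa> * (x\<^sup>2 - (fst y)\<^sup>2) + 2 * Re \<kappa> * x * fst y" by blast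
  have "(Im (Complex x (fst y)), Im (\<kappa> * (Complex x (fst y))\<^sup>2)) \<in> improj (\<lambda>z1 z2. z2 - \<kappa> * z1\<^sup>2)"
    by (intro improjI) simp
  moreover have "Im (\<kappa> * (Complex x (fst y))\<^sup>2) = snd y"
    unfolding x by (simp add: power2_eq_square algebra_simps)
  ultimately show "y \<in> improj (\<lambda>z1 z2. z2 - \<kappa> * z1\<^sup>2)" by simp
qed

text \<open>For real \<open>\<kappa>\<close> the equation is linear in the real part
  \<open>x\<close> and solvable off the line \<open>fst y = 0\<close>. Otherwise it is quadratic in
  \<open>x\<close>, and completing the square shows that the projection is the set where
  \<open>f\<close> is nonnegative.\<close>

lemma low_degree_parabola:
  assumes "\<kappa> \<noteq> 0"
  shows "low_degree_pieces (frontier (improj (\<lambda>z1 z2. z2 - \<kappa> * z1\<^sup>2)))"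
proof (cases "Im \<kappa> = 0")
  case True
  then have u: "Re \<kappa> \<noteq> 0" using assms by (simp add: complex_eq_iff)
  let ?S = "improj (\<lambda>z1 z2. z2 - \<kappa> * z1\<^sup>2)"
  have mem: "y \<in> ?S \<longleftrightarrow> fst y \<noteq> 0 \<or> snd y = 0" for y
  proof -
    have "\<exists>x. snd y = 2 * Re \<kappa> * x * fst y" if "fst y \<noteq> 0"
      using that u by (intro exI[of _ "snd y / (2 * Re \<kappa> * fst y)"]) simp
    then show ?thesis unfolding improj_parabola[OF assms] by (auto simp: True)
  qed
  have "frontier ?S = {y. fst y = 0}"
  proof
    have "frontier ?S \<subseteq> - {y. fst y \<noteq> 0}"
      by (intro frontier_subset_complement_open open_Collect_neq continuous_intros) (auto simp: mem)
    then show "frontier ?S \<subseteq> {y. fst y = 0}" by auto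
    show "{y. fst y = 0} \<subseteq> frontier ?S"
    proof
      fix y :: "real \<times> real" assume "y \<in> {y. fst y = 0}"
      then have y: "fst y = 0" by simp
      have "y \<in> closure ?S" unfolding closure_approachable
      proof (intro allI impI)
        fix e :: real assume "e > 0"
        then show "\<exists>z\<in>?S. dist z y < e"
          using y by (intro bexI[of _ "(e / 2, snd y)"]) (auto simp: mem dist_prod_def dist_real_def)
      qed
      moreover have "y \<in> closure (- ?S)" unfolding closure_approachable
      proof (intro allI impI)
        fix e :: real assume e: "e > 0"
        define t where "t = (if snd y \<ge> 0 then e / 2 else - e / 2)"
        show "\<exists>z\<in>- ?S. dist z y < e"
          using y e by (intro bexI[of _ "(0, snd y + t)"])
            (auto simp: mem dist_prod_def dist_real_def t_def)
      qed
      ultimately show "y \<in> frontier ?S" by (simp add: frontier_closures)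
    qed
  qed
  moreover have "low_degree_pieces {y :: real \<times> real. fst y = 0}"
    by (rule low_degree_pieces_zeros[of _ "(1, 0)"]) (auto intro: polyfun_fst)
  ultimately show ?thesis by simp
next
  case False
  define v k where "v = Im \<kappa>" and "k = (Re \<kappa>)\<^sup>2 + (Im \<kappa>)\<^sup>2"
  have v: "v \<noteq> 0" using False by (simp add: v_def)
  define f where "f = (\<lambda>y :: real \<times> real. v * snd y + k * (fst y * fst y))"
  have S: "improj (\<lambda>z1 z2. z2 - \<kappa> * z1\<^sup>2) = {y. 0 \<le> f y}"
    unfolding improj_parabola[OF assms]
  proof (intro Collect_cong iffI)
    fix y :: "real \<times> real"
    assume "\<exists>x. snd y = Im \<kappa> * (x\<^sup>2 - (fst y)\<^sup>2) + 2 * Re \<kappa> * x * fst y"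
    then obtain x where x: "snd y = Im \<kappa> * (x\<^sup>2 - (fst y)\<^sup>2) + 2 * Re \<kappa> * x * fst y" by blast
    have "f y = (v * x + Re \<kappa> * fst y)\<^sup>2"
      unfolding f_def x by (simp add: v_def k_def power2_eq_square algebra_simps)
    then show "0 \<le> f y" by simp
  next
    fix y :: "real \<times> real"
    assume f: "0 \<le> f y"
    define x where "x = (sqrt (f y) - Re \<kappa> * fst y) / v"
    have "sqrt (f y) = v * x + Re \<kappa> * fst y" using v by (simp add: x_def)
    then have "f y = (v * x + Re \<kappa> * fst y)\<^sup>2" using f by (metis real_sqrt_pow2)
    then have "v * snd y = v * (v * (x\<^sup>2 - (fst y)\<^sup>2) + 2 * Re \<kappa> * x * fst y)"
      unfolding f_def by (simp add: k_def power2_eq_square algebra_simps flip: v_def)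
    then show "\<exists>x. snd y = Im \<kappa> * (x\<^sup>2 - (fst y)\<^sup>2) + 2 * Re \<kappa> * x * fst y"
      using v by (auto simp: v_def)
  qed
  have cont: "continuous_on A f" for A unfolding f_def by (intro continuous_intros)
  have "frontier {y. 0 \<le> f y} = {y. f y = 0}"
  proof
    have "closed {y. 0 \<le> f y}" by (intro closed_Collect_le cont continuous_on_const)
    moreover have "frontier {y. 0 \<le> f y} \<subseteq> - {y. 0 < f y}"
      by (intro frontier_subset_complement_open open_Collect_less cont continuous_on_const) auto
    ultimately show "frontier {y. 0 \<le> f y} \<subseteq> {y. f y = 0}"
      using frontier_subset_closed[of "{y. 0 \<le> f y}"] by fastforce
    show "{y. f y = 0} \<subseteq> frontier {y. 0 \<le> f y}"
    proof
      fix y assume "y \<in> {y. f y = 0}"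
      then have y: "f y = 0" by simp
      have "y \<in> closure (- {y. 0 \<le> f y})" unfolding closure_approachable
      proof (intro allI impI)
        fix e :: real assume e: "e > 0"
        define t where "t = e / (2 * \<bar>v\<bar>) * v"
        have "\<bar>t\<bar> < e" using e v by (simp add: t_def abs_mult)
        moreover have "v * t = e / (2 * \<bar>v\<bar>) * (v * v)" by (simp add: t_def)
        moreover have "v * v > 0" using v by (metis not_real_square_gt_zero)
        then have "e / (2 * \<bar>v\<bar>) * (v * v) > 0" using e v by simp
        ultimately have "v * t > 0" "\<bar>t\<bar> < e" by linarith+
        then show "\<exists>z\<in>- {y. 0 \<le> f y}. dist z y < e"
          using y by (intro bexI[of _ "(fst y, snd y - t)"])
            (auto simp: f_def dist_prod_def dist_real_def algebra_simps)
      qed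
      moreover have "y \<in> closure {y. 0 \<le> f y}" using y closure_subset[of "{y. 0 \<le> f y}"] by auto
      ultimately show "y \<in> frontier {y. 0 \<le> f y}" by (simp add: frontier_closures)
    qed
  qed
  moreover have "low_degree_pieces {y. f y = 0}"
  proof (rule low_degree_pieces_zeros)
    show "polyfun 2 f" unfolding f_def
      by (intro polyfun.add polyfun_cmult polyfun.mult[of 1 fst 1] polyfun_fst polyfun_snd) simp_all
    show "f (0, 1) \<noteq> 0" using v by (simp add: f_def)
  qed
  ultimately show ?thesis unfolding S by simp
qed

section \<open>Reduction of arbitrary conics to the normal forms\<close>

lemma improj_affine_conic:
  assumes "a' * d' - b' * c' \<noteq> 0" "B \<noteq> 0"
    and "\<And>z1 z2. P z1 z2 = B * N (of_real a' * z1 + of_real b' * z2 + s) (of_real c' * z1 + of_real d' * z2 + t)"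
  obtains T T' where "affine_iso T T'" "improj P = T -` improj N"
proof -
  obtain T T' where T: "affine_iso T T'"
    "\<And>Q. improj (\<lambda>z1 z2. Q (of_real a' * z1 + of_real b' * z2 + s) (of_real c' * z1 + of_real d' * z2 + t)) = T -` improj Q"
    by (rule improj_affine[OF assms(1), where s = s and t = t]) blast
  have "improj P = T -` improj N"
    unfolding T(2)[symmetric] by (rule improj_cong_zeros) (simp only: assms(2,3) mult_eq_0_iff, simp)
  with T(1) show thesis by (rule that)
qed

lemma tame_affine:
  assumes "a' * d' - b' * c' \<noteq> 0" "B \<noteq> 0"
    and "\<And>z1 z2. P z1 z2 = B * N (of_real a' * z1 + of_real b' * z2 + s) (of_real c' * z1 + of_real d' * z2 + t)"
    and "tame (improj N)"
  shows "tame (improj P)"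
  using improj_affine_conic[where P = P and N = N, OF assms(1-3)] affine_iso.tame_vimage assms(4) by metis

lemma low_degree_affine:
  assumes "a' * d' - b' * c' \<noteq> 0" "B \<noteq> 0"
    and "\<And>z1 z2. P z1 z2 = B * N (of_real a' * z1 + of_real b' * z2 + s) (of_real c' * z1 + of_real d' * z2 + t)"
    and "low_degree_pieces (frontier (improj N))"
  shows "low_degree_pieces (frontier (improj P))"
  using improj_affine_conic[where P = P and N = N, OF assms(1-3)] affine_iso.low_degree_pieces_vimage
    affine_iso.frontier_vimage_iso assms(4) by metis

text \<open>A linear form and its conjugate are a basis unless the form is a multiple of a real one.
  \<open>G\<close> and \<open>H\<close> come from Cramer's rule with determinant
  \<open>2 * \<i> * Im (\<alpha> * cnj \<beta>)\<close>.\<close>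

lemma linear_comb_conj:
  assumes "Im (\<alpha> * cnj \<beta>) \<noteq> 0"
  obtains G H where "\<And>z1 z2. d * z1 + e * z2 = G * (\<alpha> * z1 + \<beta> * z2) + H * (cnj \<alpha> * z1 + cnj \<beta> * z2)"
    "G * (\<alpha> * cnj \<beta> - \<beta> * cnj \<alpha>) = d * cnj \<beta> - e * cnj \<alpha>"
proof -
  define \<Delta> where "\<Delta> = \<alpha> * cnj \<beta> - \<beta> * cnj \<alpha>"
  have "Im \<Delta> = 2 * Im (\<alpha> * cnj \<beta>)" by (simp add: \<Delta>_def)
  then have \<Delta>: "\<Delta> \<noteq> 0" using assms by auto
  define G where "G = (d * cnj \<beta> - e * cnj \<alpha>) / \<Delta>"
  define H where "H = (e * \<alpha> - d * \<beta>) / \<Delta>"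
  have "d * z1 + e * z2 = G * (\<alpha> * z1 + \<beta> * z2) + H * (cnj \<alpha> * z1 + cnj \<beta> * z2)" for z1 z2
  proof -
    have "G * (\<alpha> * z1 + \<beta> * z2) + H * (cnj \<alpha> * z1 + cnj \<beta> * z2) =
       ((d * cnj \<beta> - e * cnj \<alpha>) * (\<alpha> * z1 + \<beta> * z2) + (e * \<alpha> - d * \<beta>) * (cnj \<alpha> * z1 + cnj \<beta> * z2)) / \<Delta>"
      by (simp add: G_def H_def add_divide_distrib)
    also have "\<dots> = (\<Delta> * (d * z1 + e * z2)) / \<Delta>" by (simp add: \<Delta>_def algebra_simps)
    finally show ?thesis using \<Delta> by simp
  qed
  moreover have "G * \<Delta> = d * cnj \<beta> - e * cnj \<alpha>" using \<Delta> by (simp add: G_def)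
  ultimately show thesis using that unfolding \<Delta>_def by blast
qed

text \<open>Real and imaginary parts of the coefficients give the real change of coordinates that
  turns the form into \<open>z1 + \<i> * z2\<close>. Since translations may be complex, the shifts
  \<open>p\<close> and \<open>q\<close> of the form and its conjugate are independent.\<close>

lemma conj_coords:
  fixes \<alpha> \<beta> z1 z2 p q :: complex
  defines "w1 \<equiv> of_real (Re \<alpha>) * z1 + of_real (Re \<beta>) * z2 + (p + q) / 2"
    and "w2 \<equiv> of_real (Im \<alpha>) * z1 + of_real (Im \<beta>) * z2 + (p - q) / (2 * \<i>)"
  shows "w1 + \<i> * w2 = \<alpha> * z1 + \<beta> * z2 + p" "w1 - \<i> * w2 = cnj \<alpha> * z1 + cnj \<beta> * z2 + q"
proof -
  define a a' b b' where "a = complex_of_real (Re \<alpha>)" and "a' = complex_of_real (Im \<alpha>)"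
    and "b = complex_of_real (Re \<beta>)" and "b' = complex_of_real (Im \<beta>)"
  note defs = this
  have eqs: "\<alpha> = a + \<i> * a'" "\<beta> = b + \<i> * b'" "cnj \<alpha> = a - \<i> * a'" "cnj \<beta> = b - \<i> * b'"
    by (simp_all add: complex_eq_iff defs)
  have "\<i> * w2 = \<i> * (a' * z1 + b' * z2) + (p - q) / 2"
    unfolding w2_def defs[symmetric] by (simp add: algebra_simps diff_divide_distrib)
  then show "w1 + \<i> * w2 = \<alpha> * z1 + \<beta> * z2 + p" "w1 - \<i> * w2 = cnj \<alpha> * z1 + cnj \<beta> * z2 + q"
    unfolding w1_def defs[symmetric] unfolding eqs(3,4) unfolding eqs(1,2) by (simp_all add: field_simps)
qed

lemma reduce_UV:
  assumes nr: "Im (\<alpha> * cnj \<beta>) \<noteq> 0" and B: "B \<noteq> 0"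
    and P: "\<And>z1 z2. P z1 z2 = (\<alpha> * z1 + \<beta> * z2) * (A * (\<alpha> * z1 + \<beta> * z2) + B * (cnj \<alpha> * z1 + cnj \<beta> * z2))
       + d * z1 + e * z2 + f"
  obtains s t \<gamma> where "\<And>z1 z2. P z1 z2 = B * conic_UV (A / B) \<gamma>
     (of_real (Re \<alpha>) * z1 + of_real (Re \<beta>) * z2 + s) (of_real (Im \<alpha>) * z1 + of_real (Im \<beta>) * z2 + t)"
proof -
  obtain G H where GH: "\<And>z1 z2. d * z1 + e * z2 = G * (\<alpha> * z1 + \<beta> * z2) + H * (cnj \<alpha> * z1 + cnj \<beta> * z2)"
    using linear_comb_conj[OF nr] by metis
  \<comment> \<open>Comparison of coefficients after shifting \<open>U\<close> by \<open>h\<close>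
    and \<open>V\<close> by \<open>\<kappa>\<close>: the term in \<open>V\<close> fixes
    \<open>h\<close>, the term in \<open>U\<close> fixes \<open>\<kappa>\<close>, and the constant
    fixes \<open>\<gamma>\<close>.\<close>
  define h \<kappa> where "h = H / B" and "\<kappa> = G / B - 2 * (A / B) * h"
  define \<gamma> where "\<gamma> = h * (A / B * h + \<kappa>) - f / B"
  show thesis
  proof (rule that[of \<gamma> "(h + \<kappa>) / 2" "(h - \<kappa>) / (2 * \<i>)"])
    fix z1 z2
    define U V where "U = \<alpha> * z1 + \<beta> * z2" and "V = cnj \<alpha> * z1 + cnj \<beta> * z2"
    have "P z1 z2 = U * (A * U + B * V) + G * U + H * V + f"
      unfolding P GH[of z1 z2, unfolded add.assoc] U_def[symmetric] V_def[symmetric]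
      using GH[of z1 z2] by (simp add: U_def V_def add.assoc)
    also have "\<dots> = B * ((U + h) * (A / B * (U + h) + (V + \<kappa>)) - \<gamma>)"
    proof -
      define a g p where "a = A / B" and "g = G / B" and "p = f / B"
      have "A = B * a" "G = B * g" "H = B * h" "f = B * p"
        using B by (simp_all add: a_def g_def h_def p_def)
      then show ?thesis
        unfolding \<gamma>_def \<kappa>_def a_def[symmetric] g_def[symmetric] p_def[symmetric]
        by (simp add: algebra_simps)
    qed
    finally show "P z1 z2 = B * conic_UV (A / B) \<gamma>
       (of_real (Re \<alpha>) * z1 + of_real (Re \<beta>) * z2 + (h + \<kappa>) / 2)
       (of_real (Im \<alpha>) * z1 + of_real (Im \<beta>) * z2 + (h - \<kappa>) / (2 * \<i>))"
      unfolding conic_UV_def conj_coords by (simp add: U_def V_def)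
  qed
qed

lemma reduce_UU:
  assumes nr: "Im (\<alpha> * cnj \<beta>) \<noteq> 0" and A: "A \<noteq> 0"
    and P: "\<And>z1 z2. P z1 z2 = A * (\<alpha> * z1 + \<beta> * z2)\<^sup>2 + d * z1 + e * z2 + f"
  obtains s t \<epsilon> \<phi> where "\<And>z1 z2. P z1 z2 = A * conic_UU \<epsilon> \<phi>
     (of_real (Re \<alpha>) * z1 + of_real (Re \<beta>) * z2 + s) (of_real (Im \<alpha>) * z1 + of_real (Im \<beta>) * z2 + t)"
proof -
  obtain G H where GH: "\<And>z1 z2. d * z1 + e * z2 = G * (\<alpha> * z1 + \<beta> * z2) + H * (cnj \<alpha> * z1 + cnj \<beta> * z2)"
    using linear_comb_conj[OF nr] by metis
  define g h where "g = G / (2 * A)" and "h = H / A"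
  define \<phi> where "\<phi> = f / A - g\<^sup>2"
  show thesis
  proof (rule that[of h \<phi> "(g + 0) / 2" "(g - 0) / (2 * \<i>)"])
    fix z1 z2
    define U V where "U = \<alpha> * z1 + \<beta> * z2" and "V = cnj \<alpha> * z1 + cnj \<beta> * z2"
    have "P z1 z2 = A * U\<^sup>2 + G * U + H * V + f"
      unfolding P U_def[symmetric] V_def[symmetric]
      using GH[of z1 z2] by (simp add: U_def V_def add.assoc)
    also have "\<dots> = A * ((U + g)\<^sup>2 + h * (V + 0) + \<phi>)"
    proof -
      define p where "p = f / A"
      have "G = A * (2 * g)" "H = A * h" "f = A * p"
        using A by (simp_all add: g_def h_def p_def)
      then show ?thesis
        unfolding \<phi>_def p_def[symmetric] by (simp add: power2_eq_square algebra_simps)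
    qed
    finally show "P z1 z2 = A * conic_UU h \<phi>
       (of_real (Re \<alpha>) * z1 + of_real (Re \<beta>) * z2 + (g + 0) / 2)
       (of_real (Im \<alpha>) * z1 + of_real (Im \<beta>) * z2 + (g - 0) / (2 * \<i>))"
      unfolding conic_UU_def conj_coords by (simp add: U_def V_def)
  qed
qed

lemma conic_factored:
  "conic (\<alpha>1 * \<alpha>2) (\<alpha>1 * \<beta>2 + \<alpha>2 * \<beta>1) (\<beta>1 * \<beta>2) d e f z1 z2 =
     (\<alpha>1 * z1 + \<beta>1 * z2) * (\<alpha>2 * z1 + \<beta>2 * z2) + d * z1 + e * z2 + f"
  by (simp add: conic_def power2_eq_square algebra_simps)

text \<open>The second factor is expanded in the first factor and its conjugate;
  \<open>B = 0\<close> means that the two factors are proportional.\<close>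

lemma tame_nonreal_factor:
  assumes nr: "Im (\<alpha>1 * cnj \<beta>1) \<noteq> 0" and nz: "\<alpha>2 \<noteq> 0 \<or> \<beta>2 \<noteq> 0"
  shows "tame (improj (conic (\<alpha>1 * \<alpha>2) (\<alpha>1 * \<beta>2 + \<alpha>2 * \<beta>1) (\<beta>1 * \<beta>2) d e f))"
    (is "tame (improj ?P)")
proof -
  obtain A B where AB: "\<And>z1 z2. \<alpha>2 * z1 + \<beta>2 * z2 = A * (\<alpha>1 * z1 + \<beta>1 * z2) + B * (cnj \<alpha>1 * z1 + cnj \<beta>1 * z2)"
    using linear_comb_conj[OF nr] by metis
  have det: "Re \<alpha>1 * Im \<beta>1 - Re \<beta>1 * Im \<alpha>1 \<noteq> 0" using nr by (simp add: algebra_simps)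
  have P: "?P z1 z2 = (\<alpha>1 * z1 + \<beta>1 * z2) * (A * (\<alpha>1 * z1 + \<beta>1 * z2) + B * (cnj \<alpha>1 * z1 + cnj \<beta>1 * z2))
       + d * z1 + e * z2 + f" for z1 z2
    unfolding conic_factored AB ..
  show ?thesis
  proof (cases "B = 0")
    case False
    obtain s t \<gamma> where "\<And>z1 z2. ?P z1 z2 = B * conic_UV (A / B) \<gamma>
       (of_real (Re \<alpha>1) * z1 + of_real (Re \<beta>1) * z2 + s) (of_real (Im \<alpha>1) * z1 + of_real (Im \<beta>1) * z2 + t)"
      using reduce_UV[OF nr False P] by metis
    from tame_affine[where P = ?P and N = "conic_UV (A / B) \<gamma>", OF det False this tame_UV] show ?thesis .
  next
    case True
    have A: "A \<noteq> 0" using AB[of 1 0] AB[of 0 1] nz True by auto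
    have "?P z1 z2 = A * (\<alpha>1 * z1 + \<beta>1 * z2)\<^sup>2 + d * z1 + e * z2 + f" for z1 z2
      unfolding P True by (simp add: power2_eq_square)
    then obtain s t \<epsilon> \<phi> where "\<And>z1 z2. ?P z1 z2 = A * conic_UU \<epsilon> \<phi>
       (of_real (Re \<alpha>1) * z1 + of_real (Re \<beta>1) * z2 + s) (of_real (Im \<alpha>1) * z1 + of_real (Im \<beta>1) * z2 + t)"
      using reduce_UU[OF nr A, of ?P] by metis
    from tame_affine[where P = ?P and N = "conic_UU \<epsilon> \<phi>", OF det A this tame_UU] show ?thesis .
  qed
qed

lemma real_linear_factor:
  assumes "Im (\<alpha> * cnj \<beta>) = 0" "\<alpha> \<noteq> 0 \<or> \<beta> \<noteq> 0"
  obtains \<kappa> r s where "\<kappa> \<noteq> 0" "\<alpha> = \<kappa> * of_real r" "\<beta> = \<kappa> * of_real s" "r \<noteq> 0 \<or> s \<noteq> 0"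
proof (cases "\<alpha> = 0")
  case True
  then show thesis using that[of \<beta> 0 1] assms(2) by auto
next
  case False
  have "\<beta> / \<alpha> = cnj (\<alpha> * cnj \<beta>) / of_real ((cmod \<alpha>)\<^sup>2)"
    using False unfolding complex_norm_square by simp
  also have "Im \<dots> = 0" using assms(1) by (simp del: complex_cnj_mult)
  finally have "\<beta> / \<alpha> = of_real (Re (\<beta> / \<alpha>))" by (simp add: complex_eq_iff)
  then have "\<beta> = \<alpha> * of_real (Re (\<beta> / \<alpha>))" using False by (metis nonzero_mult_div_cancel_left times_divide_eq_right)
  then show thesis using that[of \<alpha> 1 "Re (\<beta> / \<alpha>)"] False by auto
qed

text \<open>Independent real factors serve as coordinates and give a product. Proportional ones give
  a square, and the orthogonal real form is the second coordinate: its coefficient \<open>H\<close>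
  in the linear part decides between parallel lines and a parabola.\<close>

lemma low_degree_real_factors:
  assumes 1: "Im (\<alpha>1 * cnj \<beta>1) = 0" "\<alpha>1 \<noteq> 0 \<or> \<beta>1 \<noteq> 0"
    and 2: "Im (\<alpha>2 * cnj \<beta>2) = 0" "\<alpha>2 \<noteq> 0 \<or> \<beta>2 \<noteq> 0"
  shows "low_degree_pieces (frontier (improj
     (conic (\<alpha>1 * \<alpha>2) (\<alpha>1 * \<beta>2 + \<alpha>2 * \<beta>1) (\<beta>1 * \<beta>2) d e f)))" (is "low_degree_pieces (frontier (improj ?P))")
proof -
  obtain \<kappa>1 r1 s1 where k1: "\<kappa>1 \<noteq> 0" "\<alpha>1 = \<kappa>1 * of_real r1" "\<beta>1 = \<kappa>1 * of_real s1" "r1 \<noteq> 0 \<or> s1 \<noteq> 0"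
    using real_linear_factor[OF 1] by blast
  obtain \<kappa>2 r2 s2 where k2: "\<kappa>2 \<noteq> 0" "\<alpha>2 = \<kappa>2 * of_real r2" "\<beta>2 = \<kappa>2 * of_real s2" "r2 \<noteq> 0 \<or> s2 \<noteq> 0"
    using real_linear_factor[OF 2] by blast
  have frac: "k * (p / m * X + q / m * Y) = k * (p * X + q * Y) / m" for k p q m X Y :: complex
    by (simp add: add_divide_distrib distrib_left)
  show ?thesis
  proof (cases "r1 * s2 - s1 * r2 = 0")
    case False
    define D \<kappa> where "D = (of_real (r1 * s2 - s1 * r2) :: complex)" and "\<kappa> = \<kappa>1 * \<kappa>2"
    have D: "D \<noteq> 0" "\<kappa> \<noteq> 0" using False k1 k2 unfolding D_def \<kappa>_def of_real_eq_0_iff by auto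
    \<comment> \<open>The coefficients of the linear part in the two factors. In the translations
      they change places, as in \<open>(X + H) * (Y + G)\<close>.\<close>
    define G H where "G = (d * of_real s2 - e * of_real r2) / (D * \<kappa>)"
      and "H = (e * of_real r1 - d * of_real s1) / (D * \<kappa>)"
    have "?P z1 z2 = \<kappa> * ((\<lambda>w1 w2. w1 * w2 - (G * H - f / \<kappa>))
        (of_real r1 * z1 + of_real s1 * z2 + H) (of_real r2 * z1 + of_real s2 * z2 + G))" for z1 z2
    proof -
      have "\<kappa> * (G * (of_real r1 * z1 + of_real s1 * z2) + H * (of_real r2 * z1 + of_real s2 * z2))
        = \<kappa> * ((d * of_real s2 - e * of_real r2) * (of_real r1 * z1 + of_real s1 * z2)
           + (e * of_real r1 - d * of_real s1) * (of_real r2 * z1 + of_real s2 * z2)) / (D * \<kappa>)"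
        unfolding G_def H_def by (rule frac)
      also have "\<dots> = \<kappa> * (D * (d * z1 + e * z2)) / (D * \<kappa>)" by (simp add: D_def algebra_simps)
      also have "\<dots> = d * z1 + e * z2" using D by simp
      finally have *: "d * z1 + e * z2
        = \<kappa> * (G * (of_real r1 * z1 + of_real s1 * z2) + H * (of_real r2 * z1 + of_real s2 * z2))" ..
      have "?P z1 z2 = \<kappa> * ((of_real r1 * z1 + of_real s1 * z2) * (of_real r2 * z1 + of_real s2 * z2))
          + (d * z1 + e * z2) + f"
        unfolding conic_factored by (simp add: k1 k2 \<kappa>_def algebra_simps)
      then show ?thesis unfolding * using D by (simp add: algebra_simps)
    qed
    from low_degree_affine[where P = ?P and N = "\<lambda>w1 w2. w1 * w2 - (G * H - f / \<kappa>)", OF False D(2) this low_degree_prod]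
    show ?thesis .
  next
    case True
    \<comment> \<open>The proportionality factor of the two real forms is written as an orthogonal
      projection, which also works if one coefficient is zero.\<close>
    define D \<kappa> where "D = r1 * r1 + s1 * s1" and "\<kappa> = \<kappa>1 * \<kappa>2 * of_real ((r1 * r2 + s1 * s2) / D)"
    have D: "D \<noteq> 0" using k1(4) unfolding D_def by (simp add: sum_squares_eq_zero_iff)
    have r2: "r2 = (r1 * r2 + s1 * s2) / D * r1" "s2 = (r1 * r2 + s1 * s2) / D * s1"
    proof -
      have "r2 * D = (r1 * r2 + s1 * s2) * r1" "s2 * D = (r1 * r2 + s1 * s2) * s1"
        using True unfolding D_def by algebra+
      then show "r2 = (r1 * r2 + s1 * s2) / D * r1" "s2 = (r1 * r2 + s1 * s2) / D * s1"
        using D by (simp_all add: field_simps)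
    qed
    have r2c: "complex_of_real r2 = of_real ((r1 * r2 + s1 * s2) / D) * of_real r1"
      "complex_of_real s2 = of_real ((r1 * r2 + s1 * s2) / D) * of_real s1"
      using r2 by (metis of_real_mult)+
    have "r1 * r2 + s1 * s2 \<noteq> 0"
    proof
      assume "r1 * r2 + s1 * s2 = 0"
      then have "r2 = 0" "s2 = 0" using r2 by (metis div_0 mult_zero_left)+
      then show False using k2(4) by simp
    qed
    then have \<kappa>: "\<kappa> \<noteq> 0" using k1(1) k2(1) D unfolding \<kappa>_def mult_eq_0_iff of_real_eq_0_iff by simp
    define G H where "G = (d * of_real r1 + e * of_real s1) / (of_real D * \<kappa>)"
      and "H = (e * of_real r1 - d * of_real s1) / (of_real D * \<kappa>)"
    define \<phi> where "\<phi> = f / \<kappa> - (G / 2)\<^sup>2"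
    have P: "?P z1 z2 = \<kappa> * ((of_real r1 * z1 + of_real s1 * z2 + G / 2)\<^sup>2
        + H * (of_real (- s1) * z1 + of_real r1 * z2) + \<phi>)" for z1 z2
    proof -
      have "\<kappa> * (G * (of_real r1 * z1 + of_real s1 * z2) + H * (of_real (- s1) * z1 + of_real r1 * z2))
        = \<kappa> * ((d * of_real r1 + e * of_real s1) * (of_real r1 * z1 + of_real s1 * z2)
           + (e * of_real r1 - d * of_real s1) * (of_real (- s1) * z1 + of_real r1 * z2)) / (of_real D * \<kappa>)"
        unfolding G_def H_def by (rule frac)
      also have "\<dots> = \<kappa> * (of_real D * (d * z1 + e * z2)) / (of_real D * \<kappa>)" by (simp add: D_def algebra_simps)
      also have "\<dots> = d * z1 + e * z2" using D \<kappa> by simp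
      finally have *: "d * z1 + e * z2
        = \<kappa> * (G * (of_real r1 * z1 + of_real s1 * z2) + H * (of_real (- s1) * z1 + of_real r1 * z2))" ..
      define l where "l = complex_of_real ((r1 * r2 + s1 * s2) / D)"
      have "\<alpha>2 * z1 + \<beta>2 * z2 = \<kappa>2 * of_real ((r1 * r2 + s1 * s2) / D) * (of_real r1 * z1 + of_real s1 * z2)"
        unfolding k2(2,3) r2c l_def[symmetric] by (simp add: algebra_simps)
      moreover have "\<alpha>1 * z1 + \<beta>1 * z2 = \<kappa>1 * (of_real r1 * z1 + of_real s1 * z2)"
        unfolding k1(2,3) by (simp add: algebra_simps)
      ultimately have "?P z1 z2 = \<kappa> * (of_real r1 * z1 + of_real s1 * z2)\<^sup>2 + (d * z1 + e * z2) + f"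
        unfolding conic_factored by (simp only: \<kappa>_def power2_eq_square mult_ac add.assoc)
      moreover have "\<kappa> * X\<^sup>2 + \<kappa> * (G * X + H * Y) + \<kappa> * p
          = \<kappa> * ((X + G / 2)\<^sup>2 + H * Y + (p - (G / 2)\<^sup>2))" for X Y p
        by (simp add: power2_eq_square algebra_simps)
      moreover have "f = \<kappa> * (f / \<kappa>)" using \<kappa> by simp
      ultimately show ?thesis unfolding * \<phi>_def by metis
    qed
    have det: "r1 * r1 - s1 * (- s1) \<noteq> 0" using D by (simp add: D_def)
    show ?thesis
    proof (cases "H = 0")
      case True
      show ?thesis
        by (rule low_degree_affine[where N = "\<lambda>z1 z2. z1\<^sup>2 + \<phi>" and s = "G / 2" and t = 0,
              OF det \<kappa> _ low_degree_square]) (simp add: P True)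
    next
      case False
      have "\<kappa> * H \<noteq> 0" "- 1 / H \<noteq> 0" using \<kappa> False by auto
      show ?thesis
        by (rule low_degree_affine[where N = "\<lambda>z1 z2. z2 - - 1 / H * z1\<^sup>2" and s = "G / 2" and t = "\<phi> / H",
              OF det \<open>\<kappa> * H \<noteq> 0\<close> _ low_degree_parabola[OF \<open>- 1 / H \<noteq> 0\<close>]])
           (use False in \<open>simp add: P field_simps\<close>)
    qed
  qed
qed

lemma binary_quadratic_factors:
  obtains \<alpha>1 \<beta>1 \<alpha>2 \<beta>2 :: complex where
    "a = \<alpha>1 * \<alpha>2" "b = \<alpha>1 * \<beta>2 + \<alpha>2 * \<beta>1" "c = \<beta>1 * \<beta>2"
proof (cases "a = 0")
  case True
  then show thesis using that[of 0 b c 1] by simp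
next
  case False
  define s where "s = csqrt (b\<^sup>2 - 4 * a * c)"
  have "s\<^sup>2 = b\<^sup>2 - 4 * a * c" by (simp add: s_def)
  then have "c = (b + s) / 2 * ((b - s) / (2 * a))"
    using False by (simp add: field_simps power2_eq_square)
  moreover have "b = a * ((b - s) / (2 * a)) + 1 * ((b + s) / 2)" using False by (simp add: field_simps)
  ultimately show thesis using that[of a 1 "(b - s) / (2 * a)" "(b + s) / 2"] by simp
qed

lemma tame_conic:
  assumes "a \<noteq> 0 \<or> b \<noteq> 0 \<or> c \<noteq> 0"
  shows "tame (improj (conic a b c d e f))"
proof -
  obtain \<alpha>1 \<beta>1 \<alpha>2 \<beta>2 where q: "a = \<alpha>1 * \<alpha>2" "b = \<alpha>1 * \<beta>2 + \<alpha>2 * \<beta>1" "c = \<beta>1 * \<beta>2"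
    by (rule binary_quadratic_factors)
  have nz: "\<alpha>1 \<noteq> 0 \<or> \<beta>1 \<noteq> 0" "\<alpha>2 \<noteq> 0 \<or> \<beta>2 \<noteq> 0" using assms q by auto
  have swap: "conic a b c d e f = conic (\<alpha>2 * \<alpha>1) (\<alpha>2 * \<beta>1 + \<alpha>1 * \<beta>2) (\<beta>2 * \<beta>1) d e f"
    unfolding q by (simp add: mult.commute add.commute)
  show ?thesis
  proof (cases "Im (\<alpha>1 * cnj \<beta>1) = 0")
    case True
    show ?thesis
    proof (cases "Im (\<alpha>2 * cnj \<beta>2) = 0")
      case True
      with \<open>Im (\<alpha>1 * cnj \<beta>1) = 0\<close> nz show ?thesis
        unfolding q tame_def using low_degree_real_factors by blast
    next
      case False
      with nz show ?thesis unfolding swap by (intro tame_nonreal_factor)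
    qed
  next
    case False
    with nz show ?thesis unfolding q by (intro tame_nonreal_factor)
  qed
qed

text \<open>A real leading form of nonnegative discriminant has two real factors. Otherwise its
  factors are conjugate, so the second one has no component along the first; this is
  \<open>conic_UV\<close> with parameter zero, whose complement is a disc or empty.\<close>

lemma low_degree_real_conic:
  assumes "a \<in> \<real>" "b \<in> \<real>" "c \<in> \<real>" and nz: "a \<noteq> 0 \<or> b \<noteq> 0 \<or> c \<noteq> 0"
  shows "low_degree_pieces (frontier (improj (conic a b c d e f)))"
proof (cases "a = 0")
  case True
  have "low_degree_pieces (frontier (improj (conic (0 * b) (0 * c + b * 1) (1 * c) d e f)))"
    using assms True by (intro low_degree_real_factors) (auto elim!: Reals_cases)
  then show ?thesis using True by simp
next
  case False
  obtain ra rb rc where r: "a = of_real ra" "b = of_real rb" "c = of_real rc"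
    using assms by (auto elim!: Reals_cases)
  have ra: "ra \<noteq> 0" using False r by simp
  define \<delta> where "\<delta> = rb\<^sup>2 - 4 * ra * rc"
  show ?thesis
  proof (cases "\<delta> \<ge> 0")
    case True
    define s where "s = sqrt \<delta>"
    have s: "s * s = rb * rb - 4 * ra * rc" using True by (simp add: s_def \<delta>_def power2_eq_square)
    have "rc = (rb + s) / 2 * ((rb - s) / (2 * ra))" "rb = ra * ((rb - s) / (2 * ra)) + 1 * ((rb + s) / 2)"
      using ra s by (simp_all add: field_simps)
    then have "c = of_real ((rb + s) / 2) * of_real ((rb - s) / (2 * ra))"
      "b = of_real ra * of_real ((rb - s) / (2 * ra)) + 1 * of_real ((rb + s) / 2)"
      unfolding r by (metis of_real_mult of_real_add mult_1)+
    then have "conic a b c d e f = conic (of_real ra * 1)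
        (of_real ra * of_real ((rb - s) / (2 * ra)) + 1 * of_real ((rb + s) / 2))
        (of_real ((rb + s) / 2) * of_real ((rb - s) / (2 * ra))) d e f" using r by simp
    then show ?thesis
      by (simp only:) (rule low_degree_real_factors; use ra in simp)
  next
    case False
    define s where "s = sqrt (- \<delta>)"
    have s: "s * s = 4 * ra * rc - rb * rb" "s > 0" using False by (simp_all add: s_def \<delta>_def power2_eq_square)
    \<comment> \<open>Chosen so that the form times its conjugate is \<open>a\<close> times the
      leading form; hence the factor \<open>1 / a\<close>.\<close>
    define \<alpha> \<beta> where "\<alpha> = complex_of_real ra" and "\<beta> = Complex (rb / 2) (s / 2)"
    have nr: "Im (\<alpha> * cnj \<beta>) \<noteq> 0" using s ra by (simp add: \<alpha>_def \<beta>_def)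
    have det: "Re \<alpha> * Im \<beta> - Re \<beta> * Im \<alpha> \<noteq> 0" using s ra by (simp add: \<alpha>_def \<beta>_def)
    have B: "1 / a \<noteq> 0" using \<open>a \<noteq> 0\<close> by simp
    have bb: "\<beta> * cnj \<beta> = a * c" "\<beta> + cnj \<beta> = b"
      using s by (simp_all add: \<beta>_def r complex_eq_iff field_simps)
    have "conic a b c d e f z1 z2 = (\<alpha> * z1 + \<beta> * z2) * (0 * (\<alpha> * z1 + \<beta> * z2) + 1 / a * (cnj \<alpha> * z1 + cnj \<beta> * z2))
       + d * z1 + e * z2 + f" for z1 z2
    proof -
      have "(\<alpha> * z1 + \<beta> * z2) * (cnj \<alpha> * z1 + cnj \<beta> * z2) = a * a * z1\<^sup>2 + a * (\<beta> + cnj \<beta>) * z1 * z2 + (\<beta> * cnj \<beta>) * z2\<^sup>2"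
        by (simp add: \<alpha>_def r power2_eq_square algebra_simps)
      also have "\<dots> = a * (a * z1\<^sup>2 + b * z1 * z2 + c * z2\<^sup>2)" unfolding bb by (simp add: algebra_simps)
      finally show ?thesis using \<open>a \<noteq> 0\<close> by (simp add: conic_def)
    qed
    from reduce_UV[OF nr B this] obtain s t \<gamma> where "\<And>z1 z2. conic a b c d e f z1 z2 = 1 / a * conic_UV (0 / (1 / a)) \<gamma>
       (of_real (Re \<alpha>) * z1 + of_real (Re \<beta>) * z2 + s) (of_real (Im \<alpha>) * z1 + of_real (Im \<beta>) * z2 + t)"
      by metis
    from low_degree_affine[where P = "conic a b c d e f" and N = "conic_UV (0 / (1 / a)) \<gamma>", OF det B this]
    show ?thesis by (simp add: low_degree_circle)
  qed
qed

lemma imaginary_projection_conic: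
  "imaginary_projection [:[:f, d, a:], [:e, b:], [:c:]:] = improj (conic a b c d e f)"
  unfolding imaginary_projection_def improj_def conic_def eval2_conic ..

subsection \<open>A conic whose boundary is a line segment\<close>

definition segment_conic :: "complex poly poly" where
  "segment_conic = [:[:- \<i>, 0, 0:], [:0, 1:], [:- \<i>:]:]"

lemma complex_conic_segment: "complex_conic segment_conic"
  unfolding complex_conic_iff segment_conic_def
  by (rule exI[of _ 0], rule exI[of _ 1], rule exI[of _ "- \<i>"], rule exI[of _ 0], rule exI[of _ 0],
      rule exI[of _ "- \<i>"]) simp

text \<open>For \<open>w = Complex x (snd y)\<close> as second coordinate, the equation gives the
  first as \<open>\<i> / w + \<i> * w\<close>.\<close>

lemma segment_conic_mem:
  assumes "x \<noteq> 0 \<or> snd y \<noteq> 0" "fst y = x / (x\<^sup>2 + (snd y)\<^sup>2) + x"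
  shows "y \<in> imaginary_projection segment_conic"
proof -
  define w where "w = Complex x (snd y)"
  have w: "w \<noteq> 0" using assms(1) by (auto simp: w_def complex_eq_iff)
  define z where "z = \<i> / w + \<i> * w"
  have "conic 0 1 (- \<i>) 0 0 (- \<i>) z w = 0"
    using w by (simp add: conic_def z_def power2_eq_square field_simps)
  then have "(Im z, Im w) \<in> improj (conic 0 1 (- \<i>) 0 0 (- \<i>))" by (rule improjI)
  moreover have "Im z = fst y" unfolding assms(2) by (simp add: z_def w_def Im_divide Re_divide)
  ultimately show ?thesis
    unfolding segment_conic_def imaginary_projection_conic by (simp add: w_def)
qed

text \<open>For \<open>snd y \<noteq> 0\<close> the required imaginary part is a continuous function
  of \<open>x\<close> at least as large in modulus as \<open>x\<close>, so it attains every value.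
  For \<open>snd y = 0\<close> it is \<open>x + 1 / x\<close>, of modulus at least two.\<close>

lemma segment_conic_iff:
  "y \<in> imaginary_projection segment_conic \<longleftrightarrow> snd y \<noteq> 0 \<or> \<bar>fst y\<bar> \<ge> 2"
proof (cases "snd y = 0")
  case False
  define g where "g = (\<lambda>x. x / (x\<^sup>2 + (snd y)\<^sup>2) + x)"
  have g: "x \<ge> 0 \<Longrightarrow> g x \<ge> x" "x \<le> 0 \<Longrightarrow> g x \<le> x" for x
    unfolding g_def by (auto simp: divide_nonpos_nonneg)
  have "x\<^sup>2 + (snd y)\<^sup>2 \<noteq> 0" for x using False by (simp add: sum_power2_eq_zero_iff)
  then have "continuous_on {- \<bar>fst y\<bar>..\<bar>fst y\<bar>} g" unfolding g_def by (intro continuous_intros) auto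
  moreover have "g (- \<bar>fst y\<bar>) \<le> fst y" "fst y \<le> g \<bar>fst y\<bar>"
    using g(1)[of "\<bar>fst y\<bar>"] g(2)[of "- \<bar>fst y\<bar>"] by auto
  ultimately obtain x where "g x = fst y" using IVT'[of g "- \<bar>fst y\<bar>" "fst y" "\<bar>fst y\<bar>"] by auto
  then show ?thesis using segment_conic_mem[of x y] False by (simp add: g_def)
next
  case True
  have "y \<in> imaginary_projection segment_conic \<longleftrightarrow> \<bar>fst y\<bar> \<ge> 2"
  proof
    assume "y \<in> imaginary_projection segment_conic"
    then obtain z w where zw: "y = (Im z, Im w)" "conic 0 1 (- \<i>) 0 0 (- \<i>) z w = 0"
      unfolding segment_conic_def imaginary_projection_conic improj_def by blast
    define x where "x = Re w"
    have w: "w = of_real x" using True zw(1) by (simp add: x_def complex_eq_iff)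
    have "x * Im z = x * x + 1"
      using arg_cong[OF zw(2), of Im] unfolding w by (simp add: conic_def power2_eq_square algebra_simps)
    moreover have "(\<bar>x\<bar> - 1)\<^sup>2 \<ge> 0" by simp
    ultimately have "\<bar>x\<bar> * \<bar>Im z\<bar> \<ge> 2 * \<bar>x\<bar>"
      unfolding abs_mult[symmetric] by (simp add: power2_eq_square algebra_simps)
    moreover have "x \<noteq> 0" using \<open>x * Im z = x * x + 1\<close> by auto
    ultimately show "\<bar>fst y\<bar> \<ge> 2" by (simp add: zw(1))
  next
    assume y: "\<bar>fst y\<bar> \<ge> 2"
    define s where "s = sqrt ((fst y)\<^sup>2 - 4)"
    have "(fst y)\<^sup>2 \<ge> 4" using power_mono[OF y, of 2] by simp
    then have s: "s * s = fst y * fst y - 4" by (simp add: s_def power2_eq_square)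
    define x where "x = (fst y + s) / 2"
    have x: "x * x + 1 = fst y * x" using s by (simp add: x_def field_simps)
    then have "x \<noteq> 0" by auto
    then have "fst y = x / x\<^sup>2 + x" using x by (simp add: power2_eq_square field_simps)
    then show "y \<in> imaginary_projection segment_conic"
      using segment_conic_mem[of x y] \<open>x \<noteq> 0\<close> True by simp
  qed
  then show ?thesis using True by simp
qed

text \<open>A polynomial vanishing on a segment vanishes on the whole line, but
  \<open>(3, 0)\<close> is not a boundary point.\<close>

lemma segment_conic_not_algebraic:
  "\<not> algebraic_set (frontier (imaginary_projection segment_conic))"
proof
  let ?S = "imaginary_projection segment_conic"
  assume "algebraic_set (frontier ?S)"
  then obtain F :: "real poly poly set" where F: "frontier ?S = {(x, y). \<forall>f\<in>F. eval2 f x y = 0}"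
    unfolding algebraic_set_def by blast
  have "frontier ?S \<subseteq> - {y. 2 < \<bar>fst y\<bar>}"
    by (intro frontier_subset_complement_open open_Collect_less continuous_intros)
       (auto simp: segment_conic_iff)
  then have "(3, 0) \<notin> frontier ?S" by auto
  then obtain f where f: "f \<in> F" "eval2 f 3 0 \<noteq> 0" unfolding F by auto
  have "(t, 0) \<in> frontier ?S" if "t \<in> {0..1}" for t
  proof -
    have "(t, 0) \<in> closure ?S"
      unfolding closure_approachable
    proof (intro allI impI)
      fix e :: real assume "e > 0"
      then show "\<exists>z\<in>?S. dist z (t, 0) < e"
        by (intro bexI[of _ "(t, e / 2)"]) (auto simp: segment_conic_iff dist_Pair_Pair dist_real_def)
    qed
    moreover have "(t, 0) \<in> - ?S" using that by (auto simp: segment_conic_iff)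
    ultimately show ?thesis using closure_subset[of "- ?S"] by (auto simp: frontier_closures)
  qed
  then have "{0..1} \<subseteq> {t. poly (poly f [:0:]) t = 0}"
    using f(1) unfolding F by (auto simp: eval2_def)
  then have "infinite {t. poly (poly f [:0:]) t = 0}"
    by (rule infinite_super) (simp add: infinite_Icc)
  then have "poly f [:0:] = 0" using poly_roots_finite by blast
  with f(2) show False by (simp add: eval2_def)
qed

subsection \<open>A conic whose boundary is Zariski dense in an irreducible curve of degree eight\<close>

definition octic_conic :: "complex poly poly" where
  "octic_conic = [:[:1, 0, 1:], [:0, 0:], [:2 * \<i>:]:]"

text \<open>The relation between the coordinates after eliminating \<open>j\<close> from
  \<open>x\<^sup>2 * (1 + j)\<^sup>2 = 1 - j\<close> and \<open>y ^ 4 * (1 + j) ^ 4 = j ^ 3\<close>.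
  It is normalized to be monic in the outer variable, so that division by it needs no
  denominators.\<close>

definition octic :: "real poly poly" where
  "octic = [:[:0, 0, - 1/16, 0, 3/16, 0, - 3/16, 0, 1/16:], 0, 0, 0, [:- 1/16, 0, 5/4, 0, 1/2:], 0, 0, 0, 1:]"

lemma eval2_octic:
  "16 * eval2 octic x y = 16 * y ^ 8 + y ^ 4 * (8 * x ^ 4 + 20 * x\<^sup>2 - 1) + x\<^sup>2 * (x\<^sup>2 - 1) ^ 3"
  by (simp add: eval2_def octic_def eval_nat_numeral algebra_simps)

lemma degree_octic: "degree octic = 8" and lead_coeff_octic: "coeff octic 8 = 1"
  by (simp_all add: octic_def eval_nat_numeral)

lemma total_degree_octic: "total_degree octic = 8"
proof (rule antisym)
  show "total_degree octic \<le> 8"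
    by (auto simp: total_degree_le_iff octic_def coeff_pCons one_pCons split: nat.split_asm)
  show "8 \<le> total_degree octic"
    using total_degree_ge[of octic 8 0] by (simp add: lead_coeff_octic)
qed

lemma complex_conic_octic: "complex_conic octic_conic"
  unfolding complex_conic_iff octic_conic_def
  by (rule exI[of _ 1], rule exI[of _ 0], rule exI[of _ "2 * \<i>"], rule exI[of _ 0], rule exI[of _ 0],
      rule exI[of _ 1]) simp

definition octic_curve :: "(real \<times> real) set" where
  "octic_curve = {(x, y). eval2 octic x y = 0}"

definition octic_point :: "real \<Rightarrow> real \<times> real" where
  "octic_point k = (sqrt (1 - k ^ 4) / (1 + k ^ 4), k ^ 3 / (1 + k ^ 4))"

abbreviation "octic_proj \<equiv> imaginary_projection octic_conic"

lemma octic_proj_eq: "octic_proj = improj (conic 1 0 (2 * \<i>) 0 0 1)"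
  unfolding octic_conic_def by (rule imaginary_projection_conic)

lemma nonvanishing_octic: "nonvanishing_form 1 0 (2 * \<i>)"
  unfolding nonvanishing_form_def
proof (intro allI impI notI)
  fix x1 x2 :: real
  assume x: "(x1, x2) \<noteq> (0, 0)"
    and "1 * complex_of_real x1 ^ 2 + 0 * of_real x1 * of_real x2 + 2 * \<i> * of_real x2 ^ 2 = 0"
  then have "Re (complex_of_real (x1\<^sup>2) + 2 * \<i> * complex_of_real (x2\<^sup>2)) = 0"
    "Im (complex_of_real (x1\<^sup>2) + 2 * \<i> * complex_of_real (x2\<^sup>2)) = 0" by simp_all
  then show False using x by simp
qed

lemma closed_octic_proj: "closed octic_proj"
  unfolding octic_proj_eq by (rule closed_improj_conic[OF nonvanishing_octic])

text \<open>The gradient is \<open>(2 * z1, 4 * \<i> * z2)\<close>, so tangency reads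
  \<open>x1 * x2 + y1 * y2 = 0\<close>. The parameter is the common ratio
  \<open>r = x1 / y1 = - y2 / x2\<close>.\<close>

lemma octic_frontier_parametrization:
  assumes "y \<in> frontier octic_proj"
  obtains r where "(1 + r\<^sup>2)\<^sup>2 * (fst y)\<^sup>2 = 1 - r\<^sup>2" "(1 + r\<^sup>2)\<^sup>2 * (snd y)\<^sup>2 = - (r ^ 3)"
proof -
  obtain z1 z2 where z: "y = (Im z1, Im z2)" "conic 1 0 (2 * \<i>) 0 0 1 z1 z2 = 0"
    "Im ((2 * 1 * z1 + 0 * z2 + 0) * cnj (0 * z1 + 2 * (2 * \<i>) * z2 + 0)) = 0"
    using frontier_improj_conic[OF nonvanishing_octic] assms[unfolded octic_proj_eq] by blast
  define x1 y1 x2 y2 where "x1 = Re z1" and "y1 = Im z1" and "x2 = Re z2" and "y2 = Im z2"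
  have "Re (conic 1 0 (2 * \<i>) 0 0 1 z1 z2) = 0" "Im (conic 1 0 (2 * \<i>) 0 0 1 z1 z2) = 0"
    using z(2) by simp_all
  then have e1: "x1\<^sup>2 - y1\<^sup>2 - 4 * (x2 * y2) + 1 = 0" and e2: "x1 * y1 + x2\<^sup>2 - y2\<^sup>2 = 0"
    by (simp_all add: conic_def power2_eq_square x1_def y1_def x2_def y2_def algebra_simps)
  have e3: "x1 * x2 + y1 * y2 = 0"
    using z(3) by (simp add: x1_def y1_def x2_def y2_def algebra_simps)
  show thesis
  proof (cases "y1 = 0")
    \<comment> \<open>The ratio is undefined here, but the equations force
      \<open>4 * y2\<^sup>2 = 1\<close>, which fits the parameter \<open>- 1\<close>.\<close>
    case True
    then have "x2\<^sup>2 = y2\<^sup>2" "x1 * x2 = 0" using e2 e3 by auto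
    have "4 * (x2 * y2) = x1\<^sup>2 + 1" using e1 True by simp
    then have "x2 * y2 > 0" using zero_le_power2[of x1] by linarith
    then have "x2 = y2" using \<open>x2\<^sup>2 = y2\<^sup>2\<close> by (auto simp: power2_eq_iff mult_less_0_iff zero_less_mult_iff)
    moreover have "x1 = 0" using \<open>x1 * x2 = 0\<close> \<open>x2 * y2 > 0\<close> by auto
    ultimately have "4 * y2\<^sup>2 = 1" using e1 True by (simp add: power2_eq_square)
    then show thesis using that[of "- 1"] True by (simp add: z(1) flip: y1_def y2_def)
  next
    case False
    define r where "r = x1 / y1"
    have x1: "x1 = r * y1" using False by (simp add: r_def)
    have "y1 * (r * x2 + y2) = 0" using e3 unfolding x1 by (simp add: algebra_simps)
    then have y2: "y2 = - r * x2" using False by auto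
    have a: "(r\<^sup>2 - 1) * x2\<^sup>2 = r * y1\<^sup>2"
      using e2 unfolding x1 y2 by (simp add: power2_eq_square algebra_simps)
    have b: "(r\<^sup>2 - 1) * y1\<^sup>2 + 4 * r * x2\<^sup>2 + 1 = 0"
      using e1 unfolding x1 y2 by (simp add: power2_eq_square algebra_simps)
    have 1: "(1 + r\<^sup>2)\<^sup>2 * y1\<^sup>2 = 1 - r\<^sup>2" using a b by algebra
    have "r\<^sup>2 - 1 \<noteq> 0" using 1 False by auto
    moreover have "(r\<^sup>2 - 1) * ((1 + r\<^sup>2)\<^sup>2 * y2\<^sup>2) = (r\<^sup>2 - 1) * (- (r ^ 3))"
      unfolding y2 using a 1 by algebra
    ultimately have "(1 + r\<^sup>2)\<^sup>2 * y2\<^sup>2 = - (r ^ 3)" by (metis mult_left_cancel)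
    with 1 show thesis using that[of r] by (simp add: z(1) flip: y1_def y2_def)
  qed
qed

lemma octic_curveI:
  assumes r: "(1 + r\<^sup>2)\<^sup>2 * (fst y)\<^sup>2 = 1 - r\<^sup>2" "(1 + r\<^sup>2)\<^sup>2 * (snd y)\<^sup>2 = - (r ^ 3)"
  shows "y \<in> octic_curve"
proof -
  define u v j where "u = (snd y)\<^sup>2" and "v = (fst y)\<^sup>2" and "j = r\<^sup>2"
  define s where "s = (1 + j)\<^sup>2"
  have v: "s * v = 1 - j" using r(1) by (simp add: s_def v_def j_def)
  have "s * u = - (r ^ 3)" using r(2) by (simp add: s_def u_def j_def)
  then have "(s * u)\<^sup>2 = j ^ 3" by (simp add: j_def flip: power_mult)
  then have u: "s\<^sup>2 * u\<^sup>2 = j ^ 3" by (simp add: power_mult_distrib)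
  have "1 + j \<noteq> 0" using zero_le_power2[of r] unfolding j_def by linarith
  then have s: "s ^ 4 \<noteq> 0" by (simp add: s_def)
  have "s ^ 4 * (16 * u ^ 4 + u\<^sup>2 * (8 * v\<^sup>2 + 20 * v - 1) + v * (v - 1) ^ 3)
     = 16 * (s\<^sup>2 * u\<^sup>2)\<^sup>2 + (s\<^sup>2 * u\<^sup>2) * (8 * (s * v)\<^sup>2 + 20 * (s * v) * s - s\<^sup>2) + (s * v) * (s * v - s) ^ 3"
    by (simp add: power2_eq_square power3_eq_cube power4_eq_xxxx algebra_simps)
  also have "\<dots> = 0"
    unfolding u v unfolding s_def by (simp add: power2_eq_square power3_eq_cube algebra_simps)
  finally have "16 * u ^ 4 + u\<^sup>2 * (8 * v\<^sup>2 + 20 * v - 1) + v * (v - 1) ^ 3 = 0" using s by simp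
  then have "16 * eval2 octic (fst y) (snd y) = 0"
    unfolding eval2_octic u_def v_def by (simp flip: power_mult)
  then show ?thesis by (simp add: octic_curve_def case_prod_beta)
qed

lemma octic_frontier_subset: "frontier octic_proj \<subseteq> octic_curve"
  using octic_frontier_parametrization octic_curveI by blast

lemma octic_point_curve:
  assumes "k \<in> {0<..<1}"
  shows "octic_point k \<in> octic_curve"
proof (rule octic_curveI[of "- k\<^sup>2"])
  have "k ^ 4 \<le> 1" using assms by (simp add: power_le_one)
  moreover have "1 + k ^ 4 \<noteq> 0" by (rule less_imp_neq[symmetric]) (simp add: add_pos_nonneg)
  moreover have "(- k\<^sup>2)\<^sup>2 = k ^ 4" "- ((- k\<^sup>2) ^ 3) = (k ^ 3)\<^sup>2" by (simp_all flip: power_mult)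
  ultimately show "(1 + (- k\<^sup>2)\<^sup>2)\<^sup>2 * (fst (octic_point k))\<^sup>2 = 1 - (- k\<^sup>2)\<^sup>2"
    "(1 + (- k\<^sup>2)\<^sup>2)\<^sup>2 * (snd (octic_point k))\<^sup>2 = - ((- k\<^sup>2) ^ 3)"
    by (simp_all add: octic_point_def power_divide)
qed

text \<open>The origin is not in the projection and \<open>(1, m)\<close> is, so the segment between
  them contains a boundary point. Different slopes \<open>m\<close> give different points.\<close>

lemma octic_frontier_infinite:
  "infinite (octic_point ` {k \<in> {0<..<1}. octic_point k \<in> frontier octic_proj})"
proof
  let ?K = "octic_point ` {k \<in> {0<..<1}. octic_point k \<in> frontier octic_proj}"
  assume fin: "finite ?K"
  have "{0<..} \<subseteq> (\<lambda>y. snd y / fst y) ` ?K"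
  proof
    fix m :: real assume "m \<in> {0<..}"
    then have m: "m > 0" by simp
    have "(0, 0) \<notin> octic_proj"
    proof
      assume "(0, 0) \<in> octic_proj"
      then obtain z1 z2 where "Im z1 = 0" "Im z2 = 0" "conic 1 0 (2 * \<i>) 0 0 1 z1 z2 = 0"
        unfolding octic_proj_eq improj_def by auto
      then have "Re z1 * Re z1 + 1 = 0" by (simp add: conic_def complex_eq_iff power2_eq_square)
      then show False using zero_le_square[of "Re z1"] by linarith
    qed
    then have 0: "(0, 0) \<notin> frontier octic_proj"
      using closed_octic_proj frontier_subset_closed by blast
    have "(1, m) \<in> octic_proj"
    proof -
      \<comment> \<open>For imaginary parts \<open>1\<close> and \<open>m\<close>, the imaginary
        part of the equation gives \<open>m * m - x * x\<close> as the real part of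
        \<open>z1\<close>; the real part of the equation then is \<open>g x = 0\<close>.\<close>
      define g where "g = (\<lambda>x. (m * m - x * x) * (m * m - x * x) - 4 * m * x)"
      have "g m \<le> 0" by (simp add: g_def)
      moreover have "0 \<le> g (m + 2)" using m by (simp add: g_def algebra_simps)
      moreover have "continuous_on {m..m + 2} g" unfolding g_def by (intro continuous_intros)
      ultimately obtain x where x: "g x = 0" using IVT'[of g m 0 "m + 2"] by auto
      have "conic 1 0 (2 * \<i>) 0 0 1 (Complex (m * m - x * x) 1) (Complex x m) = 0"
        using x by (simp add: conic_def g_def complex_eq_iff power2_eq_square algebra_simps)
      from improjI[of "conic 1 0 (2 * \<i>) 0 0 1", OF this] show ?thesis
        unfolding octic_proj_eq by simp
    qed
    have "closed_segment (0, 0) (1, m) \<inter> frontier octic_proj \<noteq> {}"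
      by (rule connected_Int_frontier)
         (use \<open>(1, m) \<in> octic_proj\<close> \<open>(0, 0) \<notin> octic_proj\<close> in auto)
    then obtain y where y: "y \<in> closed_segment (0, 0) (1, m)" "y \<in> frontier octic_proj" by blast
    then obtain t where t: "y = (t, t * m)" "0 \<le> t" "t \<le> 1"
      by (auto simp: closed_segment_def)
    have "t \<noteq> 0" using 0 y(2) t(1) by auto
    then have t0: "t > 0" using t by simp
    obtain r where r: "(1 + r\<^sup>2)\<^sup>2 * t\<^sup>2 = 1 - r\<^sup>2" "(1 + r\<^sup>2)\<^sup>2 * (t * m)\<^sup>2 = - (r ^ 3)"
      using octic_frontier_parametrization[OF y(2)] t(1) by auto
    have pos: "1 + r\<^sup>2 > 0" by (simp add: add_pos_nonneg)
    have "- (r ^ 3) > 0" unfolding r(2)[symmetric] using pos t0 m by simp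
    then have r_neg: "r < 0" by (simp add: power_less_zero_eq)
    have "1 - r\<^sup>2 > 0" unfolding r(1)[symmetric] using pos t0 by simp
    \<comment> \<open>Positive coordinates force \<open>r\<close> to lie between \<open>- 1\<close>
      and \<open>0\<close>, so that \<open>r = - k\<^sup>2\<close> with \<open>k\<close> in the unit
      interval.\<close>
    define k where "k = sqrt (- r)"
    have k0: "k > 0" using r_neg by (simp add: k_def)
    have k2: "k\<^sup>2 = - r" using r_neg by (simp add: k_def)
    have k4: "k ^ 4 = r\<^sup>2"
    proof -
      have "k ^ 4 = (k\<^sup>2)\<^sup>2" by (simp flip: power_mult)
      then show ?thesis by (simp add: k2)
    qed
    have k6: "(k ^ 3)\<^sup>2 = - (r ^ 3)"
    proof -
      have "(k ^ 3)\<^sup>2 = (k\<^sup>2) ^ 3" by (simp flip: power_mult)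
      then show ?thesis by (simp add: k2)
    qed
    have "k < 1"
    proof (rule ccontr)
      assume "\<not> k < 1"
      then have "1 \<le> k ^ 4" by (simp add: one_le_power)
      with \<open>1 - r\<^sup>2 > 0\<close> k4 show False by simp
    qed
    have "sqrt (1 - k ^ 4) = (1 + k ^ 4) * t"
      using pos t0 by (intro real_sqrt_unique) (auto simp: k4 r(1)[symmetric] power_mult_distrib)
    moreover have "k ^ 3 = (1 + k ^ 4) * (t * m)"
    proof -
      have "(k ^ 3)\<^sup>2 = ((1 + k ^ 4) * (t * m))\<^sup>2"
        unfolding k6 r(2)[symmetric] k4 by (simp add: power_mult_distrib)
      then show ?thesis using k0 t0 m pos by (subst (asm) power2_eq_iff_nonneg) (auto simp: k4)
    qed
    ultimately have pt: "octic_point k = y"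
      using pos by (simp add: octic_point_def t(1) k4)
    then have "y \<in> ?K" using k0 \<open>k < 1\<close> y(2) by (intro image_eqI[of _ _ k]) auto
    moreover have "m = snd y / fst y" using t0 by (simp add: t(1))
    ultimately show "m \<in> (\<lambda>y. snd y / fst y) ` ?K" by blast
  qed
  then have "finite {0::real<..}" using fin finite_subset by blast
  then show False using infinite_Ioi by blast
qed

lemma octic_parameters_infinite: "infinite {k \<in> {0<..<1}. octic_point k \<in> frontier octic_proj}"
  using octic_frontier_infinite finite_imageI by blast

subsection \<open>Divisibility by the octic\<close>

text \<open>Complex evaluation is needed because some of the eight values of \<open>y\<close> over a
  real \<open>x\<close> are not real.\<close>

definition ceval :: "real poly poly \<Rightarrow> complex \<Rightarrow> complex \<Rightarrow> complex" where
  "ceval p x y = poly (map_poly (\<lambda>c. poly (map_poly of_real c) x) p) y"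

lemma ceval_pCons: "ceval (pCons c p) x y = poly (map_poly of_real c) x + y * ceval p x y"
  by (simp add: ceval_def map_poly_pCons)

lemma poly_map_poly_of_real: "poly (map_poly of_real c) (of_real x) = (of_real (poly c x) :: complex)"
  by (induction c) (simp_all add: map_poly_pCons)

lemma ceval_of_real: "ceval p (of_real x) (of_real y) = of_real (eval2 p x y)"
  by (induction p) (simp_all add: ceval_pCons eval2_def poly_map_poly_of_real, simp add: ceval_def)

text \<open>Here $b$ stands for a square root of $1 - k^4$.\<close>

definition octic_normal :: "(complex \<Rightarrow> complex \<Rightarrow> complex) \<Rightarrow> bool" where
  "octic_normal F \<longleftrightarrow> (\<exists>N A B. \<forall>k b. b\<^sup>2 = 1 - k ^ 4 \<longrightarrow> 1 + k ^ 4 \<noteq> 0 \<longrightarrow>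
     (1 + k ^ 4) ^ N * F (b / (1 + k ^ 4)) (k ^ 3 / (1 + k ^ 4)) = poly A k + b * poly B k)"

lemma octic_normal_const: "octic_normal (\<lambda>_ _. c)"
  unfolding octic_normal_def by (intro exI[of _ 0] exI[of _ "[:c:]"]) auto

lemma octic_normal_add:
  assumes "octic_normal F" "octic_normal G"
  shows "octic_normal (\<lambda>x y. F x y + G x y)"
proof -
  obtain N A B where F: "\<And>k b. b\<^sup>2 = 1 - k ^ 4 \<Longrightarrow> 1 + k ^ 4 \<noteq> 0 \<Longrightarrow>
     (1 + k ^ 4) ^ N * F (b / (1 + k ^ 4)) (k ^ 3 / (1 + k ^ 4)) = poly A k + b * poly B k"
    using assms(1) unfolding octic_normal_def by blast
  obtain M C D where G: "\<And>k b. b\<^sup>2 = 1 - k ^ 4 \<Longrightarrow> 1 + k ^ 4 \<noteq> 0 \<Longrightarrow>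
     (1 + k ^ 4) ^ M * G (b / (1 + k ^ 4)) (k ^ 3 / (1 + k ^ 4)) = poly C k + b * poly D k"
    using assms(2) unfolding octic_normal_def by blast
  define d where "d = (1 + monom 1 4 :: complex poly)"
  have d: "poly d k = 1 + k ^ 4" for k by (simp add: d_def poly_monom)
  show ?thesis unfolding octic_normal_def
  proof (intro exI allI impI)
    fix k b :: complex assume kb: "b\<^sup>2 = 1 - k ^ 4" "1 + k ^ 4 \<noteq> 0"
    let ?x = "b / (1 + k ^ 4)" and ?y = "k ^ 3 / (1 + k ^ 4)"
    have "(1 + k ^ 4) ^ (N + M) * (F ?x ?y + G ?x ?y)
        = (1 + k ^ 4) ^ M * ((1 + k ^ 4) ^ N * F ?x ?y) + (1 + k ^ 4) ^ N * ((1 + k ^ 4) ^ M * G ?x ?y)"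
      by (simp only: power_add distrib_left mult_ac)
    also have "\<dots> = poly (d ^ M * A + d ^ N * C) k + b * poly (d ^ M * B + d ^ N * D) k"
      unfolding F[OF kb] G[OF kb] by (simp add: d algebra_simps)
    finally show "(1 + k ^ 4) ^ (N + M) * (F ?x ?y + G ?x ?y)
        = poly (d ^ M * A + d ^ N * C) k + b * poly (d ^ M * B + d ^ N * D) k" .
  qed
qed

lemma octic_normal_mult_x:
  assumes "octic_normal F"
  shows "octic_normal (\<lambda>x y. x * F x y)"
proof -
  obtain N A B where F: "\<And>k b. b\<^sup>2 = 1 - k ^ 4 \<Longrightarrow> 1 + k ^ 4 \<noteq> 0 \<Longrightarrow>
     (1 + k ^ 4) ^ N * F (b / (1 + k ^ 4)) (k ^ 3 / (1 + k ^ 4)) = poly A k + b * poly B k"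
    using assms unfolding octic_normal_def by blast
  show ?thesis unfolding octic_normal_def
  proof (intro exI allI impI)
    fix k b :: complex assume kb: "b\<^sup>2 = 1 - k ^ 4" "1 + k ^ 4 \<noteq> 0"
    let ?x = "b / (1 + k ^ 4)" and ?y = "k ^ 3 / (1 + k ^ 4)"
    have "(1 + k ^ 4) ^ Suc N * (?x * F ?x ?y) = b * ((1 + k ^ 4) ^ N * F ?x ?y)"
      using kb(2) by simp
    also have "\<dots> = b\<^sup>2 * poly B k + b * poly A k"
      unfolding F[OF kb] by (simp add: power2_eq_square algebra_simps)
    also have "\<dots> = poly ((1 - monom 1 4) * B) k + b * poly A k"
      unfolding kb(1) by (simp add: poly_monom)
    finally show "(1 + k ^ 4) ^ Suc N * (?x * F ?x ?y) = poly ((1 - monom 1 4) * B) k + b * poly A k" .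
  qed
qed

lemma octic_normal_mult_y:
  assumes "octic_normal F"
  shows "octic_normal (\<lambda>x y. y * F x y)"
proof -
  obtain N A B where F: "\<And>k b. b\<^sup>2 = 1 - k ^ 4 \<Longrightarrow> 1 + k ^ 4 \<noteq> 0 \<Longrightarrow>
     (1 + k ^ 4) ^ N * F (b / (1 + k ^ 4)) (k ^ 3 / (1 + k ^ 4)) = poly A k + b * poly B k"
    using assms unfolding octic_normal_def by blast
  show ?thesis unfolding octic_normal_def
  proof (intro exI allI impI)
    fix k b :: complex assume kb: "b\<^sup>2 = 1 - k ^ 4" "1 + k ^ 4 \<noteq> 0"
    let ?x = "b / (1 + k ^ 4)" and ?y = "k ^ 3 / (1 + k ^ 4)"
    have "(1 + k ^ 4) ^ Suc N * (?y * F ?x ?y) = k ^ 3 * ((1 + k ^ 4) ^ N * F ?x ?y)"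
      using kb(2) by simp
    also have "\<dots> = poly (monom 1 3 * A) k + b * poly (monom 1 3 * B) k"
      unfolding F[OF kb] by (simp add: poly_monom algebra_simps)
    finally show "(1 + k ^ 4) ^ Suc N * (?y * F ?x ?y) = poly (monom 1 3 * A) k + b * poly (monom 1 3 * B) k" .
  qed
qed

text \<open>Horner's scheme in both variables reduces this to the closure properties of
  \<open>octic_normal\<close>.\<close>

lemma octic_normal_ceval: "octic_normal (ceval p)"
proof (induction p)
  case 0
  then show ?case using octic_normal_const[of 0] by (simp add: ceval_def[abs_def])
next
  case (pCons c p)
  have "octic_normal (\<lambda>x y. poly (map_poly of_real c) x)"
  proof (induction c)
    case 0
    then show ?case using octic_normal_const[of 0] by simp
  next
    case (pCons a c)
    then show ?case
      using octic_normal_add[OF octic_normal_const octic_normal_mult_x] by (simp add: map_poly_pCons)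
  qed
  from octic_normal_add[OF this octic_normal_mult_y[OF pCons.IH]]
  show ?case by (simp add: ceval_pCons[abs_def])
qed

text \<open>
  Here $1 - k^4$ is not a square, so that $A(k) + B(k) \sqrt{1 - k^4} = 0$
  for infinitely many $k$ forces $A = B = 0$.
\<close>

lemma ceval_octic_point_eq_0:
  assumes inf: "infinite {k \<in> {0<..<1}. eval2 p (fst (octic_point k)) (snd (octic_point k)) = 0}" (is "infinite ?K")
    and kb: "b\<^sup>2 = 1 - k ^ 4" "1 + k ^ 4 \<noteq> 0"
  shows "ceval p (b / (1 + k ^ 4)) (k ^ 3 / (1 + k ^ 4)) = 0"
proof -
  obtain N A B where F: "\<And>k b. b\<^sup>2 = 1 - k ^ 4 \<Longrightarrow> 1 + k ^ 4 \<noteq> 0 \<Longrightarrow>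
     (1 + k ^ 4) ^ N * ceval p (b / (1 + k ^ 4)) (k ^ 3 / (1 + k ^ 4)) = poly A k + b * poly B k"
    using octic_normal_ceval[of p] unfolding octic_normal_def by blast
  \<comment> \<open>This is \<open>1 - x ^ 4\<close> with its simple zero at \<open>1\<close> split
    off.\<close>
  define q :: "complex poly" where "q = [:- 1, 1:] * [:- 1, - 1, - 1, - 1:]"
  have q: "poly q x = 1 - x ^ 4" for x by (simp add: q_def eval_nat_numeral algebra_simps)
  have "of_real ` ?K \<subseteq> {x. poly (A\<^sup>2 - q * B\<^sup>2) x = 0}"
  proof
    fix x :: complex assume "x \<in> of_real ` ?K"
    then obtain t where t: "x = of_real t" "t \<in> ?K" by blast
    define s where "s = complex_of_real (sqrt (1 - t ^ 4))"
    have "t ^ 4 \<le> 1" using t(2) by (simp add: power_le_one)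
    then have s2: "s\<^sup>2 = 1 - x ^ 4"
      unfolding s_def t(1) by (metis diff_ge_0_iff_ge of_real_1 of_real_diff of_real_power real_sqrt_pow2)
    have "1 + x ^ 4 = of_real (1 + t ^ 4)" by (simp add: t(1))
    moreover have "1 + t ^ 4 \<noteq> 0" by (metis add_pos_nonneg less_numeral_extra(1) less_numeral_extra(3) zero_le_even_power even_numeral)
    ultimately have x0: "1 + x ^ 4 \<noteq> 0" by (metis of_real_eq_0_iff)
    have "s / (1 + x ^ 4) = of_real (fst (octic_point t))" "x ^ 3 / (1 + x ^ 4) = of_real (snd (octic_point t))"
      by (simp_all add: octic_point_def s_def t(1))
    then have "ceval p (s / (1 + x ^ 4)) (x ^ 3 / (1 + x ^ 4)) = 0"
      using t(2) by (simp add: ceval_of_real)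
    then have "poly A x = - (s * poly B x)" using F[OF s2 x0] by (simp add: eq_neg_iff_add_eq_0)
    then have "(poly A x)\<^sup>2 = s\<^sup>2 * (poly B x)\<^sup>2" by (simp add: power_mult_distrib)
    then show "x \<in> {x. poly (A\<^sup>2 - q * B\<^sup>2) x = 0}" by (simp add: q s2)
  qed
  moreover have "infinite (of_real ` ?K :: complex set)"
    using inf by (simp add: finite_image_iff inj_on_def)
  ultimately have "A\<^sup>2 - q * B\<^sup>2 = 0" using poly_roots_finite finite_subset by blast
  then have eq: "A * A = q * (B * B)" by (simp add: power2_eq_square)
  have B: "B = 0"
  proof (rule ccontr)
    assume B: "B \<noteq> 0"
    \<comment> \<open>The order of vanishing at \<open>1\<close> is even for \<open>A * A\<close>
      and odd for \<open>q * (B * B)\<close>.\<close>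
    have q0: "q \<noteq> 0" "order 1 q = 1"
    proof -
      have "order 1 [:- 1, 1 :: complex:] = 1" using order_power_n_n[of "1 :: complex" 1] by simp
      moreover have "order 1 [:- 1, - 1, - 1, - 1 :: complex:] = 0" by (rule order_0I) simp
      moreover show "q \<noteq> 0" by (simp add: q_def)
      ultimately show "order 1 q = 1" unfolding q_def by (subst order_mult) auto
    qed
    have "A \<noteq> 0" using eq B q0 by auto
    then have "2 * order 1 A = order 1 (A * A)" by (simp add: order_mult)
    also have "\<dots> = 1 + 2 * order 1 B" unfolding eq using q0 B by (simp add: order_mult)
    finally show False by presburger
  qed
  then have "A = 0" using eq by simp
  with B F[OF kb] kb(2) show ?thesis by simp
qed

text \<open>
  With $j = k^4$ the points of the octic have $x^2 = (1 - j)/(1 + j)^2$ and $y^4 = j^3/(1 + j)^4$. The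
  parameters $j$ and $(j + 3)/(j - 1)$ give the same $x$, hence eight values of $y$ over a general
  $x$, and no nonzero remainder of degree less than $8$ in $y$ vanishes on all of them.
\<close>

lemma octic_dvd:
  assumes inf: "infinite {k \<in> {0<..<1}. eval2 h (fst (octic_point k)) (snd (octic_point k)) = 0}"
  shows "octic dvd h"
proof -
  obtain q r where qr: "pseudo_divmod h octic = (q, r)" by force
  have oct0: "octic \<noteq> 0" by (simp add: octic_def)
  have h: "h = octic * q + r" using pseudo_divmod(1)[OF oct0 qr] by (simp add: degree_octic lead_coeff_octic)
  have deg: "r = 0 \<or> degree r < 8" using pseudo_divmod(2)[OF oct0 qr] by (simp add: degree_octic)
  have oct_pt: "eval2 octic (fst (octic_point k)) (snd (octic_point k)) = 0" if "k \<in> {0<..<1}" for k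
    using octic_point_curve[OF that] by (simp add: octic_curve_def case_prod_beta)
  have "{k \<in> {0<..<1}. eval2 h (fst (octic_point k)) (snd (octic_point k)) = 0}
     \<subseteq> {k \<in> {0<..<1}. eval2 r (fst (octic_point k)) (snd (octic_point k)) = 0}"
    using oct_pt by (auto simp: h)
  then have inf_r: "infinite {k \<in> {0<..<1}. eval2 r (fst (octic_point k)) (snd (octic_point k)) = 0}"
    using inf by (rule infinite_super)
  have van: "ceval r c Y = 0"
    if "j \<noteq> 0" "1 + j \<noteq> 0" "c\<^sup>2 * (1 + j)\<^sup>2 = 1 - j" "Y ^ 4 = j ^ 3 / (1 + j) ^ 4" for j c Y
  proof -
    have Y: "Y \<noteq> 0" using that by auto
    \<comment> \<open>Forced by \<open>k = k ^ 4 / k ^ 3\<close> together with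
      \<open>k ^ 4 = j\<close> and \<open>k ^ 3 = Y * (1 + j)\<close>.\<close>
    define k where "k = j / (Y * (1 + j))"
    have "k ^ 4 = j ^ 4 / (Y ^ 4 * (1 + j) ^ 4)" by (simp add: k_def power_divide power_mult_distrib)
    also have "\<dots> = j" using that by (simp add: eval_nat_numeral)
    finally have k4: "k ^ 4 = j" .
    have "k * k ^ 3 = k ^ 4" by (simp add: eval_nat_numeral)
    moreover have "k \<noteq> 0" using k4 that by auto
    ultimately have "k ^ 3 = j / k" using k4 by (simp add: field_simps)
    also have "\<dots> = Y * (1 + j)" using that Y by (simp add: k_def)
    finally have k3: "k ^ 3 / (1 + k ^ 4) = Y" using that k4 by simp
    have "(c * (1 + j))\<^sup>2 = 1 - k ^ 4" using that k4 by (simp add: power_mult_distrib)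
    from ceval_octic_point_eq_0[OF inf_r this] show ?thesis using that k3 k4 by simp
  qed
  have "coeff r i = 0" for i
  proof -
    define c where "c = (\<lambda>t :: real. sqrt (1 - t) / (1 + t))"
    have root: "poly (coeff r i) (c t) = 0" if t: "t \<in> {0<..<1}" for t
    proof -
      \<comment> \<open>The second root of the quadratic equation
        \<open>c\<^sup>2 * (1 + j)\<^sup>2 = 1 - j\<close> in \<open>j\<close>. It is negative, so
        \<open>w t\<close> and \<open>w t'\<close> have opposite signs and their fourth roots are
        eight distinct numbers.\<close>
      define t' where "t' = (t + 3) / (t - 1)"
      have t'_neg: "t' < 0" using t by (simp add: t'_def divide_pos_neg)
      have t1: "1 + t' = (2 * t + 2) / (t - 1)" using t by (simp add: t'_def field_simps)
      then have t'1: "1 + t' \<noteq> 0" using t by auto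
      have c2: "(c t)\<^sup>2 * (1 + t)\<^sup>2 = 1 - t" using t by (simp add: c_def power_divide)
      have c2': "(c t)\<^sup>2 * (1 + t')\<^sup>2 = 1 - t'"
      proof -
        have "(c t)\<^sup>2 * (1 + t')\<^sup>2 = (c t)\<^sup>2 * (1 + t)\<^sup>2 * 4 / (t - 1)\<^sup>2"
          unfolding t1 by (simp add: power_divide power2_eq_square field_simps)
        also have "\<dots> = (1 - t) * 4 / (t - 1)\<^sup>2" by (simp only: c2)
        also have "\<dots> = 1 - t'" using t by (simp add: t'_def power2_eq_square divide_simps)
        finally show ?thesis .
      qed
      define w where "w = (\<lambda>s :: real. s ^ 3 / (1 + s) ^ 4)"
      have w: "w t > 0" "w t' < 0"
        using t t'_neg t'1 by (auto simp: w_def divide_neg_pos power_less_zero_eq zero_less_power_eq)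
      define R where "R = (\<lambda>s. {Y :: complex. Y ^ 4 = of_real (w s)})"
      define p where "p = map_poly (\<lambda>d. poly (map_poly of_real d) (complex_of_real (c t))) r"
      have zero: "poly p Y = 0" if "Y \<in> R s" "s \<noteq> 0" "1 + s \<noteq> 0" "(c t)\<^sup>2 * (1 + s)\<^sup>2 = 1 - s" for Y s
      proof -
        have "ceval r (of_real (c t)) Y = 0"
        proof (rule van[of "of_real s"])
          show "complex_of_real s \<noteq> 0" using that by simp
          show "1 + complex_of_real s \<noteq> 0" using that(3) by (metis of_real_1 of_real_add of_real_eq_0_iff)
          show "(complex_of_real (c t))\<^sup>2 * (1 + complex_of_real s)\<^sup>2 = 1 - complex_of_real s"
            using arg_cong[OF that(4), of complex_of_real] by simp
          show "Y ^ 4 = complex_of_real s ^ 3 / (1 + complex_of_real s) ^ 4"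
            using that(1) by (simp add: R_def w_def)
        qed
        then show ?thesis by (simp add: ceval_def p_def)
      qed
      have "p = 0"
      proof (rule ccontr)
        assume p: "p \<noteq> 0"
        have "R t \<union> R t' \<subseteq> {Y. poly p Y = 0}"
          using zero[of _ t] zero[of _ t'] t t'_neg t'1 c2 c2' by auto
        then have "card (R t \<union> R t') \<le> card {Y. poly p Y = 0}"
          using p by (intro card_mono poly_roots_finite)
        also have "\<dots> \<le> degree p" using p by (rule card_poly_roots_bound)
        also have "degree p \<le> degree r" by (rule degree_le) (simp add: p_def coeff_map_poly coeff_eq_0)
        finally have "card (R t \<union> R t') \<le> degree r" .
        moreover have "card (R t \<union> R t') = card (R t) + card (R t')"
        proof (rule card_Un_disjoint)
          show "finite (R t)" "finite (R t')" using w by (auto simp: R_def intro!: finite_nth_roots)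
          show "R t \<inter> R t' = {}" using w by (auto simp: R_def)
        qed
        moreover have "card (R t) = 4" "card (R t') = 4"
          using w by (auto simp: R_def intro!: card_nth_roots)
        moreover have "degree r < 8" using deg p by (auto simp: p_def)
        ultimately show False by simp
      qed
      then have "poly (map_poly of_real (coeff r i)) (complex_of_real (c t)) = 0"
        unfolding p_def by (metis coeff_0 coeff_map_poly map_poly_0 poly_0)
      then show ?thesis by (simp add: poly_map_poly_of_real)
    qed
    have "inj_on c {0<..<1}"
    proof (rule linorder_inj_onI')
      fix s t :: real assume "s \<in> {0<..<1}" "t \<in> {0<..<1}" "s < t"
      then have "c t < c s" unfolding c_def by (intro frac_less) auto
      then show "c s \<noteq> c t" by simp
    qed
    then have "infinite (c ` {0<..<1})" by (simp add: finite_image_iff infinite_Ioo)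
    moreover have "c ` {0<..<1} \<subseteq> {x. poly (coeff r i) x = 0}" using root by auto
    ultimately show "coeff r i = 0" using poly_roots_finite finite_subset by blast
  qed
  then have "r = 0" by (intro poly_eqI) simp
  then show ?thesis unfolding h by simp
qed

lemma octic_dvd_vanishing:
  assumes "h \<in> vanishing_ideal (frontier octic_proj)"
  shows "octic dvd h"
  by (rule octic_dvd, rule infinite_super[OF _ octic_parameters_infinite])
     (use assms in \<open>auto simp: vanishing_ideal_def case_prod_beta\<close>)

lemma eval2_dvd: "p dvd q \<Longrightarrow> eval2 p x y = 0 \<Longrightarrow> eval2 q x y = 0"
  by (auto simp: dvd_def)

lemma zariski_closure_octic: "zariski_closure (frontier octic_proj) = octic_curve"
proof (rule antisym)
  show "zariski_closure (frontier octic_proj) \<subseteq> octic_curve"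
    by (intro zariski_closure_minimal octic_frontier_subset) (simp add: octic_curve_def algebraic_zeros)
  show "octic_curve \<subseteq> zariski_closure (frontier octic_proj)"
    unfolding zariski_closure_eq octic_curve_def using octic_dvd_vanishing eval2_dvd by fastforce
qed

text \<open>If two algebraic sets cover the curve, then polynomials \<open>f\<close> and
  \<open>g\<close> defining them share out the parameters in the unit interval. One of them vanishes
  for infinitely many, so it is divisible by the octic and vanishes on the whole curve.\<close>

lemma zariski_irreducible_octic: "zariski_irreducible octic_curve"
  unfolding zariski_irreducible_def
proof (intro conjI allI impI)
  show "octic_curve \<noteq> {}"
    using octic_point_curve[of "1 / 2"] by auto
  fix A B assume A: "algebraic_set A" and B: "algebraic_set B" and AB: "octic_curve \<subseteq> A \<union> B"
  obtain F G where FG: "A = {(x, y). \<forall>f\<in>F. eval2 f x y = 0}" "B = {(x, y). \<forall>f\<in>G. eval2 f x y = 0}"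
    using A B unfolding algebraic_set_def by blast
  show "octic_curve \<subseteq> A \<or> octic_curve \<subseteq> B"
  proof (rule ccontr)
    assume "\<not> ?thesis"
    then obtain a b where "a \<in> octic_curve" "a \<notin> A" "b \<in> octic_curve" "b \<notin> B" by blast
    then obtain f g where ab: "a \<in> octic_curve" "f \<in> F" "eval2 f (fst a) (snd a) \<noteq> 0"
      "b \<in> octic_curve" "g \<in> G" "eval2 g (fst b) (snd b) \<noteq> 0"
      unfolding FG by (auto simp: case_prod_beta)
    let ?K = "\<lambda>h. {k \<in> {0<..<1}. eval2 h (fst (octic_point k)) (snd (octic_point k)) = 0}"
    have "{0<..<1} \<subseteq> ?K f \<union> ?K g"
    proof
      fix k :: real assume k: "k \<in> {0<..<1}"
      then have "octic_point k \<in> A \<union> B" using AB octic_point_curve by blast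
      then show "k \<in> ?K f \<union> ?K g" using k ab by (auto simp: FG case_prod_beta)
    qed
    then have "infinite (?K f \<union> ?K g)"
      by (rule infinite_super) (simp add: infinite_Ioo)
    then have "infinite (?K f) \<or> infinite (?K g)" by blast
    then have "octic dvd f \<or> octic dvd g" using octic_dvd by blast
    then show False using ab eval2_dvd by (fastforce simp: octic_curve_def case_prod_beta)
  qed
qed

text \<open>The octic and the \<open>Gcd\<close> of the vanishing ideal divide each other, so their
  total degrees agree.\<close>

lemma algebraic_degree_octic: "algebraic_degree octic_curve = 8"
proof -
  have Z: "zariski_closure octic_curve = octic_curve"
    by (intro zariski_closure_algebraic) (simp add: octic_curve_def algebraic_zeros)
  have "16 * eval2 octic 0 1 \<noteq> 0" unfolding eval2_octic by simp
  then have "(0, 1) \<notin> octic_curve" by (simp add: octic_curve_def)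
  then have U: "octic_curve \<noteq> UNIV" by blast
  have inf: "infinite octic_curve"
    by (rule infinite_super[OF _ octic_frontier_infinite]) (use octic_frontier_subset in auto)
  have oct0: "octic \<noteq> 0" by (simp add: octic_def)
  let ?G = "Gcd (vanishing_ideal octic_curve)"
  have 1: "?G dvd octic" by (rule Gcd_dvd) (simp add: vanishing_ideal_def octic_curve_def)
  have "octic dvd ?G"
  proof (rule Gcd_greatest)
    fix h assume "h \<in> vanishing_ideal octic_curve"
    then have "h \<in> vanishing_ideal (frontier octic_proj)"
      using octic_frontier_subset by (auto simp: vanishing_ideal_def)
    then show "octic dvd h" by (rule octic_dvd_vanishing)
  qed
  moreover have "?G \<noteq> 0" using 1 oct0 by (metis dvd_0_left)
  ultimately have "total_degree ?G = 8"
    using total_degree_dvd_le[OF 1 oct0] total_degree_dvd_le[of octic ?G] total_degree_octic by simp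
  then show ?thesis using U inf by (simp add: algebraic_degree_def Z)
qed

section \<open>Boundaries for arbitrary and for real conics\<close>

lemma tame_imaginary_projection:
  assumes "complex_conic p"
  shows "tame (imaginary_projection p)"
  using assms tame_conic imaginary_projection_conic unfolding complex_conic_iff by metis

lemma low_degree_real_imaginary_projection:
  assumes "complex_conic p" "\<forall>i j. coeff (coeff p j) i \<in> \<real>"
  shows "low_degree_pieces (frontier (imaginary_projection p))"
proof -
  obtain a b c d e f where nz: "a \<noteq> 0 \<or> b \<noteq> 0 \<or> c \<noteq> 0" and p: "p = [:[:f, d, a:], [:e, b:], [:c:]:]"
    using assms(1) unfolding complex_conic_iff by blast
  have "coeff (coeff p 0) 2 = a" "coeff (coeff p 1) 1 = b" "coeff (coeff p 2) 0 = c"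
    by (simp_all add: p numeral_2_eq_2)
  then have "a \<in> \<real>" "b \<in> \<real>" "c \<in> \<real>" using assms(2) by metis+
  then show ?thesis unfolding p imaginary_projection_conic using nz by (rule low_degree_real_conic)
qed

theorem corollary5p3:
  shows
    "(\<exists>p. complex_conic p \<and> \<not> algebraic_set (frontier (imaginary_projection p))) \<and>
     (\<forall>p. complex_conic p \<longrightarrow>
       (\<forall>Z \<in> irreducible_components (zariski_closure (frontier (imaginary_projection p))).
          algebraic_degree Z \<le> 8)) \<and>
     (\<exists>p. complex_conic p \<and>
       (\<exists>Z \<in> irreducible_components (zariski_closure (frontier (imaginary_projection p))).
          algebraic_degree Z = 8)) \<and>
     (\<forall>p. complex_conic p \<longrightarrow>
       (\<forall>C \<in> components (- imaginary_projection p). \<not> bounded C) \<longrightarrow>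
       algebraic_set (frontier (imaginary_projection p)) \<and>
       (\<forall>Z \<in> irreducible_components (frontier (imaginary_projection p)).
          algebraic_degree Z \<le> 2)) \<and>
     (\<forall>p. complex_conic p \<longrightarrow> (\<forall>i j. coeff (coeff p j) i \<in> \<real>) \<longrightarrow>
       algebraic_set (frontier (imaginary_projection p)) \<and>
       (\<forall>Z \<in> irreducible_components (frontier (imaginary_projection p)).
          algebraic_degree Z \<le> 2))"
proof (intro conjI)
  show "\<exists>p. complex_conic p \<and> \<not> algebraic_set (frontier (imaginary_projection p))"
    using complex_conic_segment segment_conic_not_algebraic by blast
  show "\<forall>p. complex_conic p \<longrightarrow>
       (\<forall>Z \<in> irreducible_components (zariski_closure (frontier (imaginary_projection p))).
          algebraic_degree Z \<le> 8)"
    using tame_imaginary_projection tame_degree by blast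
  have "octic_curve \<in> irreducible_components (zariski_closure (frontier octic_proj))"
    using zariski_irreducible_octic by (auto simp: irreducible_components_def zariski_closure_octic)
  then show "\<exists>p. complex_conic p \<and>
       (\<exists>Z \<in> irreducible_components (zariski_closure (frontier (imaginary_projection p))).
          algebraic_degree Z = 8)"
    using complex_conic_octic algebraic_degree_octic by blast
  show "\<forall>p. complex_conic p \<longrightarrow>
       (\<forall>C \<in> components (- imaginary_projection p). \<not> bounded C) \<longrightarrow>
       algebraic_set (frontier (imaginary_projection p)) \<and>
       (\<forall>Z \<in> irreducible_components (frontier (imaginary_projection p)).
          algebraic_degree Z \<le> 2)"
    using tame_imaginary_projection tame_pieces_of_unbounded_components
      low_degree_pieces_algebraic low_degree_pieces_degree by metis
  show "\<forall>p. complex_conic p \<longrightarrow> (\<forall>i j. coeff (coeff p j) i \<in> \<real>) \<longrightarrow>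
       algebraic_set (frontier (imaginary_projection p)) \<and>
       (\<forall>Z \<in> irreducible_components (frontier (imaginary_projection p)).
          algebraic_degree Z \<le> 2)"
    using low_degree_real_imaginary_projection low_degree_pieces_algebraic low_degree_pieces_degree by metis
qed

end
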